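(* Consider the splitting model in the context, with $\mu_0\in\mathcal P_c(\mathbb R^d)$ absolutely continuous with respect to Lebesgue measure. Let $\mathbf u^\star\in\mathcal U$ with associated flow $\mathbf\Phi^\star$, measure curve $\boldsymbol\mu^\star(t)=\mathbf\Phi^\star(t,\cdot)_\#\mu_0$ and controlled trajectory $\mathbf y^\star=(\mathbf y^\star_1,\dots,\mathbf y^\star_M)$. Let $\mathcal T$ be the unique optimal transport map from $\boldsymbol\mu^\star(T)$ to $\hat\mu$, and let $(\mathbf p^\star,\mathbf q^\star)$, with $\mathbf p^\star(t)\in L^2(\mathbb R^d,\mathbb R^d;\mu_0)$, $\mathbf q^\star(t)=(\mathbf q^\star_1(t),\dots,\mathbf q^\star_M(t))\in(\mathbb R^d)^M$, be the unique solution on $[0,T]$ of the backward system $-\partial_tp(t,x)=-\int DK(\zeta-\mathbf\Phi^\star(t,x))^\top p(t,x)\,d\boldsymbol\mu^\star(t)(\zeta)-\frac1M\sum_{m=1}^MDf(\mathbf y^\star_m(t)-\mathbf\Phi^\star(t,x))^\top p(t,x)+\int DK(\mathbf\Phi^\star(t,\zeta)-\mathbf\Phi^\star(t,x))^\top p(t,\zeta)\,d\mu_0(\zeta),$ $-\dot q_m(t)=\frac1M\int Df(\mathbf y^\star_m(t)-\mathbf\Phi^\star(t,\zeta))^\top p(t,\zeta)\,d\mu_0(\zeta)+\frac1M\sum_{j=1}^MDg(\mathbf y^\star_j(t)-\mathbf y^\star_m(t))^\top(q_j(t)-q_m(t)),\quad m=1,\dots,M,$ with $p(T,\cdot)=\mathbf\Phi^\star(T,\cdot)-\mathcal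 T(\mathbf\Phi^\star(T,\cdot))$ and $q(T)=0$. Then for every $\delta\mathbf u\in L^2([0,T],(\mathbb R^d)^M)$ with $\mathbf u^\star+\varepsilon\delta\mathbf u\in\mathcal U$ for small $\varepsilon>0$, $J_\infty(\mathbf u^\star+\varepsilon\delta\mathbf u)=J_\infty(\mathbf u^\star)+\varepsilon\int_0^T\sum_{m=1}^M\mathbf q^\star_m(t)\cdot\delta\mathbf u_m(t)\,dt+o(\varepsilon)$. Moreover, if $\mathbf u^\star$ is a local minimizer of $J_\infty$ on $\mathcal U$ in the strong $L^2$ topology, then for a.e. $t\in[0,T]$, $\sum_{m=1}^M\mathbf q^\star_m(t)\cdot\mathbf u^\star_m(t)=\min_{\omega\in U}\sum_{m=1}^M\mathbf q^\star_m(t)\cdot\omega_m$.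
   Context: $\mathcal P_2$, $\mathcal P_c$: Borel probability measures with finite second moment, resp. compact support; $W_2$ the 2-Wasserstein distance; $f_\#\mu$ the pushforward. Splitting model: $d,M,P\ge1$, $T>0$. Let $K,f,g\colon\mathbb R^d\to\mathbb R^d$ be odd, continuously differentiable maps with bounded derivatives. For $\mu\in\mathcal P_c(\mathbb R^d)$ let $K*\mu(x)=\int K(\zeta-x)\,d\mu(\zeta)$. For $y=(y_1,\dots,y_M)\in(\mathbb R^d)^M$ set $F[\mu](x,y)=K*\mu(x)+\frac1M\sum_{m=1}^Mf(y_m-x)$ and $G[\mu](y)_m=\frac1M\sum_{j=1}^Mg(y_j-y_m)$. Let $U_m\subset\mathbb R^d$ be compact convex, $U=U_1\times\dots\times U_M$, and $\mathcal U$ the set of measurable $\mathbf u=(\mathbf u_1,\dots,\mathbf u_M)\colon[0,T]\to U$. Given $\mu_0\in\mathcal P_c(\mathbb R^d)$ and $y_0\in(\mathbb R^d)^M$, the state $(\boldsymbol\mu(\cdot;\mathbf u),\mathbf y(\cdot;\mathbf u))$ is the unique weak measure solution of $\partial_t\mu+\nabla_x\cdot(F[\mu](\cdot,y)\mu)=0$, $\dot y=G[\mu](y)+\mathbf u(t)$, $\mu(0)=\mu_0$, $y(0)=y_0$, with flow $\mathbf\Phi$: $\mathbf\Phi(0,x)=x$, $\partial_t\mathbf\Phi(t,x)=F[\boldsymbol\mu(t)](\mathbf\Phi(t,x),\mathbf y(t))$, $\boldsymbol\mu(t)=\mathbf\Phi(t,\cdot)_\#\mu_0$. Fix target points $z_1,\dots,z_P\in\mathbb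 R^d$, $\hat\mu=\frac1P\sum_{i=1}^P\delta_{z_i}$, and $J_\infty(\mathbf u)=\frac12W_2(\boldsymbol\mu(T;\mathbf u),\hat\mu)^2$. The adjoint system's solution is understood in integral form in $L^2(\mathbb R^d,\mathbb R^d;\mu_0)\times(\mathbb R^d)^M$. *)

theory Defs
  imports "HOL-Analysis.Analysis" "HOL-Probability.Probability"
begin

definition couplings :: "'a measure \<Rightarrow> 'b measure \<Rightarrow> ('a \<times> 'b) measure set" where
  "couplings \<mu> \<nu> = {\<gamma>. prob_space \<gamma> \<and> sets \<gamma> = sets (\<mu> \<Otimes>\<^sub>M \<nu>)
      \<and> distr \<gamma> \<mu> fst = \<mu> \<and> distr \<gamma> \<nu> snd = \<nu>}"

definition W2cost :: "'a::metric_space measure \<Rightarrow> 'a measure \<Rightarrow> ennreal" where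
  "W2cost \<mu> \<nu> = (INF \<gamma>\<in>couplings \<mu> \<nu>. \<integral>\<^sup>+ z. ennreal ((dist (fst z) (snd z))\<^sup>2) \<partial>\<gamma>)"

definition W2 :: "'a::metric_space measure \<Rightarrow> 'a measure \<Rightarrow> real" where
  "W2 \<mu> \<nu> = sqrt (enn2real (W2cost \<mu> \<nu>))"

definition is_OT_map :: "'a::metric_space measure \<Rightarrow> 'a measure \<Rightarrow> ('a \<Rightarrow> 'a) \<Rightarrow> bool" where
  "is_OT_map \<mu> \<nu> \<T> \<longleftrightarrow> \<T> \<in> borel_measurable \<mu> \<and> distr \<mu> borel \<T> = \<nu>
      \<and> (\<integral>\<^sup>+ x. ennreal ((dist x (\<T> x))\<^sup>2) \<partial>\<mu>) = W2cost \<mu> \<nu>"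

definition empirical :: "nat \<Rightarrow> (nat \<Rightarrow> 'a::topological_space) \<Rightarrow> 'a measure" where
  "empirical P z = distr (measure_pmf (pmf_of_set {..<P})) borel z"

text \<open>The splitting model.  The M agents are indexed by a finite type 'M, M = CARD('M).\<close>

definition convK :: "('a::euclidean_space \<Rightarrow> 'a) \<Rightarrow> 'a measure \<Rightarrow> 'a \<Rightarrow> 'a" where
  "convK K \<mu> x = (\<integral>\<zeta>. K (\<zeta> - x) \<partial>\<mu>)"

definition Fop :: "('a::euclidean_space \<Rightarrow> 'a) \<Rightarrow> ('a \<Rightarrow> 'a) \<Rightarrow> 'a measure
    \<Rightarrow> 'a \<Rightarrow> ('M::finite \<Rightarrow> 'a) \<Rightarrow> 'a" where
  "Fop K f \<mu> x y = convK K \<mu> x + (1 / real CARD('M)) *\<^sub>R (\<Sum>m\<in>UNIV. f (y m - x))"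

definition Gop :: "('a::euclidean_space \<Rightarrow> 'a) \<Rightarrow> ('M::finite \<Rightarrow> 'a) \<Rightarrow> 'M \<Rightarrow> 'a" where
  "Gop g y m = (1 / real CARD('M)) *\<^sub>R (\<Sum>j\<in>UNIV. g (y j - y m))"

definition admissible :: "('M \<Rightarrow> 'a::euclidean_space set) \<Rightarrow> real \<Rightarrow> (real \<Rightarrow> 'M \<Rightarrow> 'a) \<Rightarrow> bool" where
  "admissible Us T u \<longleftrightarrow> (\<forall>m. (\<lambda>t. u t m) \<in> borel_measurable (restrict_space lborel {0..T}))
      \<and> (\<forall>t\<in>{0..T}. \<forall>m. u t m \<in> Us m)"

definition is_state :: "'a::euclidean_space measure \<Rightarrow> ('a \<Rightarrow> 'a) \<Rightarrow> ('a \<Rightarrow> 'a) \<Rightarrow> ('a \<Rightarrow> 'a)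
    \<Rightarrow> ('M::finite \<Rightarrow> 'a) \<Rightarrow> real \<Rightarrow> (real \<Rightarrow> 'M \<Rightarrow> 'a)
    \<Rightarrow> (real \<Rightarrow> 'a \<Rightarrow> 'a) \<Rightarrow> (real \<Rightarrow> 'M \<Rightarrow> 'a) \<Rightarrow> bool" where
  "is_state \<mu>0 K f g y0 T u \<Phi> y \<longleftrightarrow>
     continuous_on ({0..T} \<times> UNIV) (\<lambda>(t, x). \<Phi> t x)
   \<and> (\<forall>m. continuous_on {0..T} (\<lambda>t. y t m))
   \<and> (\<forall>t\<in>{0..T}. \<forall>x. \<Phi> t x = x +
        (LINT s:{0..t}|lborel. Fop K f (distr \<mu>0 borel (\<Phi> s)) (\<Phi> s x) (y s)))
   \<and> (\<forall>t\<in>{0..T}. \<forall>m. y t m = y0 m + (LINT s:{0..t}|lborel. Gop g (y s) m + u s m))"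

definition final_measure :: "'a::euclidean_space measure \<Rightarrow> ('a \<Rightarrow> 'a) \<Rightarrow> ('a \<Rightarrow> 'a) \<Rightarrow> ('a \<Rightarrow> 'a)
    \<Rightarrow> ('M::finite \<Rightarrow> 'a) \<Rightarrow> real \<Rightarrow> (real \<Rightarrow> 'M \<Rightarrow> 'a) \<Rightarrow> 'a measure" where
  "final_measure \<mu>0 K f g y0 T u =
     (THE \<nu>. \<exists>\<Phi> y. is_state \<mu>0 K f g y0 T u \<Phi> y \<and> \<nu> = distr \<mu>0 borel (\<Phi> T))"

definition Jinf :: "'a::euclidean_space measure \<Rightarrow> ('a \<Rightarrow> 'a) \<Rightarrow> ('a \<Rightarrow> 'a) \<Rightarrow> ('a \<Rightarrow> 'a)
    \<Rightarrow> ('M::finite \<Rightarrow> 'a) \<Rightarrow> real \<Rightarrow> nat \<Rightarrow> (nat \<Rightarrow> 'a) \<Rightarrow> (real \<Rightarrow> 'M \<Rightarrow> 'a) \<Rightarrow> real" where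
  "Jinf \<mu>0 K f g y0 T P z u = 1/2 * (W2 (final_measure \<mu>0 K f g y0 T u) (empirical P z))\<^sup>2"

definition L2dist :: "real \<Rightarrow> (real \<Rightarrow> 'M::finite \<Rightarrow> 'a::euclidean_space) \<Rightarrow> (real \<Rightarrow> 'M \<Rightarrow> 'a) \<Rightarrow> real" where
  "L2dist T v u = sqrt (LINT t:{0..T}|lborel. (\<Sum>m\<in>UNIV. (norm (v t m - u t m))\<^sup>2))"

definition adj_p_rhs :: "'a::euclidean_space measure \<Rightarrow> ('a \<Rightarrow> 'a \<Rightarrow>\<^sub>L 'a) \<Rightarrow> ('a \<Rightarrow> 'a \<Rightarrow>\<^sub>L 'a)
    \<Rightarrow> (real \<Rightarrow> 'a \<Rightarrow> 'a) \<Rightarrow> (real \<Rightarrow> 'M::finite \<Rightarrow> 'a) \<Rightarrow> (real \<Rightarrow> 'a \<Rightarrow> 'a)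
    \<Rightarrow> real \<Rightarrow> 'a \<Rightarrow> 'a" where
  "adj_p_rhs \<mu>0 DK Df \<Phi> y p t x =
      - (\<integral>\<zeta>. adjoint (blinfun_apply (DK (\<zeta> - \<Phi> t x))) (p t x) \<partial>(distr \<mu>0 borel (\<Phi> t)))
      - (1 / real CARD('M)) *\<^sub>R (\<Sum>m\<in>UNIV. adjoint (blinfun_apply (Df (y t m - \<Phi> t x))) (p t x))
      + (\<integral>\<zeta>. adjoint (blinfun_apply (DK (\<Phi> t \<zeta> - \<Phi> t x))) (p t \<zeta>) \<partial>\<mu>0)"

definition adj_q_rhs :: "'a::euclidean_space measure \<Rightarrow> ('a \<Rightarrow> 'a \<Rightarrow>\<^sub>L 'a) \<Rightarrow> ('a \<Rightarrow> 'a \<Rightarrow>\<^sub>L 'a)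
    \<Rightarrow> (real \<Rightarrow> 'a \<Rightarrow> 'a) \<Rightarrow> (real \<Rightarrow> 'M::finite \<Rightarrow> 'a) \<Rightarrow> (real \<Rightarrow> 'a \<Rightarrow> 'a)
    \<Rightarrow> (real \<Rightarrow> 'M \<Rightarrow> 'a) \<Rightarrow> real \<Rightarrow> 'M \<Rightarrow> 'a" where
  "adj_q_rhs \<mu>0 Df Dg \<Phi> y p q t m =
      (1 / real CARD('M)) *\<^sub>R (\<integral>\<zeta>. adjoint (blinfun_apply (Df (y t m - \<Phi> t \<zeta>))) (p t \<zeta>) \<partial>\<mu>0)
    + (1 / real CARD('M)) *\<^sub>R (\<Sum>j\<in>UNIV. adjoint (blinfun_apply (Dg (y t j - y t m))) (q t j - q t m))"

definition is_adjoint_solution :: "'a::euclidean_space measure \<Rightarrow> ('a \<Rightarrow> 'a \<Rightarrow>\<^sub>L 'a)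
    \<Rightarrow> ('a \<Rightarrow> 'a \<Rightarrow>\<^sub>L 'a) \<Rightarrow> ('a \<Rightarrow> 'a \<Rightarrow>\<^sub>L 'a) \<Rightarrow> real
    \<Rightarrow> (real \<Rightarrow> 'a \<Rightarrow> 'a) \<Rightarrow> (real \<Rightarrow> 'M::finite \<Rightarrow> 'a) \<Rightarrow> ('a \<Rightarrow> 'a)
    \<Rightarrow> (real \<Rightarrow> 'a \<Rightarrow> 'a) \<Rightarrow> (real \<Rightarrow> 'M \<Rightarrow> 'a) \<Rightarrow> bool" where
  "is_adjoint_solution \<mu>0 DK Df Dg T \<Phi> y \<T> p q \<longleftrightarrow>
     (\<lambda>(t, x). p t x) \<in> borel_measurable (restrict_space lborel {0..T} \<Otimes>\<^sub>M \<mu>0)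
   \<and> (\<forall>t\<in>{0..T}. p t \<in> borel_measurable \<mu>0 \<and> integrable \<mu>0 (\<lambda>x. (norm (p t x))\<^sup>2))
   \<and> (\<exists>B. \<forall>t\<in>{0..T}. (\<integral>x. (norm (p t x))\<^sup>2 \<partial>\<mu>0) \<le> B)
   \<and> (\<forall>m. continuous_on {0..T} (\<lambda>t. q t m))
   \<and> (AE x in \<mu>0. p T x = \<Phi> T x - \<T> (\<Phi> T x))
   \<and> (\<forall>t\<in>{0..T}. AE x in \<mu>0. p t x = p T x + (LINT s:{t..T}|lborel. adj_p_rhs \<mu>0 DK Df \<Phi> y p s x))
   \<and> (\<forall>t\<in>{0..T}. \<forall>m. q t m = (LINT s:{t..T}|lborel. adj_q_rhs \<mu>0 Df Dg \<Phi> y p q s m))"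

end

theory Submission
  imports Defs
begin

text \<open>The cost is expanded by two one-sided estimates.  Transporting along the old optimal map gives a
  competitor for the perturbed terminal measure, hence an upper bound.  For the lower bound one uses an
  optimal price \<open>\<psi>\<close> of the semi-discrete dual problem: it exists by compactness, and since
  \<open>\<mu>\<^sup>\<star>(T)\<close> is absolutely continuous (the flow has a Lipschitz inverse) the optimality
  condition shows that the given transport map is almost everywhere the unique minimiser in the
  c-transform of \<open>\<psi>\<close>, which is therefore differentiable there.  Both bounds have the first-order
  term \<open>\<integral> p(T) \<bullet> (\<Phi>\<^sup>\<epsilon>(T) - \<Phi>\<^sup>\<star>(T)) d\<mu>0\<close>.  Pairing the adjoint system with the true
  difference of the two states (no linearised flow is needed) and integrating by parts in time turns it
  into \<open>\<epsilon> \<integral> q \<bullet> \<delta>u dt + o(\<epsilon>)\<close>; here oddness of \<open>K\<close> and \<open>g\<close> enters through the evenness of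
  their derivatives.  The minimum principle follows by switching one component of the control to a
  constant value on the set where this would decrease the pairing.\<close>

section \<open>Semi-discrete optimal transport\<close>

text \<open>The o(\<epsilon>) comes from the gap between the best and second-best target in
  \<open>cpot\<close>, the c-transform for the squared distance. Where the gap beats the
  displacement the minimiser does not move, and the dual and transport bounds differ only by a
  squared displacement. At points with a gap of order \<epsilon> they may differ by O(\<epsilon>);
  such points become negligible, but with no rate, so dominated convergence is used instead of a
  quantitative estimate. \<open>final_measure\<close> is a definite description: before the cost of
  a perturbed control can be expanded, its state must be shown to exist and its terminal measure to
  be unique. Compact control sets force an admissible direction to be bounded. Uniqueness, stability
  and the Lipschitz inverse of the flow all come from one exponentially weighted absorption
  argument, which only asks for an a priori bound and an integral inequality.\<close>

definition cpot :: "'a::metric_space set \<Rightarrow> ('a \<Rightarrow> real) \<Rightarrow> 'a \<Rightarrow> real" where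
  "cpot Z \<psi> x = Min ((\<lambda>v. (dist x v)\<^sup>2 - \<psi> v) ` Z)"

lemma cpot_le: "finite Z \<Longrightarrow> v \<in> Z \<Longrightarrow> cpot Z \<psi> x \<le> (dist x v)\<^sup>2 - \<psi> v"
  unfolding cpot_def by (rule Min_le) auto

lemma cpot_attained:
  assumes "finite Z" "Z \<noteq> {}"
  obtains v where "v \<in> Z" "cpot Z \<psi> x = (dist x v)\<^sup>2 - \<psi> v"
proof -
  have "cpot Z \<psi> x \<in> (\<lambda>v. (dist x v)\<^sup>2 - \<psi> v) ` Z"
    unfolding cpot_def using assms by (intro Min_in) auto
  then show ?thesis using that by auto
qed

lemma cpot_ge: 
  assumes "finite Z" "Z \<noteq> {}" "\<And>v. v \<in> Z \<Longrightarrow> a \<le> (dist x v)\<^sup>2 - \<psi> v"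
  shows "a \<le> cpot Z \<psi> x"
  using assms by (metis cpot_attained)

lemma cpot_borel [measurable]:
  fixes Z :: "'a::euclidean_space set"
  assumes "finite Z" "Z \<noteq> {}"
  shows "cpot Z \<psi> \<in> borel_measurable borel"
proof -
  have "continuous_on UNIV (cpot Z \<psi>)"
    using assms
  proof (induction rule: finite_ne_induct)
    case (singleton v)
    then show ?case by (auto simp: cpot_def[abs_def] intro!: continuous_intros)
  next
    case (insert v F)
    have "cpot (insert v F) \<psi> = (\<lambda>x. min ((dist x v)\<^sup>2 - \<psi> v) (cpot F \<psi> x))"
      using insert by (auto simp: cpot_def fun_eq_iff)
    then show ?case using insert.IH by (auto intro!: continuous_intros)
  qed
  then show ?thesis by (rule borel_measurable_continuous_onI)
qed

text \<open>Test one minimum with the minimiser of the other. The bound involves finitely many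
  coordinates, which suits continuity for pointwise convergence of prices.\<close>

lemma cpot_lipschitz:
  assumes "finite Z" "Z \<noteq> {}"
  shows "\<bar>cpot Z \<psi> x - cpot Z \<psi>' x\<bar> \<le> (\<Sum>v\<in>Z. \<bar>\<psi> v - \<psi>' v\<bar>)"
proof -
  have *: "cpot Z a x - cpot Z b x \<le> (\<Sum>v\<in>Z. \<bar>a v - b v\<bar>)" for a b
  proof -
    obtain v where v: "v \<in> Z" "cpot Z b x = (dist x v)\<^sup>2 - b v"
      using cpot_attained assms by metis
    have "cpot Z a x - cpot Z b x \<le> \<bar>a v - b v\<bar>"
      using cpot_le[OF assms(1) v(1), of a x] v(2) by linarith
    also have "\<dots> \<le> (\<Sum>v\<in>Z. \<bar>a v - b v\<bar>)"
      using assms v by (intro member_le_sum) auto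
    finally show ?thesis .
  qed
  show ?thesis using *[of \<psi> \<psi>'] *[of \<psi>' \<psi>] by (simp add: abs_minus_commute abs_le_iff)
qed

lemma cpot_bound:
  assumes "finite Z" "Z \<noteq> {}" "\<And>v. v \<in> Z \<Longrightarrow> (dist x v)\<^sup>2 \<le> R"
  shows "\<bar>cpot Z \<psi> x\<bar> \<le> R + (\<Sum>v\<in>Z. \<bar>\<psi> v\<bar>)"
proof -
  obtain v where v: "v \<in> Z" "cpot Z \<psi> x = (dist x v)\<^sup>2 - \<psi> v"
    using cpot_attained assms(1,2) by metis
  have "\<bar>\<psi> v\<bar> \<le> (\<Sum>v\<in>Z. \<bar>\<psi> v\<bar>)"
    using assms v by (intro member_le_sum) auto
  then show ?thesis using v assms(3)[OF v(1)] zero_le_power2[of "dist x v"] by linarith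
qed

text \<open>Measurability of \<open>\<psi>\<close> matters only because the integral of a non-measurable function is 0.\<close>

lemma weak_duality:
  fixes \<mu> \<nu> :: "'a::euclidean_space measure"
  assumes Z: "finite Z" "Z \<noteq> {}" and \<nu>Z: "AE y in \<nu>. y \<in> Z"
    and \<mu>: "prob_space \<mu>" "sets \<mu> = sets borel" and \<nu>: "prob_space \<nu>" "sets \<nu> = sets borel"
    and bd: "AE x in \<mu>. norm x \<le> R"
    and \<psi>: "\<psi> \<in> borel_measurable borel"
  shows "ennreal ((\<integral>x. cpot Z \<psi> x \<partial>\<mu>) + (\<integral>y. \<psi> y \<partial>\<nu>)) \<le> W2cost \<mu> \<nu>"
  unfolding W2cost_def
proof (rule INF_greatest)
  fix \<gamma> assume "\<gamma> \<in> couplings \<mu> \<nu>"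
  then have g: "prob_space \<gamma>" and s: "sets \<gamma> = sets (\<mu> \<Otimes>\<^sub>M \<nu>)"
    and d1: "distr \<gamma> \<mu> fst = \<mu>" and d2: "distr \<gamma> \<nu> snd = \<nu>" by (auto simp: couplings_def)
  interpret g: prob_space \<gamma> by fact
  interpret \<mu>: prob_space \<mu> by fact
  interpret \<nu>: prob_space \<nu> by fact
  note [measurable_cong] = \<mu>(2) \<nu>(2) s
  note [measurable] = \<psi> cpot_borel[OF Z]
  have f1[measurable]: "fst \<in> measurable \<gamma> \<mu>"
    unfolding measurable_cong_sets[OF s refl] by (rule measurable_fst)
  have f2[measurable]: "snd \<in> measurable \<gamma> \<nu>"
    unfolding measurable_cong_sets[OF s refl] by (rule measurable_snd)
  have b1: "fst \<in> borel_measurable \<gamma>"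
    using f1 measurable_cong_sets[OF refl \<mu>(2), of \<gamma>] by simp
  have b2: "snd \<in> borel_measurable \<gamma>"
    using f2 measurable_cong_sets[OF refl \<nu>(2), of \<gamma>] by simp
  \<comment> \<open>\<open>D\<close> bounds the finite target set. Together with \<open>R\<close> it
    bounds cost and c-transform almost everywhere along every coupling, so the integrals may be
    split.\<close>
  define D where "D = Max ((\<lambda>v. norm v) ` Z)"
  have D: "norm v \<le> D" if "v \<in> Z" for v unfolding D_def using Z that by (intro Max_ge) auto
  have A1: "AE z in \<gamma>. norm (fst z) \<le> R" by (rule AE_distrD[OF f1]) (simp only: d1 bd)
  have A2: "AE z in \<gamma>. snd z \<in> Z" by (rule AE_distrD[OF f2]) (simp only: d2 \<nu>Z)
  have D2: "AE z in \<gamma>. (dist (fst z) (snd z))\<^sup>2 \<le> (R + D)\<^sup>2"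
    using A1 A2
  proof eventually_elim
    case (elim z)
    have "dist (fst z) (snd z) \<le> R + D"
      using elim D[of "snd z"] norm_triangle_ineq4[of "fst z" "snd z"] by (auto simp: dist_norm)
    then show ?case by (intro power_mono) auto
  qed
  have i0: "integrable \<gamma> (\<lambda>z. (dist (fst z) (snd z))\<^sup>2)"
  proof (rule g.integrable_const_bound[of _ "(R+D)\<^sup>2"])
    show "AE x in \<gamma>. norm ((dist (fst x) (snd x))\<^sup>2) \<le> (R + D)\<^sup>2" using D2 by simp
    show "(\<lambda>z. (dist (fst z) (snd z))\<^sup>2) \<in> borel_measurable \<gamma>" 
      by (intro borel_measurable_power borel_measurable_dist b1 b2)
  qed
  have i1: "integrable \<mu> (cpot Z \<psi>)"
  proof (rule \<mu>.integrable_const_bound[of _ "(R+D)\<^sup>2 + (\<Sum>v\<in>Z. \<bar>\<psi> v\<bar>)"])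
    show "AE x in \<mu>. norm (cpot Z \<psi> x) \<le> (R+D)\<^sup>2 + (\<Sum>v\<in>Z. \<bar>\<psi> v\<bar>)"
      using bd
    proof eventually_elim
      case (elim x)
      have "(dist x v)\<^sup>2 \<le> (R+D)\<^sup>2" if "v \<in> Z" for v
      proof -
        have "dist x v \<le> R + D"
          using elim D[OF that] norm_triangle_ineq4[of x v] by (auto simp: dist_norm)
        then show ?thesis by (intro power_mono) auto
      qed
      then show ?case using cpot_bound[OF Z, of x "(R+D)\<^sup>2" \<psi>] by auto
    qed
  qed auto
  have i2: "integrable \<nu> \<psi>"
  proof (rule \<nu>.integrable_const_bound[of _ "\<Sum>v\<in>Z. \<bar>\<psi> v\<bar>"])
    show "AE x in \<nu>. norm (\<psi> x) \<le> (\<Sum>v\<in>Z. \<bar>\<psi> v\<bar>)"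
      using \<nu>Z by eventually_elim (use Z in \<open>auto intro!: member_le_sum[where f="\<lambda>v. \<bar>\<psi> v\<bar>"]\<close>)
  qed auto
  have j1: "integrable \<gamma> (\<lambda>z. cpot Z \<psi> (fst z))"
    using integrable_distr[OF f1, of "cpot Z \<psi>"] i1 d1 by simp
  have j2: "integrable \<gamma> (\<lambda>z. \<psi> (snd z))"
    using integrable_distr[OF f2, of \<psi>] i2 d2 by simp
  have k1: "(\<integral>x. cpot Z \<psi> x \<partial>\<mu>) = (\<integral>z. cpot Z \<psi> (fst z) \<partial>\<gamma>)"
    using integral_distr[OF f1, of "cpot Z \<psi>"] d1 by simp
  have k2: "(\<integral>x. \<psi> x \<partial>\<nu>) = (\<integral>z. \<psi> (snd z) \<partial>\<gamma>)"
    using integral_distr[OF f2, of "\<psi>"] d2 by simp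
  have "(\<integral>x. cpot Z \<psi> x \<partial>\<mu>) + (\<integral>y. \<psi> y \<partial>\<nu>) = (\<integral>z. cpot Z \<psi> (fst z) + \<psi> (snd z) \<partial>\<gamma>)"
    unfolding k1 k2 using j1 j2 by simp
  also have "\<dots> \<le> (\<integral>z. (dist (fst z) (snd z))\<^sup>2 \<partial>\<gamma>)"
  proof (rule integral_mono_AE)
    show "AE z in \<gamma>. cpot Z \<psi> (fst z) + \<psi> (snd z) \<le> (dist (fst z) (snd z))\<^sup>2"
      using A2 by eventually_elim (use cpot_le[OF Z(1)] in \<open>force simp: le_diff_eq\<close>)
  qed (use j1 j2 i0 in auto)
  finally show "ennreal ((\<integral>x. cpot Z \<psi> x \<partial>\<mu>) + (\<integral>y. \<psi> y \<partial>\<nu>))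
      \<le> (\<integral>\<^sup>+ z. ennreal ((dist (fst z) (snd z))\<^sup>2) \<partial>\<gamma>)"
    by (subst nn_integral_eq_integral[OF i0]) (auto intro: ennreal_leI)
qed

text \<open>The joint law of \<open>X\<close> and \<open>Y\<close> is a coupling. This supplies
  competitors from any probability space: perturbed flow against old targets, and identity against a
  map.\<close>

lemma W2cost_distr_le:
  fixes X Y :: "'b \<Rightarrow> 'a::euclidean_space"
  assumes M: "prob_space M" and X[measurable]: "X \<in> borel_measurable M" and Y[measurable]: "Y \<in> borel_measurable M"
  shows "W2cost (distr M borel X) (distr M borel Y) \<le> (\<integral>\<^sup>+ x. ennreal ((dist (X x) (Y x))\<^sup>2) \<partial>M)"
proof -
  interpret prob_space M by fact
  let ?g = "distr M (borel \<Otimes>\<^sub>M borel) (\<lambda>x. (X x, Y x))"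
  have "?g \<in> couplings (distr M borel X) (distr M borel Y)"
    unfolding couplings_def mem_Collect_eq
  proof (intro conjI)
    show "prob_space ?g" by (rule prob_space_distr) simp
    show "sets ?g = sets (distr M borel X \<Otimes>\<^sub>M distr M borel Y)"
      unfolding sets_distr by (rule sets_pair_measure_cong) simp_all
    show "distr ?g (distr M borel X) fst = distr M borel X"
      by (subst distr_distr) (auto simp: comp_def intro!: distr_cong)
    show "distr ?g (distr M borel Y) snd = distr M borel Y"
      by (subst distr_distr) (auto simp: comp_def intro!: distr_cong)
  qed
  then have "W2cost (distr M borel X) (distr M borel Y) \<le> (\<integral>\<^sup>+ z. ennreal ((dist (fst z) (snd z))\<^sup>2) \<partial>?g)"
    unfolding W2cost_def by (rule INF_lower)
  also have "\<dots> = (\<integral>\<^sup>+ x. ennreal ((dist (X x) (Y x))\<^sup>2) \<partial>M)"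
    by (subst nn_integral_distr) auto
  finally show ?thesis .
qed

section \<open>Maximisers of the semi-discrete dual problem\<close>

lemma continuous_on_cpot_integral:
  fixes \<mu> :: "'a::euclidean_space measure"
  assumes Z: "finite Z" "Z \<noteq> {}" and int: "\<And>\<psi>. integrable \<mu> (cpot Z \<psi>)" and \<mu>: "prob_space \<mu>"
  shows "continuous_on UNIV (\<lambda>\<psi>. \<integral>x. cpot Z \<psi> x \<partial>\<mu>)"
proof -
  interpret prob_space \<mu> by fact
  have bd: "norm ((\<integral>x. cpot Z \<psi>' x \<partial>\<mu>) - (\<integral>x. cpot Z \<psi> x \<partial>\<mu>)) \<le> (\<Sum>v\<in>Z. \<bar>\<psi>' v - \<psi> v\<bar>)" for \<psi> \<psi>'
  proof -
    have "norm (\<integral>x. cpot Z \<psi>' x - cpot Z \<psi> x \<partial>\<mu>) \<le> (\<integral>x. (\<Sum>v\<in>Z. \<bar>\<psi>' v - \<psi> v\<bar>) \<partial>\<mu>)"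
      using int cpot_lipschitz[OF Z] by (intro Bochner_Integration.integral_norm_bound_integral) auto
    then show ?thesis using int by (simp add: prob_space)
  qed
  have "((\<lambda>\<psi>'. \<integral>x. cpot Z \<psi>' x \<partial>\<mu>) \<longlongrightarrow> (\<integral>x. cpot Z \<psi> x \<partial>\<mu>)) (at \<psi>)" for \<psi>
  proof (rule LIM_zero_cancel, rule Lim_null_comparison)
    show "\<forall>\<^sub>F \<psi>' in at \<psi>. norm ((\<integral>x. cpot Z \<psi>' x \<partial>\<mu>) - (\<integral>x. cpot Z \<psi> x \<partial>\<mu>)) \<le> (\<Sum>v\<in>Z. \<bar>\<psi>' v - \<psi> v\<bar>)"
      using bd by auto
    \<comment> \<open>Prices carry the product topology, so only coordinatewise convergence is
      available; the Lipschitz bound needs no more than the coordinates in \<open>Z\<close>.\<close>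
    have "((\<lambda>\<psi>'. \<psi>' v) \<longlongrightarrow> \<psi> v) (at \<psi>)" for v
      using continuous_on_product_coordinates[of v] unfolding continuous_on_def by auto
    then have "((\<lambda>\<psi>'. \<Sum>v\<in>Z. \<bar>\<psi>' v - \<psi> v\<bar>) \<longlongrightarrow> (\<Sum>v\<in>Z. \<bar>\<psi> v - \<psi> v\<bar>)) (at \<psi>)"
      by (intro tendsto_intros) auto
    then show "((\<lambda>\<psi>'. \<Sum>v\<in>Z. \<bar>\<psi>' v - \<psi> v\<bar>) \<longlongrightarrow> 0) (at \<psi>)" by simp
  qed
  then show ?thesis by (auto simp: continuous_on_def)
qed

lemma integrable_cpot:
  fixes \<mu> :: "'a::euclidean_space measure"
  assumes Z: "finite Z" "Z \<noteq> {}" and \<mu>: "prob_space \<mu>" "sets \<mu> = sets borel"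
    and bd: "AE x in \<mu>. \<forall>v\<in>Z. (dist x v)\<^sup>2 \<le> R"
  shows "integrable \<mu> (cpot Z \<psi>)"
proof -
  interpret prob_space \<mu> by fact
  show ?thesis
  proof (rule integrable_const_bound)
    show "AE x in \<mu>. norm (cpot Z \<psi> x) \<le> R + (\<Sum>v\<in>Z. \<bar>\<psi> v\<bar>)"
      using bd by eventually_elim (auto intro!: cpot_bound Z)
  qed (simp add: measurable_cong_sets[OF \<mu>(2) refl] cpot_borel Z)
qed

text \<open>Since the weights sum to 1, a constant added to the price leaves the objective
  unchanged, so the largest price may be taken to be 0. Prices below \<open>- B\<close>, with
  \<open>B\<close> bounding the squared distances, can be raised to \<open>- B\<close> without loss.
  It remains to maximise over a product of compact intervals, compact by Tychonoff. Pinning prices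
  to 0 off \<open>Z\<close> later yields measurability.\<close>

lemma dual_maximizer_exists:
  fixes \<mu> :: "'a::euclidean_space measure"
  assumes Z: "finite Z" "Z \<noteq> {}" and \<mu>: "prob_space \<mu>" "sets \<mu> = sets borel"
    and bd: "AE x in \<mu>. \<forall>v\<in>Z. (dist x v)\<^sup>2 \<le> R"
    and w: "\<And>v. v \<in> Z \<Longrightarrow> 0 \<le> w v" "(\<Sum>v\<in>Z. w v) = 1"
  obtains \<psi> where "\<And>\<psi>'. (\<integral>x. cpot Z \<psi>' x \<partial>\<mu>) + (\<Sum>v\<in>Z. w v * \<psi>' v)
       \<le> (\<integral>x. cpot Z \<psi> x \<partial>\<mu>) + (\<Sum>v\<in>Z. w v * \<psi> v)" "\<And>v. v \<notin> Z \<Longrightarrow> \<psi> v = 0"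
proof -
  interpret prob_space \<mu> by fact
  have int: "integrable \<mu> (cpot Z \<psi>)" for \<psi> by (rule integrable_cpot[OF Z \<mu> bd])
  define B where "B = max R 0"
  define S where "S = (\<Pi>\<^sub>E v\<in>(UNIV::'a set). if v \<in> Z then {-B..0::real} else {0})"
  define \<Psi> where "\<Psi> \<psi> = (\<integral>x. cpot Z \<psi> x \<partial>\<mu>) + (\<Sum>v\<in>Z. w v * \<psi> v)" for \<psi>
  have "compactin (product_topology (\<lambda>i. euclidean) (UNIV::'a set)) S"
    unfolding S_def compactin_PiE by auto
  then have cS: "compact S"
    by (simp add: euclidean_product_topology)
  have "(\<lambda>v. 0) \<in> S" by (auto simp: S_def B_def)
  then have ne: "S \<noteq> {}" by auto
  have "continuous_on S \<Psi>" unfolding \<Psi>_def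
    by (intro continuous_intros continuous_on_subset[OF continuous_on_cpot_integral[OF Z int \<mu>(1)]]
        continuous_on_subset[OF continuous_on_product_coordinates]) auto
  from continuous_attains_sup[OF cS ne this] obtain \<psi> where \<psi>: "\<psi> \<in> S" "\<And>\<psi>'. \<psi>' \<in> S \<Longrightarrow> \<Psi> \<psi>' \<le> \<Psi> \<psi>"
    by auto
  have "\<Psi> \<psi>' \<le> \<Psi> \<psi>" for \<psi>'
  proof -
    define m where "m = Max (\<psi>' ` Z)"
    \<comment> \<open>The normalised and truncated competitor: shifted so that its maximum is 0,
      then cut off below at \<open>- B\<close>.\<close>
    define \<psi>'' where "\<psi>'' v = (if v \<in> Z then max (\<psi>' v - m) (- B) else 0)" for v
    have m: "\<psi>' v \<le> m" if "v \<in> Z" for v unfolding m_def using Z that by (intro Max_ge) auto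
    have "m \<in> \<psi>' ` Z" unfolding m_def using Z by (intro Max_in) auto
    then obtain j where j: "j \<in> Z" "\<psi>' j = m" by auto
    have "\<psi>'' \<in> S" using m by (auto simp: S_def \<psi>''_def B_def)
    then have 1: "\<Psi> \<psi>'' \<le> \<Psi> \<psi>" by (rule \<psi>(2))
    have "(\<integral>x. cpot Z \<psi>' x + m \<partial>\<mu>) \<le> (\<integral>x. cpot Z \<psi>'' x \<partial>\<mu>)"
    proof (rule integral_mono_AE)
      show "AE x in \<mu>. cpot Z \<psi>' x + m \<le> cpot Z \<psi>'' x"
        using bd
      proof eventually_elim
        case (elim x)
        show ?case
        proof (rule cpot_ge[OF Z])
          fix v assume v: "v \<in> Z"
          \<comment> \<open>Tested at \<open>j\<close>, where the price equals \<open>m\<close>; the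
            shifted c-transform is thus at most one squared distance. This is why truncation at
            \<open>- B\<close> cannot lower it.\<close>
          have "cpot Z \<psi>' x + m \<le> B"
            using cpot_le[OF Z(1) j(1), of \<psi>' x] j elim by (force simp: B_def)
          moreover have "cpot Z \<psi>' x \<le> (dist x v)\<^sup>2 - \<psi>' v" by (rule cpot_le[OF Z(1) v])
          moreover have "0 \<le> (dist x v)\<^sup>2" by simp
          ultimately have "cpot Z \<psi>' x + m \<le> (dist x v)\<^sup>2 + B"
            and "cpot Z \<psi>' x + m \<le> (dist x v)\<^sup>2 - (\<psi>' v - m)" by linarith+
          then show "cpot Z \<psi>' x + m \<le> (dist x v)\<^sup>2 - \<psi>'' v"
            using v by (simp add: \<psi>''_def max_def)
        qed
      qed
    qed (use int in auto)
    then have 2: "(\<integral>x. cpot Z \<psi>' x \<partial>\<mu>) + m \<le> (\<integral>x. cpot Z \<psi>'' x \<partial>\<mu>)"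
      using int by (simp add: prob_space)
    have "(\<Sum>v\<in>Z. w v * \<psi>' v) - m = (\<Sum>v\<in>Z. w v * (\<psi>' v - m))"
      using w(2) by (simp add: right_diff_distrib sum_subtractf flip: sum_distrib_right)
    also have "\<dots> \<le> (\<Sum>v\<in>Z. w v * \<psi>'' v)"
      using w(1) by (intro sum_mono mult_left_mono) (auto simp: \<psi>''_def)
    finally show ?thesis using 1 2 by (simp add: \<Psi>_def)
  qed
  moreover have "\<psi> v = 0" if "v \<notin> Z" for v
    using \<psi>(1) that by (auto simp: S_def PiE_def Pi_def split: if_splits)
  ultimately show ?thesis using that unfolding \<Psi>_def by blast
qed

text \<open>Raise the price of \<open>v\<close> by \<open>t\<close>. The objective gains
  \<open>w v * t\<close> and loses at most \<open>t\<close> on the set \<open>E t\<close> where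
  \<open>v\<close> is within \<open>t\<close> of being optimal. Maximality gives
  \<open>w v \<le> measure \<mu> (E t)\<close>, and \<open>t\<close> tends to 0 by continuity from
  above. Only an inequality is claimed, so the objective need not be differentiated.\<close>

lemma dual_maximizer_cell:
  fixes \<mu> :: "'a::euclidean_space measure"
  assumes Z: "finite Z" "Z \<noteq> {}" and \<mu>: "prob_space \<mu>" "sets \<mu> = sets borel"
    and bd: "AE x in \<mu>. \<forall>v\<in>Z. (dist x v)\<^sup>2 \<le> R"
    and max: "\<And>\<psi>'. (\<integral>x. cpot Z \<psi>' x \<partial>\<mu>) + (\<Sum>v\<in>Z. w v * \<psi>' v)
       \<le> (\<integral>x. cpot Z \<psi> x \<partial>\<mu>) + (\<Sum>v\<in>Z. w v * \<psi> v)" and v: "v \<in> Z"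
  shows "w v \<le> measure \<mu> {x. (dist x v)\<^sup>2 - \<psi> v \<le> cpot Z \<psi> x}"
proof -
  interpret prob_space \<mu> by fact
  note [measurable_cong] = \<mu>(2)
  note [measurable] = cpot_borel[OF Z]
  have int: "integrable \<mu> (cpot Z \<psi>)" for \<psi> by (rule integrable_cpot[OF Z \<mu> bd])
  define E where "E t = {x. (dist x v)\<^sup>2 - \<psi> v - t < cpot Z \<psi> x}" for t
  have Eb: "E t \<in> sets borel" for t unfolding E_def by measurable
  then have E[measurable]: "E t \<in> sets \<mu>" for t using \<mu>(2) by simp
  have le: "w v \<le> measure \<mu> (E t)" if t: "0 < t" for t
  proof -
    define \<psi>' where "\<psi>' = \<psi>(v := \<psi> v + t)"
    have "(\<integral>x. cpot Z \<psi> x - t * indicator (E t) x \<partial>\<mu>) \<le> (\<integral>x. cpot Z \<psi>' x \<partial>\<mu>)"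
    proof (rule Bochner_Integration.integral_mono)
      fix x
      show "cpot Z \<psi> x - t * indicator (E t) x \<le> cpot Z \<psi>' x"
      proof (rule cpot_ge[OF Z])
        fix u assume u: "u \<in> Z"
        have "cpot Z \<psi> x \<le> (dist x u)\<^sup>2 - \<psi> u" by (rule cpot_le[OF Z(1) u])
        then show "cpot Z \<psi> x - t * indicator (E t) x \<le> (dist x u)\<^sup>2 - \<psi>' u"
          using t by (auto simp: \<psi>'_def E_def indicator_def)
      qed
    qed (use int in \<open>auto intro!: integrable_mult_right simp: less_top[symmetric]\<close>)
    then have 1: "(\<integral>x. cpot Z \<psi> x \<partial>\<mu>) - t * measure \<mu> (E t) \<le> (\<integral>x. cpot Z \<psi>' x \<partial>\<mu>)"
      using int E by (simp add: less_top[symmetric])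
    have "(\<Sum>u\<in>Z. w u * \<psi>' u) = (\<Sum>u\<in>Z. w u * \<psi> u + (if u = v then w v * t else 0))"
      by (intro sum.cong) (auto simp: \<psi>'_def algebra_simps)
    also have "\<dots> = (\<Sum>u\<in>Z. w u * \<psi> u) + w v * t"
      using Z v by (simp add: sum.distrib)
    finally have "w v * t \<le> measure \<mu> (E t) * t" using 1 max[of \<psi>'] by (simp add: algebra_simps)
    then show ?thesis using t by simp
  qed
  have "(\<lambda>n. measure \<mu> (E (1 / Suc n))) \<longlonglongrightarrow> measure \<mu> (\<Inter>n. E (1 / Suc n))"
  proof (rule finite_Lim_measure_decseq)
    show "decseq (\<lambda>n. E (1 / Suc n))"
    proof (rule decseq_SucI)
      fix n
      have "1 / real (Suc (Suc n)) \<le> 1 / real (Suc n)" by (simp add: field_simps)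
      then show "E (1 / Suc (Suc n)) \<subseteq> E (1 / Suc n)" unfolding E_def by force
    qed
  qed auto
  moreover have "(\<Inter>n. E (1 / Suc n)) = {x. (dist x v)\<^sup>2 - \<psi> v \<le> cpot Z \<psi> x}" (is "?L = ?R")
  proof
    show "?R \<subseteq> ?L" 
    proof (clarsimp simp: E_def)
      fix x n assume "(dist x v)\<^sup>2 - \<psi> v \<le> cpot Z \<psi> x"
      moreover have "0 < 1 / (1 + real n)" by simp
      ultimately show "(dist x v)\<^sup>2 - \<psi> v - 1 / (1 + real n) < cpot Z \<psi> x" by linarith
    qed
    show "?L \<subseteq> ?R"
    proof
      fix x assume x: "x \<in> ?L"
      have "(dist x v)\<^sup>2 - \<psi> v - cpot Z \<psi> x \<le> 0"
      proof (rule field_le_epsilon)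
        fix e :: real assume "0 < e"
        then obtain n where "inverse (real (Suc n)) < e" using reals_Archimedean by blast
        moreover have "x \<in> E (1 / Suc n)" using x by auto
        ultimately show "(dist x v)\<^sup>2 - \<psi> v - cpot Z \<psi> x \<le> 0 + e" by (auto simp: E_def inverse_eq_divide)
      qed
      then show "x \<in> ?R" by auto
    qed
  qed
  ultimately show ?thesis
    using le by (intro LIMSEQ_le_const) auto
qed

section \<open>From the dual maximiser to the given optimal map\<close>

lemma distr_eq_finite_support:
  fixes \<mu> \<nu> :: "'a::t1_space measure"
  assumes \<mu>: "finite_measure \<mu>" "sets \<mu> = sets borel" and \<nu>: "finite_measure \<nu>" "sets \<nu> = sets borel"
    and Z: "finite Z" "AE y in \<mu>. y \<in> Z" "AE y in \<nu>. y \<in> Z"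
    and eq: "\<And>v. v \<in> Z \<Longrightarrow> measure \<mu> {v} = measure \<nu> {v}"
  shows "\<mu> = \<nu>"
proof (rule measure_eqI)
  fix A assume A: "A \<in> sets \<mu>"
  have *: "emeasure M A = (\<Sum>v\<in>A \<inter> Z. ennreal (measure M {v}))"
    if M: "finite_measure M" "sets M = sets borel" "AE y in M. y \<in> Z" for M :: "'a measure"
  proof -
    interpret finite_measure M by fact
    have "emeasure M A = emeasure M (A \<inter> Z)"
      using M A \<mu>(2) Z(1) by (intro emeasure_eq_AE) (auto elim!: eventually_mono intro!: sets.Int finite_imp_closed borel_closed)
    also have "\<dots> = (\<Sum>v\<in>A \<inter> Z. emeasure M {v})"
      using Z(1) M by (intro emeasure_eq_sum_singleton) auto
    finally show ?thesis by (simp add: emeasure_eq_measure)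
  qed
  show "emeasure \<mu> A = emeasure \<nu> A"
    unfolding *[OF \<mu> Z(2)] *[OF \<nu> Z(3)] by (rule sum.cong) (simp_all add: eq)
qed (use \<mu> \<nu> in auto)

text \<open>The quadratic terms in \<open>x\<close> cancel; a hyperplane with normal
  \<open>w - v\<close> remains.\<close>

lemma negligible_equidistance:
  fixes v w :: "'a::euclidean_space"
  assumes "v \<noteq> w"
  shows "negligible {x. (dist x v)\<^sup>2 - a = (dist x w)\<^sup>2 - b}"
proof -
  have "{x. (dist x v)\<^sup>2 - a = (dist x w)\<^sup>2 - b} = {x. (2 *\<^sub>R (w - v)) \<bullet> x = (norm w)\<^sup>2 - (norm v)\<^sup>2 + a - b}"
    by (auto simp: dist_norm power2_norm_eq_inner inner_diff_left inner_diff_right inner_commute algebra_simps)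
  moreover have "negligible {x. (2 *\<^sub>R (w - v)) \<bullet> x = (norm w)\<^sup>2 - (norm v)\<^sup>2 + a - b}"
    using assms by (intro negligible_hyperplane) auto
  ultimately show ?thesis by simp
qed

lemma AE_lborel_absolutely_continuous_negligible:
  fixes \<mu> :: "'a::euclidean_space measure"
  assumes "absolutely_continuous lborel \<mu>" "sets \<mu> = sets borel" "negligible N" "N \<in> sets borel"
  shows "AE x in \<mu>. x \<notin> N"
proof -
  have "N \<in> null_sets lborel"
    using assms(3,4) by (simp add: negligible_iff_null_sets null_sets_def)
  then have "N \<in> null_sets \<mu>" using assms(1) by (auto simp: absolutely_continuous_def)
  then show ?thesis by (rule AE_not_in)
qed

text \<open>Complementary slackness. The cells of the maximiser define a map \<open>T'\<close> that
  transports \<open>\<mu>\<close> to \<open>\<nu>\<close> and attains the dual value; since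
  \<open>\<T>\<close> costs no more, the nonnegative slack of \<open>\<T>\<close> integrates to at
  most 0. So \<open>\<T> x\<close> lies almost everywhere in its own cell, and absence of ties makes
  the inequality strict.\<close>

lemma OT_map_strict_potential:
  fixes \<mu> \<nu> :: "'a::euclidean_space measure"
  assumes \<mu>: "prob_space \<mu>" "sets \<mu> = sets borel" and \<nu>: "prob_space \<nu>" "sets \<nu> = sets borel"
    and Z: "finite Z" "Z \<noteq> {}" and \<nu>Z: "AE y in \<nu>. y \<in> Z"
    and bd: "AE x in \<mu>. norm x \<le> R" and ac: "absolutely_continuous lborel \<mu>"
    and OT: "is_OT_map \<mu> \<nu> \<T>"
  obtains \<psi> where "\<psi> \<in> borel_measurable borel" "AE x in \<mu>. \<T> x \<in> Z"
    "AE x in \<mu>. \<forall>v\<in>Z - {\<T> x}. (dist x (\<T> x))\<^sup>2 - \<psi> (\<T> x) < (dist x v)\<^sup>2 - \<psi> v"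
proof -
  interpret \<mu>: prob_space \<mu> by fact
  interpret \<nu>: prob_space \<nu> by fact
  note [measurable_cong] = \<mu>(2) \<nu>(2)
  note [measurable] = cpot_borel[OF Z]
  have sp[simp]: "space \<mu> = UNIV" using \<mu>(2) sets_eq_imp_space_eq by fastforce
  have T[measurable]: "\<T> \<in> borel_measurable \<mu>" and dT: "distr \<mu> borel \<T> = \<nu>"
    and cT: "(\<integral>\<^sup>+ x. ennreal ((dist x (\<T> x))\<^sup>2) \<partial>\<mu>) = W2cost \<mu> \<nu>"
    using OT by (auto simp: is_OT_map_def)
  have TZ: "AE x in \<mu>. \<T> x \<in> Z"
    by (rule AE_distrD[OF T]) (simp only: dT \<nu>Z)
  define D where "D = Max ((\<lambda>v. norm v) ` Z)"
  have D: "norm v \<le> D" if "v \<in> Z" for v unfolding D_def using Z that by (intro Max_ge) auto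
  have bd2: "AE x in \<mu>. \<forall>v\<in>Z. (dist x v)\<^sup>2 \<le> (R + D)\<^sup>2"
    using bd
  proof eventually_elim
    case (elim x)
    show ?case
    proof
      fix v assume "v \<in> Z"
      then have "dist x v \<le> R + D"
        using elim D[of v] norm_triangle_ineq4[of x v] by (auto simp: dist_norm)
      then show "(dist x v)\<^sup>2 \<le> (R + D)\<^sup>2" by (intro power_mono) auto
    qed
  qed
  define w where "w v = measure \<nu> {v}" for v
  have sw: "(\<Sum>v\<in>Z. w v) = 1"
  proof -
    have "(\<Sum>v\<in>Z. w v) = measure \<nu> Z"
      unfolding w_def using Z \<nu>(2) by (intro \<nu>.finite_measure_eq_sum_singleton[symmetric]) auto
    also have "\<dots> = 1"
      using \<nu>Z Z by (subst \<nu>.prob_eq_1) (auto simp: \<nu>(2) intro!: finite_imp_closed borel_closed)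
    finally show ?thesis .
  qed
  obtain \<psi> where max: "\<And>\<psi>'. (\<integral>x. cpot Z \<psi>' x \<partial>\<mu>) + (\<Sum>v\<in>Z. w v * \<psi>' v)
       \<le> (\<integral>x. cpot Z \<psi> x \<partial>\<mu>) + (\<Sum>v\<in>Z. w v * \<psi> v)" and \<psi>0: "\<And>v. v \<notin> Z \<Longrightarrow> \<psi> v = 0"
    using dual_maximizer_exists[OF Z \<mu> bd2 _ sw] by (metis w_def measure_nonneg)
  have \<psi>b[measurable]: "\<psi> \<in> borel_measurable borel"
  proof -
    have "\<psi> x = (\<Sum>v\<in>Z. \<psi> v * indicator {v} x)" for x
    proof -
      have "(\<Sum>v\<in>Z. \<psi> v * indicator {v} x) = (\<Sum>v\<in>Z. if v = x then \<psi> x else 0)"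
        by (intro sum.cong) (auto simp: indicator_def)
      then show ?thesis using \<psi>0[of x] Z(1) by simp
    qed
    then have "\<psi> = (\<lambda>x. \<Sum>v\<in>Z. \<psi> v * indicator {v} x)" by (rule ext)
    moreover have "(\<lambda>x. \<Sum>v\<in>Z. \<psi> v * indicator {v} x) \<in> borel_measurable borel" by measurable
    ultimately show ?thesis by metis
  qed
  define Cl where "Cl v = {x. (dist x v)\<^sup>2 - \<psi> v \<le> cpot Z \<psi> x}" for v
  have Clb: "Cl v \<in> sets borel" for v unfolding Cl_def by measurable
  then have Cl[measurable]: "Cl v \<in> sets \<mu>" for v using \<mu>(2) by simp
  have wCl: "w v \<le> measure \<mu> (Cl v)" if "v \<in> Z" for v
    unfolding Cl_def by (rule dual_maximizer_cell[OF Z \<mu> bd2 max that])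
  \<comment> \<open>This is where absolute continuity enters: ties lie on finitely many
    hyperplanes.\<close>
  have ties: "AE x in \<mu>. \<forall>v\<in>Z. \<forall>u\<in>Z - {v}. (dist x v)\<^sup>2 - \<psi> v \<noteq> (dist x u)\<^sup>2 - \<psi> u"
  proof -
    have "AE x in \<mu>. (dist x v)\<^sup>2 - \<psi> v \<noteq> (dist x u)\<^sup>2 - \<psi> u" if "u \<noteq> v" for u v
    proof -
      have "AE x in \<mu>. x \<notin> {x. (dist x v)\<^sup>2 - \<psi> v = (dist x u)\<^sup>2 - \<psi> u}"
        using that by (intro AE_lborel_absolutely_continuous_negligible[OF ac \<mu>(2)] negligible_equidistance) auto
      then show ?thesis by simp
    qed
    then show ?thesis using Z(1) by (auto intro!: AE_finite_allI)
  qed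
  have uniq: "AE x in \<mu>. \<forall>v\<in>Z. x \<in> Cl v \<longrightarrow> (\<forall>u\<in>Z - {v}. x \<notin> Cl u \<and> (dist x v)\<^sup>2 - \<psi> v < (dist x u)\<^sup>2 - \<psi> u)"
    using ties
  proof eventually_elim
    case (elim x)
    show ?case
    proof (intro ballI impI)
      fix v u assume v: "v \<in> Z" and xv: "x \<in> Cl v" and u: "u \<in> Z - {v}"
      have "(dist x v)\<^sup>2 - \<psi> v \<le> (dist x u)\<^sup>2 - \<psi> u"
        using xv cpot_le[OF Z(1), of u \<psi> x] u by (auto simp: Cl_def)
      moreover have "(dist x v)\<^sup>2 - \<psi> v \<noteq> (dist x u)\<^sup>2 - \<psi> u" using elim v u by auto
      ultimately have *: "(dist x v)\<^sup>2 - \<psi> v < (dist x u)\<^sup>2 - \<psi> u" by simp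
      then show "x \<notin> Cl u \<and> (dist x v)\<^sup>2 - \<psi> v < (dist x u)\<^sup>2 - \<psi> u"
        using cpot_le[OF Z(1) v, of \<psi> x] by (auto simp: Cl_def)
    qed
  qed
  have ex: "\<exists>v\<in>Z. x \<in> Cl v" for x
  proof -
    obtain v where "v \<in> Z" "cpot Z \<psi> x = (dist x v)\<^sup>2 - \<psi> v"
      by (rule cpot_attained[OF Z])
    then show ?thesis by (intro bexI[of _ v]) (simp_all add: Cl_def)
  qed
  \<comment> \<open>Almost everywhere exactly one indicator is 1, so the sum selects the target of
    the cell containing \<open>x\<close>; measurability is immediate in this form.\<close>
  define T' where "T' x = (\<Sum>v\<in>Z. indicator (Cl v) x *\<^sub>R v)" for x
  have T'm[measurable]: "T' \<in> borel_measurable \<mu>" unfolding T'_def by measurable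
  have T': "AE x in \<mu>. \<forall>v\<in>Z. x \<in> Cl v \<longleftrightarrow> T' x = v"
    using uniq
  proof eventually_elim
    case (elim x)
    obtain v where v: "v \<in> Z" "x \<in> Cl v" using ex by auto
    have nv: "x \<notin> Cl u" if "u \<in> Z" "u \<noteq> v" for u using elim v that by blast
    have "T' x = (\<Sum>u\<in>Z. if u = v then v else 0)"
      unfolding T'_def by (intro sum.cong refl) (use v(2) nv in \<open>simp add: indicator_def\<close>)
    then have "T' x = v" using Z(1) v(1) by simp
    then show ?case using v nv by metis
  qed
  have T'Z: "AE x in \<mu>. T' x \<in> Z"
    using T' by eventually_elim (metis ex)
  have m: "measure \<mu> (Cl v) = measure (distr \<mu> borel T') {v}" if "v \<in> Z" for v
  proof -
    have "measure (distr \<mu> borel T') {v} = measure \<mu> (T' -` {v} \<inter> space \<mu>)" by (rule measure_distr) auto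
    also have "\<dots> = measure \<mu> (Cl v)"
    proof (rule \<mu>.finite_measure_eq_AE)
      show "AE x in \<mu>. (x \<in> T' -` {v} \<inter> space \<mu>) = (x \<in> Cl v)"
        using T' by eventually_elim (use that in auto)
    qed (use measurable_sets[OF T'm, of "{v}"] in auto)
    finally show ?thesis by simp
  qed
  interpret d: prob_space "distr \<mu> borel T'" by (rule \<mu>.prob_space_distr) simp
  have dZ: "AE y in distr \<mu> borel T'. y \<in> Z"
    using T'Z by (subst AE_distr_iff) (auto intro!: finite_imp_closed borel_closed Z)
  have sm: "(\<Sum>v\<in>Z. measure \<mu> (Cl v)) = 1"
  proof -
    have "(\<Sum>v\<in>Z. measure \<mu> (Cl v)) = measure (distr \<mu> borel T') Z"
      using Z m by (subst d.finite_measure_eq_sum_singleton) auto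
    also have "\<dots> = 1"
      using dZ Z by (subst d.prob_eq_1) (auto intro!: finite_imp_closed borel_closed)
    finally show ?thesis .
  qed
  \<comment> \<open>Each cell has at least the mass it should have, and both families of masses sum
    to 1, so no cell can exceed it.\<close>
  have weq: "measure \<mu> (Cl v) = w v" if "v \<in> Z" for v
  proof (rule ccontr)
    assume "measure \<mu> (Cl v) \<noteq> w v"
    then have "w v < measure \<mu> (Cl v)" using wCl[OF that] by simp
    then have "(\<Sum>v\<in>Z. w v) < (\<Sum>v\<in>Z. measure \<mu> (Cl v))"
      using Z wCl that by (intro sum_strict_mono_ex1) auto
    then show False using sw sm by simp
  qed
  have dT': "distr \<mu> borel T' = \<nu>"
    by (rule distr_eq_finite_support[OF _ _ _ _ Z(1) dZ \<nu>Z])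
      (use m weq in \<open>auto simp: w_def \<nu> d.finite_measure_axioms \<nu>.finite_measure_axioms\<close>)
  have idm: "(\<lambda>x. x) \<in> borel_measurable \<mu>" by (simp add: measurable_ident_sets \<mu>(2))
  have bdd: "integrable \<mu> (\<lambda>x. (dist x (S x))\<^sup>2)"
    if S[measurable]: "S \<in> borel_measurable \<mu>" and SZ: "AE x in \<mu>. S x \<in> Z" for S
  proof (rule \<mu>.integrable_const_bound)
    show "AE x in \<mu>. norm ((dist x (S x))\<^sup>2) \<le> (R + D)\<^sup>2"
      using bd2 SZ by eventually_elim auto
    show "(\<lambda>x. (dist x (S x))\<^sup>2) \<in> borel_measurable \<mu>"
      by (intro borel_measurable_power borel_measurable_dist idm S)
  qed
  have i1: "integrable \<mu> (\<lambda>x. \<psi> (S x))"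
    if S[measurable]: "S \<in> borel_measurable \<mu>" and SZ: "AE x in \<mu>. S x \<in> Z" for S
  proof (rule \<mu>.integrable_const_bound)
    show "AE x in \<mu>. norm (\<psi> (S x)) \<le> (\<Sum>v\<in>Z. \<bar>\<psi> v\<bar>)"
      using SZ by eventually_elim (use Z in \<open>auto intro!: member_le_sum[where f="\<lambda>v. \<bar>\<psi> v\<bar>"]\<close>)
  qed auto
  have i2: "integrable \<mu> (cpot Z \<psi>)" by (rule integrable_cpot[OF Z \<mu> bd2])
  \<comment> \<open>\<open>T'\<close> is an admissible transport between the same measures, so
    optimality of \<open>\<T>\<close> applies.\<close>
  have "(\<integral>\<^sup>+ x. ennreal ((dist x (\<T> x))\<^sup>2) \<partial>\<mu>) \<le> (\<integral>\<^sup>+ x. ennreal ((dist x (T' x))\<^sup>2) \<partial>\<mu>)"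
  proof -
    have "distr \<mu> borel (\<lambda>x. x) = \<mu>" using \<mu>(2) by (intro distr_id2) simp
    then show ?thesis
      using W2cost_distr_le[OF \<mu>(1) idm T'm] cT dT' by simp
  qed
  then have le: "(\<integral>x. (dist x (\<T> x))\<^sup>2 \<partial>\<mu>) \<le> (\<integral>x. (dist x (T' x))\<^sup>2 \<partial>\<mu>)"
    using bdd[OF T TZ] bdd[OF T'm T'Z] by (simp add: nn_integral_eq_integral)
  have e1: "(\<integral>x. \<psi> (\<T> x) \<partial>\<mu>) = (\<integral>x. \<psi> (T' x) \<partial>\<mu>)"
    using integral_distr[OF T \<psi>b] integral_distr[OF T'm \<psi>b] dT dT' by simp
  have e2: "(\<integral>x. (dist x (T' x))\<^sup>2 - \<psi> (T' x) \<partial>\<mu>) = (\<integral>x. cpot Z \<psi> x \<partial>\<mu>)"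
  proof (rule integral_cong_AE)
    show "AE x in \<mu>. (dist x (T' x))\<^sup>2 - \<psi> (T' x) = cpot Z \<psi> x"
      using T' T'Z
    proof eventually_elim
      case (elim x)
      then have "x \<in> Cl (T' x)" by auto
      then show ?case using cpot_le[OF Z(1) elim(2), of \<psi> x] by (auto simp: Cl_def)
    qed
  qed (use borel_measurable_integrable[OF bdd[OF T'm T'Z]] in auto)
  \<comment> \<open>The slack of the dual constraint along \<open>\<T>\<close>. Both maps push
    \<open>\<mu>\<close> to \<open>\<nu>\<close>, so their price terms have equal integrals and only
    the costs are compared.\<close>
  let ?h = "\<lambda>x. (dist x (\<T> x))\<^sup>2 - \<psi> (\<T> x) - cpot Z \<psi> x"
  have ih: "integrable \<mu> ?h"
    using bdd[OF T TZ] i1[OF T TZ] i2 by auto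
  have h0: "AE x in \<mu>. 0 \<le> ?h x"
    using TZ by eventually_elim (use cpot_le[OF Z(1)] in \<open>auto simp: le_diff_eq\<close>)
  have "integral\<^sup>L \<mu> ?h \<le> 0"
    using le e1 e2 bdd[OF T TZ] i1[OF T TZ] i2 bdd[OF T'm T'Z] i1[OF T'm T'Z] by simp
  moreover have "0 \<le> integral\<^sup>L \<mu> ?h" using h0 by (rule integral_nonneg_AE)
  ultimately have "AE x in \<mu>. ?h x = 0"
    using integral_nonneg_eq_0_iff_AE[OF ih h0] by simp
  then have "AE x in \<mu>. \<forall>v\<in>Z - {\<T> x}. (dist x (\<T> x))\<^sup>2 - \<psi> (\<T> x) < (dist x v)\<^sup>2 - \<psi> v"
    using uniq TZ
  proof eventually_elim
    case (elim x)
    then have "x \<in> Cl (\<T> x)" by (auto simp: Cl_def)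
    then show ?case using elim(2,3) by blast
  qed
  with \<psi>b TZ show ?thesis by (rule that)
qed

section \<open>Directional derivative of the squared Wasserstein distance\<close>

lemma W2_squared: "(W2 \<mu> \<nu>)\<^sup>2 = enn2real (W2cost \<mu> \<nu>)"
  by (simp add: W2_def)

text \<open>The perturbation is Lagrangian and uniformly O(\<epsilon>). The transport bound misses
  the linear term by at most \<open>(A * \<epsilon>)\<^sup>2\<close>; the dual bound misses it by
  the integral of \<open>\<rho>\<close>, whose quotient by \<epsilon> is bounded and tends to 0
  wherever the minimiser is strict.\<close>

lemma W2_squared_directional_derivative:
  fixes X :: "'b \<Rightarrow> 'a::euclidean_space" and W :: "real \<Rightarrow> 'b \<Rightarrow> 'a"
  assumes M: "prob_space M" and X: "X \<in> borel_measurable M" and Xb: "AE x in M. norm (X x) \<le> R"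
    and \<nu>: "prob_space \<nu>" "sets \<nu> = sets borel" and Z: "finite Z" "Z \<noteq> {}" and \<nu>Z: "AE y in \<nu>. y \<in> Z"
    and ac: "absolutely_continuous lborel (distr M borel X)" and OT: "is_OT_map (distr M borel X) \<nu> \<T>"
    and \<epsilon>0: "0 < \<epsilon>0" and W: "\<And>\<epsilon>. 0 < \<epsilon> \<Longrightarrow> \<epsilon> \<le> \<epsilon>0 \<Longrightarrow> W \<epsilon> \<in> borel_measurable M"
    and Wb: "\<And>\<epsilon>. 0 < \<epsilon> \<Longrightarrow> \<epsilon> \<le> \<epsilon>0 \<Longrightarrow> AE x in M. norm (W \<epsilon> x) \<le> A * \<epsilon>" and A: "0 \<le> A"
  shows "((\<lambda>\<epsilon>. (1/2 * (W2 (distr M borel (\<lambda>x. X x + W \<epsilon> x)) \<nu>)\<^sup>2 - 1/2 * (W2 (distr M borel X) \<nu>)\<^sup>2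
      - (\<integral>x. (X x - \<T> (X x)) \<bullet> W \<epsilon> x \<partial>M)) / \<epsilon>) \<longlongrightarrow> 0) (at_right 0)"
proof -
  interpret prob_space M by fact
  interpret \<nu>: prob_space \<nu> by fact
  note [measurable] = X
  note [measurable_cong] = \<nu>(2)
  let ?\<mu> = "distr M borel X"
  have \<mu>: "prob_space ?\<mu>" by (rule prob_space_distr[OF X])
  have \<T>[measurable]: "\<T> \<in> borel_measurable borel" and dT: "distr ?\<mu> borel \<T> = \<nu>"
    and cT: "(\<integral>\<^sup>+ x. ennreal ((dist x (\<T> x))\<^sup>2) \<partial>?\<mu>) = W2cost ?\<mu> \<nu>"
    using OT by (auto simp: is_OT_map_def)
  have bd\<mu>: "AE x in ?\<mu>. norm x \<le> R" using Xb by (subst AE_distr_iff) auto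
  obtain \<psi> where \<psi>[measurable]: "\<psi> \<in> borel_measurable borel" and TZ: "AE x in ?\<mu>. \<T> x \<in> Z"
    and strict: "AE x in ?\<mu>. \<forall>v\<in>Z - {\<T> x}. (dist x (\<T> x))\<^sup>2 - \<psi> (\<T> x) < (dist x v)\<^sup>2 - \<psi> v"
    by (rule OT_map_strict_potential[OF \<mu> _ \<nu> Z \<nu>Z bd\<mu> ac OT]) auto
  define Y where "Y x = \<T> (X x)" for x
  have Y[measurable]: "Y \<in> borel_measurable M" unfolding Y_def by measurable
  have YZ: "AE x in M. Y x \<in> Z" unfolding Y_def by (rule AE_distrD[OF X TZ])
  have Ys: "AE x in M. \<forall>v\<in>Z - {Y x}. (dist (X x) (Y x))\<^sup>2 - \<psi> (Y x) < (dist (X x) v)\<^sup>2 - \<psi> v"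
    unfolding Y_def by (rule AE_distrD[OF X strict])
  have \<nu>Y: "distr M borel Y = \<nu>"
    using dT by (subst (asm) distr_distr) (auto simp: comp_def Y_def[abs_def])
  define D where "D = Max ((\<lambda>v. norm v) ` Z)"
  have D: "norm v \<le> D" if "v \<in> Z" for v unfolding D_def using Z that by (intro Max_ge) auto
  have D0: "0 \<le> D" using D Z(2) norm_ge_zero order_trans by blast
  have sqi: "integrable M (\<lambda>x. (norm (V x))\<^sup>2)" if [measurable]: "V \<in> borel_measurable M" and "AE x in M. norm (V x) \<le> B" for V :: "'b \<Rightarrow> 'a" and B
    by (rule integrable_const_bound[of _ "B\<^sup>2"]) (use that(2) in \<open>auto elim!: eventually_mono intro!: power_mono\<close>)
  have ini: "integrable M (\<lambda>x. V x \<bullet> V' x)" if [measurable]: "V \<in> borel_measurable M" "V' \<in> borel_measurable M"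
    and b: "AE x in M. norm (V x) \<le> B" "AE x in M. norm (V' x) \<le> B'" for V V' :: "'b \<Rightarrow> 'a" and B B'
  proof (rule integrable_const_bound[of _ "\<bar>B\<bar> * \<bar>B'\<bar>"])
    show "AE x in M. norm (V x \<bullet> V' x) \<le> \<bar>B\<bar> * \<bar>B'\<bar>"
      using b
    proof eventually_elim
      case (elim x)
      have "norm (V x \<bullet> V' x) \<le> norm (V x) * norm (V' x)" using Cauchy_Schwarz_ineq2 by simp
      also have "\<dots> \<le> \<bar>B\<bar> * \<bar>B'\<bar>" using elim by (intro mult_mono) auto
      finally show ?case .
    qed
  qed measurable
  have XYb: "AE x in M. norm (X x - Y x) \<le> R + D"
    using Xb YZ
  proof eventually_elim
    case (elim x)
    then show ?case using norm_triangle_ineq4[of "X x" "Y x"] D[of "Y x"] by linarith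
  qed
  have iXY: "integrable M (\<lambda>x. (norm (X x - Y x))\<^sup>2)" by (rule sqi[OF _ XYb]) measurable
  have cost0: "enn2real (W2cost ?\<mu> \<nu>) = (\<integral>x. (norm (X x - Y x))\<^sup>2 \<partial>M)"
  proof -
    have "W2cost ?\<mu> \<nu> = (\<integral>\<^sup>+ x. ennreal ((norm (X x - Y x))\<^sup>2) \<partial>M)"
      unfolding cT[symmetric] by (subst nn_integral_distr) (auto simp: Y_def dist_norm)
    then show ?thesis using iXY by (simp add: nn_integral_eq_integral)
  qed
  define h where "h = cpot Z \<psi>"
  note [measurable] = cpot_borel[OF Z, of \<psi>, folded h_def]
  \<comment> \<open>The pointwise dual value after displacement, minus the old cost and its
    linearisation. If the minimiser stays at \<open>Y x\<close>, this is just the squared norm of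
    \<open>W \<epsilon> x\<close>.\<close>
  define \<rho> where "\<rho> \<epsilon> x = h (X x + W \<epsilon> x) + \<psi> (Y x) - (norm (X x - Y x))\<^sup>2 - 2 * ((X x - Y x) \<bullet> W \<epsilon> x)" for \<epsilon> x
  have i\<psi>: "integrable M (\<lambda>x. \<psi> (Y x))"
    by (rule integrable_const_bound[of _ "\<Sum>v\<in>Z. \<bar>\<psi> v\<bar>"])
      (use YZ Z(1) in \<open>auto elim!: eventually_mono intro!: member_le_sum[where f="\<lambda>v. \<bar>\<psi> v\<bar>"]\<close>)
  have sq: "(dist (a + b) c)\<^sup>2 = (dist a c)\<^sup>2 + 2 * ((a - c) \<bullet> b) + (norm b)\<^sup>2" for a b c :: 'a
    by (simp add: dist_norm power2_norm_eq_inner inner_diff_left inner_diff_right inner_add_left inner_add_right inner_commute algebra_simps)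
  let ?F = "\<lambda>\<epsilon>. enn2real (W2cost (distr M borel (\<lambda>x. X x + W \<epsilon> x)) \<nu>)"
  let ?I = "\<lambda>\<epsilon>. \<integral>x. (X x - Y x) \<bullet> W \<epsilon> x \<partial>M"
  \<comment> \<open>\<open>F0\<close> is a free name for the unperturbed cost, so that the estimate
    can be instantiated both with the integral and, through \<open>cost0\<close>, with the transport
    cost.\<close>
  have est: "?F \<epsilon> \<le> F0 + 2 * ?I \<epsilon> + (A * \<epsilon>)\<^sup>2 \<and> F0 + 2 * ?I \<epsilon> + (\<integral>x. \<rho> \<epsilon> x \<partial>M) \<le> ?F \<epsilon> \<and> integrable M (\<rho> \<epsilon>)
      \<and> (AE x in M. - (4 * D * A * \<epsilon>) \<le> \<rho> \<epsilon> x \<and> \<rho> \<epsilon> x \<le> (A * \<epsilon>)\<^sup>2)"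
    if \<epsilon>: "0 < \<epsilon>" "\<epsilon> \<le> \<epsilon>0" and F0: "F0 = (\<integral>x. (norm (X x - Y x))\<^sup>2 \<partial>M)" for \<epsilon> F0
  proof -
    note Wm[measurable] = W[OF \<epsilon>] and Wb = Wb[OF \<epsilon>]
    have iI: "integrable M (\<lambda>x. (X x - Y x) \<bullet> W \<epsilon> x)" by (rule ini[OF _ _ XYb Wb]) measurable
    have iW: "integrable M (\<lambda>x. (norm (W \<epsilon> x))\<^sup>2)" by (rule sqi[OF _ Wb]) measurable
    have W2le: "AE x in M. (norm (W \<epsilon> x))\<^sup>2 \<le> (A * \<epsilon>)\<^sup>2" using Wb by eventually_elim (intro power_mono, auto)
    have e: "(dist (X x + W \<epsilon> x) (Y x))\<^sup>2 = (norm (X x - Y x))\<^sup>2 + 2 * ((X x - Y x) \<bullet> W \<epsilon> x) + (norm (W \<epsilon> x))\<^sup>2" for x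
      unfolding sq by (simp add: dist_norm)
    have "W2cost (distr M borel (\<lambda>x. X x + W \<epsilon> x)) (distr M borel Y) \<le> (\<integral>\<^sup>+ x. ennreal ((dist (X x + W \<epsilon> x) (Y x))\<^sup>2) \<partial>M)"
      by (rule W2cost_distr_le[OF M]) measurable
    also have "\<dots> = ennreal (\<integral>x. (dist (X x + W \<epsilon> x) (Y x))\<^sup>2 \<partial>M)"
    proof (rule nn_integral_eq_integral)
      show "integrable M (\<lambda>x. (dist (X x + W \<epsilon> x) (Y x))\<^sup>2)" unfolding e using iI iW iXY by simp
    qed simp
    finally have c1: "W2cost (distr M borel (\<lambda>x. X x + W \<epsilon> x)) \<nu> \<le> ennreal (\<integral>x. (dist (X x + W \<epsilon> x) (Y x))\<^sup>2 \<partial>M)"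
      unfolding \<nu>Y .
    then have "?F \<epsilon> \<le> enn2real (ennreal (\<integral>x. (dist (X x + W \<epsilon> x) (Y x))\<^sup>2 \<partial>M))" by (rule enn2real_mono) simp
    also have "\<dots> = (\<integral>x. (dist (X x + W \<epsilon> x) (Y x))\<^sup>2 \<partial>M)" by (rule enn2real_ennreal) simp
    also have "\<dots> = (\<integral>x. (norm (X x - Y x))\<^sup>2 + 2 * ((X x - Y x) \<bullet> W \<epsilon> x) + (norm (W \<epsilon> x))\<^sup>2 \<partial>M)" by (simp only: e)
    also have "\<dots> = F0 + 2 * ?I \<epsilon> + (\<integral>x. (norm (W \<epsilon> x))\<^sup>2 \<partial>M)" unfolding F0 using iI iW iXY by simp
    also have "(\<integral>x. (norm (W \<epsilon> x))\<^sup>2 \<partial>M) \<le> (\<integral>x. (A * \<epsilon>)\<^sup>2 \<partial>M)" using iW W2le by (intro integral_mono_AE) auto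
    finally have up: "?F \<epsilon> \<le> F0 + 2 * ?I \<epsilon> + (A * \<epsilon>)\<^sup>2" by (simp add: prob_space)
    have b2: "AE x in M. norm (X x + W \<epsilon> x) \<le> R + A * \<epsilon>"
      using Xb Wb by eventually_elim (rule norm_triangle_mono)
    have ih: "integrable M (\<lambda>x. h (X x + W \<epsilon> x))"
    proof (rule integrable_const_bound)
      show "AE x in M. norm (h (X x + W \<epsilon> x)) \<le> (R + A * \<epsilon> + D)\<^sup>2 + (\<Sum>v\<in>Z. \<bar>\<psi> v\<bar>)"
        using b2
      proof eventually_elim
        case (elim x)
        have "(dist (X x + W \<epsilon> x) v)\<^sup>2 \<le> (R + A * \<epsilon> + D)\<^sup>2" if "v \<in> Z" for v
          using elim D[OF that] norm_triangle_ineq4[of "X x + W \<epsilon> x" v] by (intro power_mono) (auto simp: dist_norm)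
        then show ?case unfolding h_def using cpot_bound[OF Z] by simp
      qed
    qed measurable
    have i\<rho>: "integrable M (\<rho> \<epsilon>)" unfolding \<rho>_def[abs_def] using ih i\<psi> iXY iI by auto
    have "ennreal ((\<integral>x. cpot Z \<psi> x \<partial>distr M borel (\<lambda>x. X x + W \<epsilon> x)) + (\<integral>y. \<psi> y \<partial>\<nu>)) \<le> W2cost (distr M borel (\<lambda>x. X x + W \<epsilon> x)) \<nu>"
    proof (rule weak_duality[OF Z \<nu>Z _ _ \<nu> _ \<psi>])
      show "prob_space (distr M borel (\<lambda>x. X x + W \<epsilon> x))" by (rule prob_space_distr) measurable
      show "AE x in distr M borel (\<lambda>x. X x + W \<epsilon> x). norm x \<le> R + A * \<epsilon>" using b2 by (subst AE_distr_iff) auto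
    qed simp
    also have "(\<integral>x. cpot Z \<psi> x \<partial>distr M borel (\<lambda>x. X x + W \<epsilon> x)) = (\<integral>x. h (X x + W \<epsilon> x) \<partial>M)"
      unfolding h_def[symmetric] by (subst integral_distr) auto
    also have "(\<integral>y. \<psi> y \<partial>\<nu>) = (\<integral>x. \<psi> (Y x) \<partial>M)"
      unfolding \<nu>Y[symmetric] by (subst integral_distr) auto
    finally have wd: "ennreal ((\<integral>x. h (X x + W \<epsilon> x) \<partial>M) + (\<integral>x. \<psi> (Y x) \<partial>M)) \<le> W2cost (distr M borel (\<lambda>x. X x + W \<epsilon> x)) \<nu>" .
    \<comment> \<open>Finiteness is needed before passing to reals, because \<open>enn2real\<close>
      sends infinity to 0.\<close>
    have "W2cost (distr M borel (\<lambda>x. X x + W \<epsilon> x)) \<nu> < top" using c1 by (rule le_less_trans) simp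
    then have "enn2real (ennreal ((\<integral>x. h (X x + W \<epsilon> x) \<partial>M) + (\<integral>x. \<psi> (Y x) \<partial>M))) \<le> ?F \<epsilon>"
      using wd by (intro enn2real_mono)
    \<comment> \<open>A negative dual value is sent to 0 by \<open>ennreal\<close>; the claim then
      holds because the cost is nonnegative.\<close>
    then have "(\<integral>x. h (X x + W \<epsilon> x) \<partial>M) + (\<integral>x. \<psi> (Y x) \<partial>M) \<le> ?F \<epsilon>"
      by (cases "0 \<le> (\<integral>x. h (X x + W \<epsilon> x) \<partial>M) + (\<integral>x. \<psi> (Y x) \<partial>M)") (auto intro: order_trans[OF _ enn2real_nonneg])
    moreover have "(\<integral>x. \<rho> \<epsilon> x \<partial>M) = (\<integral>x. h (X x + W \<epsilon> x) \<partial>M) + (\<integral>x. \<psi> (Y x) \<partial>M) - F0 - 2 * ?I \<epsilon>"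
      unfolding \<rho>_def F0 using ih i\<psi> iXY iI by simp
    ultimately have low: "F0 + 2 * ?I \<epsilon> + (\<integral>x. \<rho> \<epsilon> x \<partial>M) \<le> ?F \<epsilon>" by simp
    have "AE x in M. - (4 * D * A * \<epsilon>) \<le> \<rho> \<epsilon> x \<and> \<rho> \<epsilon> x \<le> (A * \<epsilon>)\<^sup>2"
      using Ys YZ Wb W2le
    proof eventually_elim
      case (elim x)
      have "h (X x + W \<epsilon> x) \<le> (dist (X x + W \<epsilon> x) (Y x))\<^sup>2 - \<psi> (Y x)" unfolding h_def by (rule cpot_le[OF Z(1) elim(2)])
      then have "\<rho> \<epsilon> x \<le> (A * \<epsilon>)\<^sup>2" using elim(4) unfolding e \<rho>_def by linarith
      \<comment> \<open>A new minimiser \<open>v\<close> was no better than \<open>Y x\<close>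
        before the displacement, so it gains at most twice the inner product of
        \<open>Y x - v\<close> with \<open>W \<epsilon> x\<close>. Two points of norm at most
        \<open>D\<close> give the factor 4.\<close>
      moreover have "- (4 * D * A * \<epsilon>) \<le> \<rho> \<epsilon> x"
      proof -
        obtain v where v: "v \<in> Z" "h (X x + W \<epsilon> x) = (dist (X x + W \<epsilon> x) v)\<^sup>2 - \<psi> v"
          unfolding h_def by (rule cpot_attained[OF Z])
        have o: "(dist (X x) (Y x))\<^sup>2 - \<psi> (Y x) \<le> (dist (X x) v)\<^sup>2 - \<psi> v"
          using elim(1) v(1) by (cases "v = Y x") (auto intro: less_imp_le)
        have "\<rho> \<epsilon> x \<ge> 2 * ((X x - v) \<bullet> W \<epsilon> x) - 2 * ((X x - Y x) \<bullet> W \<epsilon> x)"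
          using o zero_le_power2[of "norm (W \<epsilon> x)"] unfolding \<rho>_def v(2) sq unfolding dist_norm by linarith
        also have "2 * ((X x - v) \<bullet> W \<epsilon> x) - 2 * ((X x - Y x) \<bullet> W \<epsilon> x) = 2 * ((Y x - v) \<bullet> W \<epsilon> x)"
          by (simp add: inner_diff_left)
        finally have 1: "2 * ((Y x - v) \<bullet> W \<epsilon> x) \<le> \<rho> \<epsilon> x" .
        have "\<bar>(Y x - v) \<bullet> W \<epsilon> x\<bar> \<le> norm (Y x - v) * norm (W \<epsilon> x)" by (rule Cauchy_Schwarz_ineq2)
        also have "\<dots> \<le> (2 * D) * (A * \<epsilon>)"
          using elim(3) D[OF v(1)] D[OF elim(2)] norm_triangle_ineq4[of "Y x" v] D0 by (intro mult_mono) auto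
        finally show ?thesis using 1 by (simp add: abs_le_iff)
      qed
      ultimately show ?case by simp
    qed
    then show ?thesis using up low i\<rho> by blast
  qed
  have lim: "((\<lambda>\<epsilon>. (\<integral>x. \<rho> \<epsilon> x / \<epsilon> \<partial>M)) \<longlongrightarrow> 0) (at_right 0)"
  \<comment> \<open>Along a sequence only countably many exceptional null sets occur, and dominated
    convergence applies.\<close>
  proof (rule tendsto_at_right_sequentially[OF \<epsilon>0])
    fix S :: "nat \<Rightarrow> real" assume S: "\<And>n. 0 < S n" "\<And>n. S n < \<epsilon>0" "S \<longlonglongrightarrow> 0"
    have S': "S n \<le> \<epsilon>0" for n using S(2)[of n] by simp
    note es = est[OF S(1) S' refl]
    have "(\<lambda>n. \<integral>x. \<rho> (S n) x / S n \<partial>M) \<longlonglongrightarrow> (\<integral>x. 0 \<partial>M)"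
    proof (rule integral_dominated_convergence[where w = "\<lambda>_. 4 * D * A + A\<^sup>2 * \<epsilon>0"])
      show "(\<lambda>x. \<rho> (S n) x / S n) \<in> borel_measurable M" for n
        using es[of n] by (auto intro!: borel_measurable_divide dest: borel_measurable_integrable)
      show "AE x in M. norm (\<rho> (S n) x / S n) \<le> 4 * D * A + A\<^sup>2 * \<epsilon>0" for n
      proof -
        have "AE x in M. - (4 * D * A * S n) \<le> \<rho> (S n) x \<and> \<rho> (S n) x \<le> (A * S n)\<^sup>2" using es[of n] by blast
        then show ?thesis
        proof eventually_elim
          case (elim x)
          have "(A * S n)\<^sup>2 = A\<^sup>2 * S n * S n" by (simp add: power2_eq_square)
          also have "\<dots> \<le> A\<^sup>2 * \<epsilon>0 * S n" using S(1)[of n] S'[of n] by (intro mult_right_mono mult_left_mono) auto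
          finally have "(A * S n)\<^sup>2 \<le> A\<^sup>2 * \<epsilon>0 * S n" .
          moreover have "0 \<le> 4 * D * A * S n" "0 \<le> A\<^sup>2 * \<epsilon>0 * S n" using D0 A S(1)[of n] \<epsilon>0 by simp_all
          ultimately have "\<bar>\<rho> (S n) x\<bar> \<le> 4 * D * A * S n + A\<^sup>2 * \<epsilon>0 * S n" using elim by linarith
          then have "\<bar>\<rho> (S n) x\<bar> \<le> (4 * D * A + A\<^sup>2 * \<epsilon>0) * S n" by (simp only: distrib_right)
          then show ?case using S(1)[of n] by (simp add: abs_divide divide_le_eq)
        qed
      qed
      have "AE x in M. \<forall>n. norm (W (S n) x) \<le> A * S n \<and> \<rho> (S n) x \<le> (A * S n)\<^sup>2"
        unfolding AE_all_countable
      proof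
        fix n
        have "AE x in M. - (4 * D * A * S n) \<le> \<rho> (S n) x \<and> \<rho> (S n) x \<le> (A * S n)\<^sup>2" using es[of n] by blast
        with Wb[OF S(1) S'] show "AE x in M. norm (W (S n) x) \<le> A * S n \<and> \<rho> (S n) x \<le> (A * S n)\<^sup>2"
          by eventually_elim auto
      qed
      then show "AE x in M. (\<lambda>n. \<rho> (S n) x / S n) \<longlonglongrightarrow> 0"
        using Ys YZ
      proof eventually_elim
        case (elim x)
        \<comment> \<open>Once \<epsilon> is small against the gap at \<open>x\<close>, the old
          target is still a minimiser and \<open>\<rho>\<close> is at least a square. The threshold
          depends on \<open>x\<close>, hence no rate.\<close>
        have ev: "\<forall>\<^sub>F n in sequentially. 0 \<le> \<rho> (S n) x"
        proof -
          have "\<forall>\<^sub>F n in sequentially. \<forall>v\<in>Z. (dist (X x + W (S n) x) (Y x))\<^sup>2 - \<psi> (Y x) \<le> (dist (X x + W (S n) x) v)\<^sup>2 - \<psi> v"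
          proof (rule eventually_ball_finite[OF Z(1)], intro ballI)
            fix v assume v: "v \<in> Z"
            show "\<forall>\<^sub>F n in sequentially. (dist (X x + W (S n) x) (Y x))\<^sup>2 - \<psi> (Y x) \<le> (dist (X x + W (S n) x) v)\<^sup>2 - \<psi> v"
            proof (cases "v = Y x")
              case False
              define gap where "gap = ((dist (X x) v)\<^sup>2 - \<psi> v) - ((dist (X x) (Y x))\<^sup>2 - \<psi> (Y x))"
              have gap: "0 < gap" using elim(2) v False unfolding gap_def by force
              have "(\<lambda>n. 4 * D * A * S n) \<longlonglongrightarrow> 4 * D * A * 0" by (intro tendsto_intros S)
              then have "\<forall>\<^sub>F n in sequentially. 4 * D * A * S n < gap" using gap by (intro order_tendstoD) auto
              then show ?thesis
              proof eventually_elim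
                case (elim n)
                have "\<bar>(Y x - v) \<bullet> W (S n) x\<bar> \<le> norm (Y x - v) * norm (W (S n) x)" by (rule Cauchy_Schwarz_ineq2)
                also have "\<dots> \<le> (2 * D) * (A * S n)"
                  using \<open>\<forall>n. norm (W (S n) x) \<le> A * S n \<and> \<rho> (S n) x \<le> (A * S n)\<^sup>2\<close> D[OF v] D[OF \<open>Y x \<in> Z\<close>] norm_triangle_ineq4[of "Y x" v] D0
                  by (intro mult_mono) auto
                finally have "- (4 * D * A * S n) \<le> 2 * ((Y x - v) \<bullet> W (S n) x)" by (simp add: abs_le_iff mult_ac)
                then show ?case using elim unfolding sq gap_def by (simp add: inner_diff_left)
              qed
            qed simp
          qed
          then show ?thesis
          proof eventually_elim
            case (elim n)
            then have "(dist (X x + W (S n) x) (Y x))\<^sup>2 - \<psi> (Y x) \<le> h (X x + W (S n) x)"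
              unfolding h_def by (intro cpot_ge[OF Z]) auto
            then have "(norm (W (S n) x))\<^sup>2 \<le> \<rho> (S n) x" unfolding sq \<rho>_def by (simp add: dist_norm)
            then show ?case using zero_le_power2 order_trans by blast
          qed
        qed
        show ?case
        proof (rule tendsto_sandwich[OF _ _ tendsto_const])
          show "\<forall>\<^sub>F n in sequentially. 0 \<le> \<rho> (S n) x / S n" using ev by eventually_elim (simp add: less_imp_le[OF S(1)])
          have "\<rho> (S n) x / S n \<le> A\<^sup>2 * S n" for n
          proof -
            have "\<rho> (S n) x \<le> (A\<^sup>2 * S n) * S n" using elim(1) by (simp add: power2_eq_square mult_ac)
            then show ?thesis using S(1)[of n] by (simp add: divide_le_eq)
          qed
          then show "\<forall>\<^sub>F n in sequentially. \<rho> (S n) x / S n \<le> A\<^sup>2 * S n" by simp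
          have "(\<lambda>n. A\<^sup>2 * S n) \<longlonglongrightarrow> A\<^sup>2 * 0" by (intro tendsto_intros S)
          then show "(\<lambda>n. A\<^sup>2 * S n) \<longlonglongrightarrow> 0" by simp
        qed
      qed
    qed simp_all
    then show "(\<lambda>n. \<integral>x. \<rho> (S n) x / S n \<partial>M) \<longlonglongrightarrow> 0" by simp
  qed
  let ?q = "\<lambda>\<epsilon>. (1/2 * (W2 (distr M borel (\<lambda>x. X x + W \<epsilon> x)) \<nu>)\<^sup>2 - 1/2 * (W2 (distr M borel X) \<nu>)\<^sup>2 - (\<integral>x. (X x - \<T> (X x)) \<bullet> W \<epsilon> x \<partial>M)) / \<epsilon>"
  have ev: "\<forall>\<^sub>F \<epsilon> in at_right (0::real). 0 < \<epsilon> \<and> \<epsilon> \<le> \<epsilon>0"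
    using eventually_at_right_less[of "0::real"] eventually_at_right_real[OF \<epsilon>0] by eventually_elim auto
  show ?thesis
  proof (rule tendsto_sandwich)
    show "\<forall>\<^sub>F \<epsilon> in at_right 0. 1/2 * (\<integral>x. \<rho> \<epsilon> x / \<epsilon> \<partial>M) \<le> ?q \<epsilon>"
      using ev
    proof eventually_elim
      case (elim \<epsilon>)
      have "1/2 * (\<integral>x. \<rho> \<epsilon> x \<partial>M) \<le> 1/2 * ?F \<epsilon> - 1/2 * enn2real (W2cost ?\<mu> \<nu>) - ?I \<epsilon>"
        using est[of \<epsilon>, OF _ _ cost0] elim by simp
      then have "(1/2 * (\<integral>x. \<rho> \<epsilon> x \<partial>M)) / \<epsilon> \<le> (1/2 * ?F \<epsilon> - 1/2 * enn2real (W2cost ?\<mu> \<nu>) - ?I \<epsilon>) / \<epsilon>"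
        using elim by (intro divide_right_mono) auto
      then show ?case by (simp add: W2_squared Y_def)
    qed
    show "\<forall>\<^sub>F \<epsilon> in at_right 0. ?q \<epsilon> \<le> A\<^sup>2 / 2 * \<epsilon>"
      using ev
    proof eventually_elim
      case (elim \<epsilon>)
      have "1/2 * ?F \<epsilon> - 1/2 * enn2real (W2cost ?\<mu> \<nu>) - ?I \<epsilon> \<le> (A\<^sup>2 / 2 * \<epsilon>) * \<epsilon>"
        using est[of \<epsilon>, OF _ _ cost0] elim by (simp add: power2_eq_square mult_ac)
      then have "(1/2 * ?F \<epsilon> - 1/2 * enn2real (W2cost ?\<mu> \<nu>) - ?I \<epsilon>) / \<epsilon> \<le> A\<^sup>2 / 2 * \<epsilon>"
        using elim by (simp add: divide_le_eq)
      then show ?case by (simp add: W2_squared Y_def)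
    qed
    show "((\<lambda>\<epsilon>. 1/2 * (\<integral>x. \<rho> \<epsilon> x / \<epsilon> \<partial>M)) \<longlongrightarrow> 0) (at_right 0)"
      using tendsto_mult_left[OF lim, of "1/2"] by simp
    have "((\<lambda>\<epsilon>::real. A\<^sup>2 / 2 * \<epsilon>) \<longlongrightarrow> A\<^sup>2 / 2 * 0) (at_right 0)" by (intro tendsto_intros)
    then show "((\<lambda>\<epsilon>::real. A\<^sup>2 / 2 * \<epsilon>) \<longlongrightarrow> 0) (at_right 0)" by simp
  qed
qed

section \<open>Existence and stability of the flow\<close>

text \<open>A replacement for Gronwall. If \<open>B\<close> is an admissible constant, so is
  \<open>c + B / 2\<close>, since the weights are at least 1; hence the infimum of admissible
  constants is at most \<open>2 * c\<close>. The a priori bound makes the set of constants nonempty.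
  The index set is arbitrary, so flow points and agents can be estimated together.\<close>

lemma weighted_bound_absorb:
  fixes w e :: "'i \<Rightarrow> real"
  assumes bdd: "\<And>i. i \<in> I \<Longrightarrow> w i \<le> B0" and e: "\<And>i. i \<in> I \<Longrightarrow> 1 \<le> e i" and c: "0 \<le> c"
    and step: "\<And>B i. 0 \<le> B \<Longrightarrow> (\<And>j. j \<in> I \<Longrightarrow> w j \<le> B * e j) \<Longrightarrow> i \<in> I \<Longrightarrow> w i \<le> c + B / 2 * e i"
    and i: "i \<in> I"
  shows "w i \<le> 2 * c * e i"
proof -
  define S where "S = {B. 0 \<le> B \<and> (\<forall>j\<in>I. w j \<le> B * e j)}"
  have "max B0 0 \<in> S"
  proof -
    have "w j \<le> max B0 0 * e j" if "j \<in> I" for j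
    proof -
      have "w j \<le> max B0 0 * 1" using bdd[OF that] by simp
      also have "\<dots> \<le> max B0 0 * e j" using e[OF that] by (intro mult_left_mono) auto
      finally show ?thesis .
    qed
    then show ?thesis by (auto simp: S_def)
  qed
  then have ne: "S \<noteq> {}" by auto
  have bb: "bdd_below S" by (auto simp: S_def)
  have half: "c + B / 2 \<in> S" if B: "B \<in> S" for B
  proof -
    have "w j \<le> (c + B / 2) * e j" if j: "j \<in> I" for j
    proof -
      have "w j \<le> c * 1 + B / 2 * e j" using step[of B j] B j by (auto simp: S_def)
      also have "c * 1 \<le> c * e j" using e[OF j] c by (intro mult_left_mono) auto
      finally show ?thesis by (simp add: algebra_simps)
    qed
    then show ?thesis using B c by (auto simp: S_def)
  qed
  \<comment> \<open>Rearranged form of \<open>Inf S \<le> c + B / 2\<close>, so that the infimum can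
    be taken over \<open>B\<close>.\<close>
  have "2 * (Inf S - c) \<le> Inf S"
  proof (rule cInf_greatest[OF ne])
    fix B assume "B \<in> S"
    then have "Inf S \<le> c + B / 2" using half bb by (intro cInf_lower) auto
    then show "2 * (Inf S - c) \<le> B" by simp
  qed
  then have le: "Inf S \<le> 2 * c" by simp
  have "w i / e i \<le> Inf S"
    using i e[OF i] by (intro cInf_greatest[OF ne]) (auto simp: S_def field_simps)
  then have "w i / e i \<le> 2 * c" using le by simp
  then show ?thesis using e[OF i] by (simp add: field_simps)
qed

text \<open>A pointwise bound on \<open>g\<close> suffices: if \<open>g\<close> is not integrable,
  its integral is 0, and the right side is nonnegative because \<open>F'\<close> dominates a
  norm.\<close>

lemma norm_set_integral_le_FTC:
  fixes g :: "real \<Rightarrow> 'b::{banach, second_countable_topology}"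
  assumes ab: "a \<le> b" and g: "\<And>s. s \<in> {a..b} \<Longrightarrow> norm (g s) \<le> F' s"
    and F: "\<And>s. (F has_real_derivative F' s) (at s)" and F': "continuous_on UNIV F'"
  shows "norm (LINT s:{a..b}|lborel. g s) \<le> F b - F a"
proof -
  have hb: "has_bochner_integral lborel (\<lambda>x. F' x * indicator {a..b} x) (F b - F a)"
    using F F' ab by (intro has_bochner_integral_FTC_Icc_real) (auto simp: continuous_on_eq_continuous_at)
  then have i: "integrable lborel (\<lambda>x. F' x * indicator {a..b} x)" 
    and e: "(\<integral>x. F' x * indicator {a..b} x \<partial>lborel) = F b - F a"
    by (auto simp: has_bochner_integral_iff)
  have "norm (\<integral>s. indicator {a..b} s *\<^sub>R g s \<partial>lborel) \<le> (\<integral>x. F' x * indicator {a..b} x \<partial>lborel)"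
  proof (cases "integrable lborel (\<lambda>s. indicator {a..b} s *\<^sub>R g s)")
    case True
    then show ?thesis using i g
      by (intro Bochner_Integration.integral_norm_bound_integral) (auto simp: indicator_def)
  next
    case False
    have "0 \<le> F' x" if "x \<in> {a..b}" for x using g[OF that] norm_ge_zero[of "g x"] by linarith
    then have "0 \<le> (\<integral>x. F' x * indicator {a..b} x \<partial>lborel)"
      by (intro Bochner_Integration.integral_nonneg) (auto simp: indicator_def)
    then show ?thesis using False by (simp add: not_integrable_integral_eq)
  qed
  then show ?thesis using e by (simp add: set_lebesgue_integral_def)
qed

text \<open>A contraction on the whole interval at once: in the supremum norm weighted by
  \<open>exp (- 2 * L * t)\<close> the Picard operator has constant 1/2, whatever the length of the
  interval.\<close>

lemma picard_global:
  fixes N :: "real \<Rightarrow> 'e::banach \<Rightarrow> 'e"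
  assumes T: "0 \<le> T" and L: "0 < L"
    and cont: "continuous_on ({0..T} \<times> UNIV) (\<lambda>(s, v). N s v)"
    and lip: "\<And>s v w. s \<in> {0..T} \<Longrightarrow> norm (N s v - N s w) \<le> L * norm (v - w)"
  obtains v where "continuous_on {0..T} v" "\<And>t. t \<in> {0..T} \<Longrightarrow> ((\<lambda>s. N s (v s)) has_integral v t) {0..t}"
proof -
  \<comment> \<open>Bounded continuous functions live on the whole line; clamping time extends the
    Picard image constantly beyond the interval.\<close>
  define c where "c t = max 0 (min T t)" for t
  have c: "c t \<in> {0..T}" and c': "c t \<in> {0..T}" for t using T by (auto simp: c_def)
  have cid: "t \<in> {0..T} \<Longrightarrow> c t = t" for t by (auto simp: c_def)
  have cc: "continuous_on S c" for S unfolding c_def by (intro continuous_intros)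
  have Ncont: "continuous_on {0..T} (\<lambda>s. N s (h s))" if "continuous_on {0..T} h" for h
  proof -
    have "continuous_on {0..T} (\<lambda>s. (s, h s))" using that by (intro continuous_intros)
    then have "continuous_on {0..T} ((\<lambda>(s, v). N s v) \<circ> (\<lambda>s. (s, h s)))"
      by (intro continuous_on_compose continuous_on_subset[OF cont]) auto
    then show ?thesis by (simp add: comp_def)
  qed
  \<comment> \<open>Unknowns are stored already divided by the weight; \<open>h\<close> restores the
    actual curve.\<close>
  define h where "h V s = exp (2 * L * s) *\<^sub>R apply_bcontfun V s" for V :: "real \<Rightarrow>\<^sub>C 'e" and s
  have hc: "continuous_on S (h V)" for V S unfolding h_def by (intro continuous_intros) auto
  define I where "I V t = integral {0..t} (\<lambda>s. N s (h V s))" for V t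
  have int: "(\<lambda>s. N s (h V s)) integrable_on {0..t}" if "t \<in> {0..T}" for V t
    using that by (intro integrable_continuous_real continuous_on_subset[OF Ncont[OF hc]]) auto
  have Ic: "continuous_on {0..T} (I V)" for V
    unfolding I_def using int[of T V] T by (intro indefinite_integral_continuous_1) auto
  define G where "G V t = exp (- 2 * L * c t) *\<^sub>R I V (c t)" for V t
  have GB: "G V \<in> bcontfun" for V
  proof -
    have Gc: "continuous_on UNIV (G V)" unfolding G_def
      using c by (intro continuous_intros cc continuous_on_compose2[OF Ic cc]) auto
    have "bounded (G V ` UNIV)"
    proof (rule bounded_subset)
      show "bounded (G V ` {0..T})"
        by (intro compact_imp_bounded compact_continuous_image continuous_on_subset[OF Gc]) auto
      have "G V t = G V (c t)" for t using cid[OF c] by (simp add: G_def)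
      then show "range (G V) \<subseteq> G V ` {0..T}" using c by blast
    qed
    then show ?thesis using Gc by (auto simp: bcontfun_def)
  qed
  define \<Gamma> where "\<Gamma> V = Bcontfun (G V)" for V
  have \<Gamma>: "apply_bcontfun (\<Gamma> V) = G V" for V unfolding \<Gamma>_def using GB by (rule Bcontfun_inverse)
  have "dist (\<Gamma> V) (\<Gamma> W) \<le> 1/2 * dist V W" for V W
  proof (rule dist_bound)
    fix t
    have "norm (I V (c t) - I W (c t)) = norm (integral {0..c t} (\<lambda>s. N s (h V s) - N s (h W s)))"
      unfolding I_def using int[OF c] by (simp add: integral_diff)
    also have "\<dots> \<le> integral {0..c t} (\<lambda>s. dist V W * (L * exp (2 * L * s)))"
    proof (rule integral_norm_bound_integral)
      show "(\<lambda>s. dist V W * (L * exp (2 * L * s))) integrable_on {0..c t}"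
        by (intro integrable_continuous_real continuous_intros)
      fix s assume s: "s \<in> {0..c t}"
      then have "s \<in> {0..T}" using c[of t] by auto
      then have "norm (N s (h V s) - N s (h W s)) \<le> L * norm (h V s - h W s)" by (rule lip)
      also have "norm (h V s - h W s) = exp (2 * L * s) * dist (apply_bcontfun V s) (apply_bcontfun W s)"
        by (simp add: h_def dist_norm flip: scaleR_diff_right)
      also have "L * \<dots> \<le> L * (exp (2 * L * s) * dist V W)"
        using L dist_bounded[of V s W] by (intro mult_left_mono) auto
      finally show "norm (N s (h V s) - N s (h W s)) \<le> dist V W * (L * exp (2 * L * s))"
        by (simp add: mult_ac)
    qed (use int[OF c] in \<open>auto intro!: integrable_diff\<close>)
    also have "\<dots> = dist V W * (exp (2 * L * c t) / 2 - 1 / 2)"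
    proof -
      have "((\<lambda>s. L * exp (2 * L * s)) has_integral (exp (2 * L * c t) / 2 - exp (2 * L * 0) / 2)) {0..c t}"
        using c[of t] by (intro fundamental_theorem_of_calculus)
          (auto intro!: derivative_eq_intros simp flip: has_real_derivative_iff_has_vector_derivative)
      then have "integral {0..c t} (\<lambda>s. L * exp (2 * L * s)) = exp (2 * L * c t) / 2 - 1 / 2"
        by (intro integral_unique) simp
      then show ?thesis by (subst integral_mult_right) (simp only: )
    qed
    also have "\<dots> \<le> dist V W * (exp (2 * L * c t) / 2)" by (intro mult_left_mono) auto
    finally have "norm (I V (c t) - I W (c t)) \<le> dist V W * (exp (2 * L * c t) / 2)" .
    then have "exp (- 2 * L * c t) * norm (I V (c t) - I W (c t)) \<le> exp (- 2 * L * c t) * (dist V W * (exp (2 * L * c t) / 2))"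
      by (intro mult_left_mono) auto
    also have "\<dots> = 1/2 * dist V W" by (simp add: exp_minus field_simps)
    finally show "dist (apply_bcontfun (\<Gamma> V) t) (apply_bcontfun (\<Gamma> W) t) \<le> 1/2 * dist V W"
      by (simp add: \<Gamma> G_def dist_norm flip: scaleR_diff_right)
  qed
  then have "\<exists>!V. \<Gamma> V = V" by (intro banach_fix_type[of "1/2"]) auto
  then obtain V where V: "\<Gamma> V = V" by auto
  have hI: "h V t = I V t" if "t \<in> {0..T}" for t
  proof -
    have "apply_bcontfun V t = exp (- 2 * L * t) *\<^sub>R I V t"
      using \<Gamma>[of V] V that by (simp add: G_def cid)
    then show ?thesis by (simp add: h_def exp_minus)
  qed
  show ?thesis
  proof (rule that[of "h V"])
    show "continuous_on {0..T} (h V)" by (rule hc)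
    fix t assume t: "t \<in> {0..T}"
    show "((\<lambda>s. N s (h V s)) has_integral h V t) {0..t}"
      using int[OF t, of V] hI[OF t] by (simp add: I_def has_integral_integral)
  qed
qed

section \<open>Kernels, velocity field and joint measurability\<close>

lemma blinfun_derivative_lipschitz:
  fixes h :: "'a::euclidean_space \<Rightarrow> 'a"
  assumes "\<And>x. (h has_derivative blinfun_apply (Dh x)) (at x)" "\<And>x. norm (Dh x) \<le> L"
  shows "norm (h a - h b) \<le> L * norm (a - b)"
  by (rule differentiable_bound[of UNIV h "\<lambda>x. blinfun_apply (Dh x)"])
    (use assms in \<open>auto simp: norm_blinfun.rep_eq\<close>)

lemma norm_average_le:
  fixes h :: "'M::finite \<Rightarrow> 'b::real_normed_vector"
  assumes "\<And>m. norm (h m) \<le> B"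
  shows "norm ((1 / real CARD('M)) *\<^sub>R (\<Sum>m\<in>UNIV. h m)) \<le> B"
proof -
  have "norm (\<Sum>m\<in>UNIV. h m) \<le> real CARD('M) * B"
    using sum_norm_bound[of UNIV h B] assms by simp
  then have "norm (\<Sum>m\<in>UNIV. h m) / real CARD('M) \<le> real CARD('M) * B / real CARD('M)"
    by (rule divide_right_mono) simp
  moreover have "norm ((1 / real CARD('M)) *\<^sub>R (\<Sum>m\<in>UNIV. h m)) = norm (\<Sum>m\<in>UNIV. h m) / real CARD('M)"
    by simp
  ultimately show ?thesis by simp
qed

text \<open>\<open>L\<close> is one Lipschitz constant for all three kernels, strictly positive
  because the Picard argument uses it as a rate. The flow is defined on the whole space, but a
  measure term sees it only on \<open>C\<close>, so uniform bounds are needed there alone.\<close>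

locale splitting_model = prob_space \<mu>0 for \<mu>0 :: "'a::euclidean_space measure" +
  fixes K f g :: "'a \<Rightarrow> 'a" and DK Df Dg :: "'a \<Rightarrow> 'a \<Rightarrow>\<^sub>L 'a" and C :: "'a set" and L T :: real
  assumes sets_mu0: "sets \<mu>0 = sets borel" and T_pos: "T > 0" and L_pos: "L > 0"
    and K_odd: "\<And>x. K (- x) = - K x" and f_odd: "\<And>x. f (- x) = - f x" and g_odd: "\<And>x. g (- x) = - g x"
    and K_deriv: "\<And>x. (K has_derivative blinfun_apply (DK x)) (at x)"
    and f_deriv: "\<And>x. (f has_derivative blinfun_apply (Df x)) (at x)"
    and g_deriv: "\<And>x. (g has_derivative blinfun_apply (Dg x)) (at x)"
    and DK_cont: "continuous_on UNIV DK" and Df_cont: "continuous_on UNIV Df" and Dg_cont: "continuous_on UNIV Dg"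
    and DK_le: "\<And>x. norm (DK x) \<le> L" and Df_le: "\<And>x. norm (Df x) \<le> L" and Dg_le: "\<And>x. norm (Dg x) \<le> L"
    and C_compact: "compact C" and AE_C: "AE x in \<mu>0. x \<in> C"
begin

declare sets_mu0 [measurable_cong]

abbreviation velocity :: "(real \<Rightarrow> 'a \<Rightarrow> 'a) \<Rightarrow> (real \<Rightarrow> 'M::finite \<Rightarrow> 'a) \<Rightarrow> real \<Rightarrow> 'a \<Rightarrow> 'a" where
  "velocity \<Phi> y t x \<equiv> Fop K f (distr \<mu>0 borel (\<Phi> t)) (\<Phi> t x) (y t)"

lemma space_mu0 [simp]: "space \<mu>0 = UNIV"
  using sets_eq_imp_space_eq[OF sets_mu0] by simp

lemma prob_UNIV [simp]: "prob UNIV = 1"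
  using prob_space by simp

lemma borel_measurable_mu0: "h \<in> borel_measurable borel \<Longrightarrow> h \<in> borel_measurable \<mu>0"
  using measurable_cong_sets[OF sets_mu0 refl] by blast

lemmas K_lip = blinfun_derivative_lipschitz[OF K_deriv DK_le]
lemmas f_lip = blinfun_derivative_lipschitz[OF f_deriv Df_le]
lemmas g_lip = blinfun_derivative_lipschitz[OF g_deriv Dg_le]

text \<open>With the Lipschitz bounds this turns into linear growth of the kernels.\<close>

lemma odd_0: "K 0 = 0" "f 0 = 0" "g 0 = 0"
proof -
  have "v = 0" if "v = - v" for v :: 'a
  proof -
    have "2 *\<^sub>R v = 0" using that by (simp add: scaleR_2 eq_neg_iff_add_eq_0)
    then show ?thesis by simp
  qed
  then show "K 0 = 0" "f 0 = 0" "g 0 = 0" using K_odd[of 0] f_odd[of 0] g_odd[of 0] by simp_all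
qed

lemma K_cont: "continuous_on S K" and f_cont: "continuous_on S f" and g_cont: "continuous_on S g"
  using has_derivative_continuous_on[OF has_derivative_at_withinI[OF K_deriv]]
    has_derivative_continuous_on[OF has_derivative_at_withinI[OF f_deriv]]
    has_derivative_continuous_on[OF has_derivative_at_withinI[OF g_deriv]] by blast+

lemma K_meas [measurable]: "K \<in> borel_measurable borel" and f_meas [measurable]: "f \<in> borel_measurable borel"
  and g_meas [measurable]: "g \<in> borel_measurable borel"
  using borel_measurable_continuous_onI[OF K_cont] borel_measurable_continuous_onI[OF f_cont]
    borel_measurable_continuous_onI[OF g_cont] by blast+

lemma Fop_distr:
  fixes y :: "'M::finite \<Rightarrow> 'a"
  assumes \<phi>: "\<phi> \<in> borel_measurable borel"
  shows "Fop K f (distr \<mu>0 borel \<phi>) a y =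
    (\<integral>\<zeta>. K (\<phi> \<zeta> - a) \<partial>\<mu>0) + (1 / real CARD('M)) *\<^sub>R (\<Sum>m\<in>UNIV. f (y m - a))"
  unfolding Fop_def convK_def by (subst integral_distr[OF borel_measurable_mu0[OF \<phi>]]) auto

lemma AE_bounded_image:
  assumes "bounded (\<phi> ` C)"
  obtains B where "AE \<zeta> in \<mu>0. norm (\<phi> \<zeta>) \<le> B"
proof -
  obtain B where "\<And>x. x \<in> C \<Longrightarrow> norm (\<phi> x) \<le> B" using assms by (auto simp: bounded_iff)
  then have "AE \<zeta> in \<mu>0. norm (\<phi> \<zeta>) \<le> B" using AE_C by auto
  then show ?thesis by (rule that)
qed

lemma integrable_K:
  assumes \<phi>: "\<phi> \<in> borel_measurable borel" "bounded (\<phi> ` C)"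
  shows "integrable \<mu>0 (\<lambda>\<zeta>. K (\<phi> \<zeta> - a))"
proof -
  note [measurable] = borel_measurable_mu0[OF \<phi>(1)]
  obtain B where B: "AE \<zeta> in \<mu>0. norm (\<phi> \<zeta>) \<le> B" using AE_bounded_image[OF \<phi>(2)] .
  show ?thesis
  proof (rule integrable_const_bound)
    show "AE x in \<mu>0. norm (K (\<phi> x - a)) \<le> L * (B + norm a)"
      using B
    proof eventually_elim
      case (elim x)
      have "norm (K (\<phi> x - a)) \<le> L * norm (\<phi> x - a)" using K_lip[of "\<phi> x - a" 0] odd_0 by simp
      also have "\<dots> \<le> L * (B + norm a)"
        using elim L_pos norm_triangle_ineq4[of "\<phi> x" a] by (intro mult_left_mono) auto
      finally show ?case .
    qed
  qed measurable
qed

text \<open>The base point enters both the interaction term and the agent term, hence the factor 2.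
  Each displacement inside a kernel is a difference of two displacements.\<close>

lemma Fop_diff:
  fixes y y' :: "'M::finite \<Rightarrow> 'a"
  assumes \<phi>: "\<phi> \<in> borel_measurable borel" "bounded (\<phi> ` C)" and \<phi>': "\<phi>' \<in> borel_measurable borel" "bounded (\<phi>' ` C)"
    and d: "\<And>\<zeta>. \<zeta> \<in> C \<Longrightarrow> norm (\<phi> \<zeta> - \<phi>' \<zeta>) \<le> \<delta>" and e: "\<And>m. norm (y m - y' m) \<le> e"
  shows "norm (Fop K f (distr \<mu>0 borel \<phi>) a y - Fop K f (distr \<mu>0 borel \<phi>') a' y')
    \<le> L * (\<delta> + 2 * norm (a - a') + e)"
proof -
  have tri: "norm ((p - a) - (p' - a')) \<le> norm (p - p') + norm (a - a')" for p p'
    using norm_triangle_ineq4[of "p - p'" "a - a'"] by (simp add: algebra_simps)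
  have i: "integrable \<mu>0 (\<lambda>\<zeta>. K (\<phi> \<zeta> - a))" "integrable \<mu>0 (\<lambda>\<zeta>. K (\<phi>' \<zeta> - a'))"
    using \<phi> \<phi>' integrable_K by auto
  have "norm (\<integral>\<zeta>. K (\<phi> \<zeta> - a) - K (\<phi>' \<zeta> - a') \<partial>\<mu>0) \<le> (\<integral>\<zeta>. norm (K (\<phi> \<zeta> - a) - K (\<phi>' \<zeta> - a')) \<partial>\<mu>0)"
    by (rule integral_norm_bound)
  also have "\<dots> \<le> (\<integral>\<zeta>. L * (\<delta> + norm (a - a')) \<partial>\<mu>0)"
  proof (rule integral_mono_AE)
    show "AE \<zeta> in \<mu>0. norm (K (\<phi> \<zeta> - a) - K (\<phi>' \<zeta> - a')) \<le> L * (\<delta> + norm (a - a'))"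
      using AE_C
    proof eventually_elim
      case (elim \<zeta>)
      have "norm (K (\<phi> \<zeta> - a) - K (\<phi>' \<zeta> - a')) \<le> L * norm ((\<phi> \<zeta> - a) - (\<phi>' \<zeta> - a'))" by (rule K_lip)
      also have "\<dots> \<le> L * (\<delta> + norm (a - a'))"
        using tri[of "\<phi> \<zeta>" "\<phi>' \<zeta>"] d[OF elim] L_pos by (intro mult_left_mono) auto
      finally show ?case .
    qed
  qed (use i in auto)
  finally have 1: "norm ((\<integral>\<zeta>. K (\<phi> \<zeta> - a) \<partial>\<mu>0) - (\<integral>\<zeta>. K (\<phi>' \<zeta> - a') \<partial>\<mu>0)) \<le> L * (\<delta> + norm (a - a'))"
    using i by (simp add: prob_space)
  have 2: "norm ((1 / real CARD('M)) *\<^sub>R (\<Sum>m\<in>UNIV. f (y m - a) - f (y' m - a'))) \<le> L * (e + norm (a - a'))"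
  proof (rule norm_average_le)
    fix m
    have "norm (f (y m - a) - f (y' m - a')) \<le> L * norm ((y m - a) - (y' m - a'))" by (rule f_lip)
    also have "\<dots> \<le> L * (e + norm (a - a'))"
      using tri[of "y m" "y' m"] e[of m] L_pos by (intro mult_left_mono) auto
    finally show "norm (f (y m - a) - f (y' m - a')) \<le> L * (e + norm (a - a'))" .
  qed
  have "Fop K f (distr \<mu>0 borel \<phi>) a y - Fop K f (distr \<mu>0 borel \<phi>') a' y' =
     ((\<integral>\<zeta>. K (\<phi> \<zeta> - a) \<partial>\<mu>0) - (\<integral>\<zeta>. K (\<phi>' \<zeta> - a') \<partial>\<mu>0))
      + (1 / real CARD('M)) *\<^sub>R (\<Sum>m\<in>UNIV. f (y m - a) - f (y' m - a'))"
    unfolding Fop_distr[OF \<phi>(1)] Fop_distr[OF \<phi>'(1)] by (simp add: sum_subtractf scaleR_diff_right)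
  also have "norm \<dots> \<le> L * (\<delta> + norm (a - a')) + L * (e + norm (a - a'))"
    using 1 2 by (rule norm_triangle_mono)
  finally show ?thesis by (simp add: algebra_simps)
qed

text \<open>Comparison with the configuration in which everything sits at the origin, where the
  velocity vanishes by oddness.\<close>

lemma Fop_bound:
  fixes y :: "'M::finite \<Rightarrow> 'a"
  assumes \<phi>: "\<phi> \<in> borel_measurable borel" and "\<And>\<zeta>. \<zeta> \<in> C \<Longrightarrow> norm (\<phi> \<zeta>) \<le> \<delta>" and "\<And>m. norm (y m) \<le> e"
  shows "norm (Fop K f (distr \<mu>0 borel \<phi>) a y) \<le> L * (\<delta> + 2 * norm a + e)"
proof -
  have "norm (Fop K f (distr \<mu>0 borel \<phi>) a y - Fop K f (distr \<mu>0 borel (\<lambda>_. 0)) 0 (\<lambda>_::'M. 0))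
      \<le> L * (\<delta> + 2 * norm (a - 0) + e)"
    using assms by (intro Fop_diff) (auto simp: bounded_iff)
  moreover have "Fop K f (distr \<mu>0 borel (\<lambda>_. 0)) 0 (\<lambda>_::'M. 0) = 0"
    by (subst Fop_distr) (auto simp: odd_0)
  ultimately show ?thesis by simp
qed

lemma Gop_diff:
  fixes y y' :: "'M::finite \<Rightarrow> 'a"
  assumes e: "\<And>m. norm (y m - y' m) \<le> e"
  shows "norm (Gop g y m - Gop g y' m) \<le> 2 * L * e"
proof -
  have "Gop g y m - Gop g y' m = (1 / real CARD('M)) *\<^sub>R (\<Sum>j\<in>UNIV. g (y j - y m) - g (y' j - y' m))"
    by (simp add: Gop_def sum_subtractf scaleR_diff_right)
  also have "norm \<dots> \<le> 2 * L * e"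
  proof (rule norm_average_le)
    fix j
    have "norm (g (y j - y m) - g (y' j - y' m)) \<le> L * norm ((y j - y m) - (y' j - y' m))" by (rule g_lip)
    also have "\<dots> \<le> L * (e + e)"
      using norm_triangle_ineq4[of "y j - y' j" "y m - y' m"] e[of j] e[of m] L_pos
      by (intro mult_left_mono) (auto simp: algebra_simps)
    finally show "norm (g (y j - y m) - g (y' j - y' m)) \<le> 2 * L * e" by simp
  qed
  finally show ?thesis .
qed

text \<open>Data are continuous or measurable only for times in \<open>{0..T}\<close>. Composition
  with \<open>clamp\<close> makes them total, so joint measurability can be stated on full product
  spaces.\<close>

definition clamp :: "real \<Rightarrow> real" where "clamp t = max 0 (min T t)"

lemma clamp_mem: "clamp t \<in> {0..T}" and clamp_id: "t \<in> {0..T} \<Longrightarrow> clamp t = t"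
  using T_pos by (auto simp: clamp_def)

lemma clamp_cont: "continuous_on S clamp"
  unfolding clamp_def by (intro continuous_intros)

lemma clamp_meas [measurable]: "clamp \<in> borel_measurable borel"
  by (intro borel_measurable_continuous_onI clamp_cont)

lemma flow_clamp_meas:
  fixes \<Phi> :: "real \<Rightarrow> 'a \<Rightarrow> 'a"
  assumes "continuous_on ({0..T} \<times> UNIV) (\<lambda>(t, x). \<Phi> t x)"
  shows "(\<lambda>z. \<Phi> (clamp (fst z)) (snd z)) \<in> borel_measurable (borel \<Otimes>\<^sub>M borel)"
proof -
  have "continuous_on UNIV (\<lambda>z. (\<lambda>(t, x). \<Phi> t x) (clamp (fst z), snd z))"
    using clamp_mem
    by (intro continuous_on_compose2[OF assms] continuous_intros continuous_on_compose2[OF clamp_cont[of UNIV]]) auto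
  then have "continuous_on UNIV (\<lambda>z. \<Phi> (clamp (fst z)) (snd z))" by simp
  then show ?thesis unfolding borel_prod by (rule borel_measurable_continuous_onI)
qed

lemma flow_clamp_meas_comp:
  fixes \<Phi> :: "real \<Rightarrow> 'a \<Rightarrow> 'a"
  assumes \<Phi>: "continuous_on ({0..T} \<times> UNIV) (\<lambda>(t, x). \<Phi> t x)"
    and [measurable]: "h \<in> borel_measurable M" "k \<in> borel_measurable M"
  shows "(\<lambda>z. \<Phi> (clamp (h z)) (k z)) \<in> borel_measurable M"
proof -
  have "(\<lambda>z. (h z, k z)) \<in> M \<rightarrow>\<^sub>M borel \<Otimes>\<^sub>M borel" by measurable
  from measurable_compose[OF this flow_clamp_meas[OF \<Phi>]] show ?thesis by simp
qed

lemma flow_section: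
  fixes \<Phi> :: "real \<Rightarrow> 'a \<Rightarrow> 'a"
  assumes "continuous_on ({0..T} \<times> UNIV) (\<lambda>(t, x). \<Phi> t x)" "t \<in> {0..T}"
  shows "continuous_on S (\<Phi> t)" "\<Phi> t \<in> borel_measurable borel" "bounded (\<Phi> t ` C)"
proof -
  have "continuous_on UNIV (\<lambda>x. (\<lambda>(t, x). \<Phi> t x) (t, x))"
    using assms(2) by (intro continuous_on_compose2[OF assms(1)] continuous_intros) auto
  then have c: "continuous_on UNIV (\<Phi> t)" by simp
  then show "continuous_on S (\<Phi> t)" "\<Phi> t \<in> borel_measurable borel"
    by (auto intro: continuous_on_subset borel_measurable_continuous_onI)
  show "bounded (\<Phi> t ` C)"
    by (intro compact_imp_bounded compact_continuous_image C_compact continuous_on_subset[OF c]) auto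
qed

lemma flow_bounded:
  fixes \<Phi> :: "real \<Rightarrow> 'a \<Rightarrow> 'a"
  assumes "continuous_on ({0..T} \<times> UNIV) (\<lambda>(t, x). \<Phi> t x)" "compact S"
  obtains B where "0 \<le> B" "\<And>t x. t \<in> {0..T} \<Longrightarrow> x \<in> S \<Longrightarrow> norm (\<Phi> t x) \<le> B"
proof -
  have "compact ((\<lambda>(t, x). \<Phi> t x) ` ({0..T} \<times> S))"
    using assms by (intro compact_continuous_image compact_Times continuous_on_subset[OF assms(1)]) auto
  then obtain B where B: "\<forall>z\<in>(\<lambda>(t, x). \<Phi> t x) ` ({0..T} \<times> S). norm z \<le> B"
    using compact_imp_bounded bounded_iff by metis
  show ?thesis
  proof (rule that[of "max B 0"])
    fix t x assume "t \<in> {0..T}" "x \<in> S"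
    then have "\<Phi> t x \<in> (\<lambda>(t, x). \<Phi> t x) ` ({0..T} \<times> S)" by force
    with B have "norm (\<Phi> t x) \<le> B" by (rule bspec)
    then show "norm (\<Phi> t x) \<le> max B 0" by simp
  qed simp
qed

lemma agents_bounded:
  fixes y :: "real \<Rightarrow> 'M::finite \<Rightarrow> 'a"
  assumes "\<forall>m. continuous_on {0..T} (\<lambda>t. y t m)"
  obtains B where "0 \<le> B" "\<And>t m. t \<in> {0..T} \<Longrightarrow> norm (y t m) \<le> B"
proof -
  have "bounded ((\<lambda>t. y t m) ` {0..T})" for m
    using assms by (intro compact_imp_bounded compact_continuous_image) auto
  then have "bounded (\<Union>m. (\<lambda>t. y t m) ` {0..T})" by (intro bounded_UN) auto
  then obtain B where B: "\<forall>z\<in>(\<Union>m. (\<lambda>t. y t m) ` {0..T}). norm z \<le> B" using bounded_iff by metis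
  show ?thesis
  proof (rule that[of "max B 0"])
    fix t m assume "t \<in> {0..T}"
    then have "y t m \<in> (\<Union>m. (\<lambda>t. y t m) ` {0..T})" by blast
    with B have "norm (y t m) \<le> B" by (rule bspec)
    then show "norm (y t m) \<le> max B 0" by simp
  qed simp
qed

lemma agents_clamp_meas:
  fixes y :: "real \<Rightarrow> 'M::finite \<Rightarrow> 'a"
  assumes "\<forall>m. continuous_on {0..T} (\<lambda>t. y t m)"
  shows "(\<lambda>t. y (clamp t) m) \<in> borel_measurable borel"
  using assms clamp_mem
  by (intro borel_measurable_continuous_onI continuous_on_compose2[of "{0..T}" "\<lambda>t. y t m" UNIV clamp] clamp_cont) auto

lemma velocity_meas:
  fixes \<Phi> :: "real \<Rightarrow> 'a \<Rightarrow> 'a" and y :: "real \<Rightarrow> 'M::finite \<Rightarrow> 'a"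
  assumes \<Phi>: "continuous_on ({0..T} \<times> UNIV) (\<lambda>(t, x). \<Phi> t x)" and y: "\<forall>m. continuous_on {0..T} (\<lambda>t. y t m)"
  shows "(\<lambda>z. velocity \<Phi> y (clamp (fst z)) (snd z))
    \<in> borel_measurable (borel \<Otimes>\<^sub>M borel)"
proof -
  note [measurable] = agents_clamp_meas[OF y]
  note [measurable] = flow_clamp_meas_comp[OF \<Phi>]
  show ?thesis
    by (subst Fop_distr[OF flow_section(2)[OF \<Phi> clamp_mem]]) measurable
qed

lemma set_integrable_bounded:
  fixes h :: "real \<Rightarrow> 'b::{banach, second_countable_topology}"
  assumes "(\<lambda>t. h (clamp t)) \<in> borel_measurable borel" "\<And>t. t \<in> {0..T} \<Longrightarrow> norm (h t) \<le> B" "t \<in> {0..T}"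
  shows "set_integrable lborel {0..t} h"
  unfolding set_integrable_def
proof (rule integrableI_bounded_set[of "{0..t}" _ _ B])
  have "(\<lambda>s. indicator {0..t} s *\<^sub>R h s) = (\<lambda>s. indicator {0..t} s *\<^sub>R h (clamp s))"
    using assms(3) by (auto simp: fun_eq_iff indicator_def clamp_id)
  then show "(\<lambda>s. indicator {0..t} s *\<^sub>R h s) \<in> borel_measurable lborel" using assms(1) by simp
  show "AE x in lborel. x \<in> {0..t} \<longrightarrow> norm (indicator {0..t} x *\<^sub>R h x) \<le> B"
    using assms(2,3) by auto
qed (auto simp: emeasure_lborel_Icc_eq)

lemma velocity_set_integrable:
  fixes \<Phi> :: "real \<Rightarrow> 'a \<Rightarrow> 'a" and y :: "real \<Rightarrow> 'M::finite \<Rightarrow> 'a"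
  assumes \<Phi>: "continuous_on ({0..T} \<times> UNIV) (\<lambda>(t, x). \<Phi> t x)" and y: "\<forall>m. continuous_on {0..T} (\<lambda>t. y t m)"
    and t: "t \<in> {0..T}"
  shows "set_integrable lborel {0..t} (\<lambda>s. velocity \<Phi> y s x)"
proof -
  obtain B where B: "0 \<le> B" "\<And>t z. t \<in> {0..T} \<Longrightarrow> z \<in> insert x C \<Longrightarrow> norm (\<Phi> t z) \<le> B"
    using flow_bounded[OF \<Phi>, of "insert x C"] C_compact by auto
  obtain A where A: "0 \<le> A" "\<And>t m. t \<in> {0..T} \<Longrightarrow> norm (y t m) \<le> A" using agents_bounded[OF y] by blast
  show ?thesis
  proof (rule set_integrable_bounded[OF _ _ t])
    have "(\<lambda>t. (t, x)) \<in> borel \<rightarrow>\<^sub>M borel \<Otimes>\<^sub>M borel" by measurable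
    from measurable_compose[OF this velocity_meas[OF \<Phi> y]]
    show "(\<lambda>t. velocity \<Phi> y (clamp t) x) \<in> borel_measurable borel" by simp
    fix s assume s: "s \<in> {0..T}"
    have "norm (velocity \<Phi> y s x) \<le> L * (B + 2 * norm (\<Phi> s x) + A)"
      using s B A by (intro Fop_bound flow_section[OF \<Phi> s]) auto
    also have "\<dots> \<le> L * (B + 2 * B + A)" using B(2)[OF s, of x] L_pos by (intro mult_left_mono) auto
    finally show "norm (velocity \<Phi> y s x) \<le> L * (B + 2 * B + A)" .
  qed
qed

lemma Gop_set_integrable:
  fixes y :: "real \<Rightarrow> 'M::finite \<Rightarrow> 'a"
  assumes y: "\<forall>m. continuous_on {0..T} (\<lambda>t. y t m)" and t: "t \<in> {0..T}"
  shows "set_integrable lborel {0..t} (\<lambda>s. Gop g (y s) m)"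
  unfolding Gop_def using t y
  by (intro borel_integrable_atLeastAtMost' continuous_intros continuous_on_compose2[OF g_cont[of UNIV]])
    (auto intro: continuous_on_subset)

end

lemma set_lebesgue_integral_split_Icc:
  fixes h :: "real \<Rightarrow> 'b::{banach, second_countable_topology}"
  assumes h: "set_integrable lborel {a..b} h" and t: "t \<in> {a..b}"
  shows "(LINT s:{a..b}|lborel. h s) = (LINT s:{a..t}|lborel. h s) + (LINT s:{t..b}|lborel. h s)"
proof -
  have "{a..b} = {a..t} \<union> {t..b}" using t by auto
  moreover have "(LINT s:{a..t}\<union>{t..b}|lborel. h s) = (LINT s:{a..t}|lborel. h s) + (LINT s:{t..b}|lborel. h s)"
  proof (rule set_integral_Un_AE)
    show "AE x in lborel. \<not> (x \<in> {a..t} \<and> x \<in> {t..b})"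
      using AE_lborel_singleton[of t] by eventually_elim auto
  qed (use t in \<open>auto intro: set_integrable_subset[OF h]\<close>)
  ultimately show ?thesis by simp
qed

lemma set_lebesgue_integral_singleton_Icc:
  fixes h :: "real \<Rightarrow> 'b::{banach, second_countable_topology}"
  shows "(LINT s:{a..a}|lborel. h s) = 0"
  unfolding set_lebesgue_integral_def
  by (rule integral_eq_zero_AE, use AE_lborel_singleton[of a] in eventually_elim) auto

context splitting_model
begin

section \<open>Stability, uniqueness and regularity of the terminal measure\<close>

lemma state_flow:
  assumes "is_state \<mu>0 K f g y0 T u \<Phi> y"
  shows "continuous_on ({0..T} \<times> UNIV) (\<lambda>(t, x). \<Phi> t x)" "\<forall>m. continuous_on {0..T} (\<lambda>t. y t m)"
    "\<And>t x. t \<in> {0..T} \<Longrightarrow> \<Phi> t x = x + (LINT s:{0..t}|lborel. velocity \<Phi> y s x)"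
    "\<And>t m. t \<in> {0..T} \<Longrightarrow> y t m = y0 m + (LINT s:{0..t}|lborel. Gop g (y s) m + u s m)"
  using assms by (auto simp: is_state_def)

text \<open>Agents drive the flow, and the velocity at one point depends on the flow on all of
  \<open>C\<close>; so all of them are put into one family for \<open>weighted_bound_absorb\<close>.
  The only source is the control difference, contributing \<open>D * T\<close>. The case
  \<open>D = 0\<close> gives uniqueness.\<close>

lemma state_stability:
  fixes y y' :: "real \<Rightarrow> 'M::finite \<Rightarrow> 'a"
  assumes s: "is_state \<mu>0 K f g y0 T u \<Phi> y" and s': "is_state \<mu>0 K f g y0 T u' \<Phi>' y'"
    and u: "\<And>m. set_integrable lborel {0..T} (\<lambda>t. u t m)" and u': "\<And>m. set_integrable lborel {0..T} (\<lambda>t. u' t m)"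
    and D: "0 \<le> D" "\<And>t m. t \<in> {0..T} \<Longrightarrow> norm (u' t m - u t m) \<le> D"
    and t: "t \<in> {0..T}"
  shows "x \<in> C \<Longrightarrow> norm (\<Phi>' t x - \<Phi> t x) \<le> 2 * (D * T) * exp (8 * L * t)"
    and "norm (y' t m - y t m) \<le> 2 * (D * T) * exp (8 * L * t)"
proof -
  note sf = state_flow[OF s] and sf' = state_flow[OF s']
  define I where "I = {0..T} \<times> (Inl ` C \<union> range (Inr :: 'M \<Rightarrow> 'a + 'M))"
  define w where "w = (\<lambda>(t, i). case i of Inl x \<Rightarrow> norm (\<Phi>' t x - \<Phi> t x) | Inr m \<Rightarrow> norm (y' t m - y t m))"
  define e where "e = (\<lambda>(t, i::'a + 'M). exp (8 * L * t))"
  obtain B1 where B1: "0 \<le> B1" "\<And>t x. t \<in> {0..T} \<Longrightarrow> x \<in> C \<Longrightarrow> norm (\<Phi> t x) \<le> B1"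
    using flow_bounded[OF sf(1) C_compact] by blast
  obtain B2 where B2: "0 \<le> B2" "\<And>t x. t \<in> {0..T} \<Longrightarrow> x \<in> C \<Longrightarrow> norm (\<Phi>' t x) \<le> B2"
    using flow_bounded[OF sf'(1) C_compact] by blast
  obtain B3 where B3: "0 \<le> B3" "\<And>t m. t \<in> {0..T} \<Longrightarrow> norm (y t m) \<le> B3"
    using agents_bounded[OF sf(2)] by blast
  obtain B4 where B4: "0 \<le> B4" "\<And>t m. t \<in> {0..T} \<Longrightarrow> norm (y' t m) \<le> B4"
    using agents_bounded[OF sf'(2)] by blast
  have main: "w i \<le> 2 * (D * T) * e i" if "i \<in> I" for i
  proof (rule weighted_bound_absorb[OF _ _ _ _ that])
    show "w i \<le> B1 + B2 + B3 + B4" if i: "i \<in> I" for i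
    proof -
      obtain t j where i': "i = (t, j)" "t \<in> {0..T}" "j \<in> Inl ` C \<union> range Inr" using i by (auto simp: I_def)
      show ?thesis
      proof (cases j)
        case (Inl x)
        then have "norm (\<Phi>' t x - \<Phi> t x) \<le> B2 + B1"
          using i' B1(2)[of t x] B2(2)[of t x] norm_triangle_ineq4[of "\<Phi>' t x" "\<Phi> t x"] by auto
        then show ?thesis using Inl i' B1(1) B2(1) B3(1) B4(1) by (simp add: w_def)
      next
        case (Inr m)
        have "norm (y' t m - y t m) \<le> B4 + B3"
          using i' B3(2)[of t m] B4(2)[of t m] norm_triangle_ineq4[of "y' t m" "y t m"] by auto
        then show ?thesis using Inr i' B1(1) B2(1) B3(1) B4(1) by (simp add: w_def)
      qed
    qed
    show "1 \<le> e i" if "i \<in> I" for i using that L_pos by (auto simp: I_def e_def)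
    show "0 \<le> D * T" using D T_pos by simp
    show "w i \<le> D * T + B / 2 * e i" if B: "0 \<le> B" and H: "\<And>j. j \<in> I \<Longrightarrow> w j \<le> B * e j" and i: "i \<in> I" for B i
    proof -
      obtain t j where i': "i = (t, j)" "t \<in> {0..T}" "j \<in> Inl ` C \<union> range Inr" using i by (auto simp: I_def)
      note t = i'(2)
      have HC: "norm (\<Phi>' s z - \<Phi> s z) \<le> B * exp (8 * L * s)" if "s \<in> {0..T}" "z \<in> C" for s z
        using H[of "(s, Inl z)"] that by (auto simp: I_def w_def e_def)
      have HM: "norm (y' s m - y s m) \<le> B * exp (8 * L * s)" if "s \<in> {0..T}" for s m
        using H[of "(s, Inr m)"] that by (auto simp: I_def w_def e_def)
      \<comment> \<open>The velocity difference has coefficient \<open>L * (1 + 2 + 1)\<close>. With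
        weight \<open>exp (8 * L * s)\<close> the integral of
        \<open>4 * L * B * exp (8 * L * s)\<close> is half the weight times \<open>B\<close>, as
        absorption demands.\<close>
      have fin: "norm (LINT s:{0..t}|lborel. h s) \<le> D * T + B / 2 * exp (8 * L * t)"
        if h: "\<And>s. s \<in> {0..t} \<Longrightarrow> norm (h s) \<le> D + 4 * L * B * exp (8 * L * s)" for h :: "real \<Rightarrow> 'a"
      proof -
        have "norm (LINT s:{0..t}|lborel. h s) \<le> (D * t + B / 2 * exp (8 * L * t)) - (D * 0 + B / 2 * exp (8 * L * 0))"
          by (rule norm_set_integral_le_FTC[where F = "\<lambda>s. D * s + B / 2 * exp (8 * L * s)"
                and F' = "\<lambda>s. D + 4 * L * B * exp (8 * L * s)"])
            (use t h in \<open>auto intro!: derivative_eq_intros continuous_intros\<close>)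
        moreover have "D * t \<le> D * T" using t D by (intro mult_left_mono) auto
        ultimately show ?thesis using B by simp
      qed
      show ?thesis
      proof (cases j)
        case (Inl x)
        then have x: "x \<in> C" using i' by auto
        have "\<Phi>' t x - \<Phi> t x = (LINT s:{0..t}|lborel. velocity \<Phi>' y' s x
              - velocity \<Phi> y s x)"
          unfolding sf(3)[OF t, of x] sf'(3)[OF t, of x]
          by (subst set_integral_diff) (auto intro!: velocity_set_integrable[OF _ _ t] sf sf')
        also have "norm \<dots> \<le> D * T + B / 2 * exp (8 * L * t)"
        proof (rule fin)
          fix s assume "s \<in> {0..t}"
          then have s: "s \<in> {0..T}" using t by auto
          have "norm (velocity \<Phi>' y' s x - velocity \<Phi> y s x)
            \<le> L * (B * exp (8 * L * s) + 2 * norm (\<Phi>' s x - \<Phi> s x) + B * exp (8 * L * s))"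
            using s HC HM by (intro Fop_diff flow_section[OF sf(1) s] flow_section[OF sf'(1) s]) auto
          also have "\<dots> \<le> L * (B * exp (8 * L * s) + 2 * (B * exp (8 * L * s)) + B * exp (8 * L * s))"
            using HC[OF s x] L_pos by (intro mult_left_mono) auto
          also have "\<dots> \<le> D + 4 * L * B * exp (8 * L * s)" using D by simp
          finally show "norm (velocity \<Phi>' y' s x - velocity \<Phi> y s x)
            \<le> D + 4 * L * B * exp (8 * L * s)" .
        qed
        finally show ?thesis using Inl i' by (simp add: w_def e_def)
      next
        case (Inr m)
        have iu: "set_integrable lborel {0..t} (\<lambda>s. Gop g (y s) m + u s m)" "set_integrable lborel {0..t} (\<lambda>s. Gop g (y' s) m + u' s m)"
          using t by (auto intro!: set_integral_add(1) Gop_set_integrable sf sf' set_integrable_subset[OF u] set_integrable_subset[OF u'])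
        have "y' t m - y t m = (LINT s:{0..t}|lborel. (Gop g (y' s) m + u' s m) - (Gop g (y s) m + u s m))"
          unfolding sf(4)[OF t, of m] sf'(4)[OF t, of m] using iu by (subst set_integral_diff) auto
        also have "norm \<dots> \<le> D * T + B / 2 * exp (8 * L * t)"
        proof (rule fin)
          fix s assume "s \<in> {0..t}"
          then have s: "s \<in> {0..T}" using t by auto
          have "norm ((Gop g (y' s) m + u' s m) - (Gop g (y s) m + u s m)) \<le> norm (Gop g (y' s) m - Gop g (y s) m) + norm (u' s m - u s m)"
            using norm_triangle_ineq[of "Gop g (y' s) m - Gop g (y s) m" "u' s m - u s m"] by (simp add: algebra_simps)
          also have "\<dots> \<le> 2 * L * (B * exp (8 * L * s)) + D"
            using Gop_diff[of "y' s" "y s", OF HM[OF s]] D(2)[OF s, of m] by (intro add_mono) auto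
          also have "\<dots> \<le> D + 4 * L * B * exp (8 * L * s)" using L_pos B by simp
          finally show "norm ((Gop g (y' s) m + u' s m) - (Gop g (y s) m + u s m)) \<le> D + 4 * L * B * exp (8 * L * s)" .
        qed
        finally show ?thesis using Inr i' by (simp add: w_def e_def)
      qed
    qed
  qed
  show "norm (\<Phi>' t x - \<Phi> t x) \<le> 2 * (D * T) * exp (8 * L * t)" if "x \<in> C"
    using main[of "(t, Inl x)"] that t by (auto simp: I_def w_def e_def)
  show "norm (y' t m - y t m) \<le> 2 * (D * T) * exp (8 * L * t)"
    using main[of "(t, Inr m)"] t by (auto simp: I_def w_def e_def)
qed

text \<open>Two states for the same control agree on \<open>C\<close>, hence almost everywhere, so
  the definite description is well defined even though flows are compared only there.\<close>

lemma final_measure_eq: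
  fixes y :: "real \<Rightarrow> 'M::finite \<Rightarrow> 'a"
  assumes s: "is_state \<mu>0 K f g y0 T u \<Phi> y" and u: "\<And>m. set_integrable lborel {0..T} (\<lambda>t. u t m)"
  shows "final_measure \<mu>0 K f g y0 T u = distr \<mu>0 borel (\<Phi> T)"
  unfolding final_measure_def
proof (rule the_equality)
  show "\<exists>\<Phi>' y. is_state \<mu>0 K f g y0 T u \<Phi>' y \<and> distr \<mu>0 borel (\<Phi> T) = distr \<mu>0 borel (\<Phi>' T)"
    using s by blast
  fix \<nu> assume "\<exists>\<Phi> y. is_state \<mu>0 K f g y0 T u \<Phi> y \<and> \<nu> = distr \<mu>0 borel (\<Phi> T)"
  then obtain \<Phi>' y' where s': "is_state \<mu>0 K f g y0 T u \<Phi>' y'" and \<nu>: "\<nu> = distr \<mu>0 borel (\<Phi>' T)" by auto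
  have T: "T \<in> {0..T}" using T_pos by auto
  have "\<Phi>' T x = \<Phi> T x" if "x \<in> C" for x
    using state_stability(1)[OF s s' u u, of 0, OF _ _ T that] by simp
  then have "AE x in \<mu>0. \<Phi>' T x = \<Phi> T x" using AE_C by auto
  moreover have "\<Phi> T \<in> borel_measurable \<mu>0" "\<Phi>' T \<in> borel_measurable \<mu>0"
    using flow_section(2)[OF state_flow(1)[OF s] T] flow_section(2)[OF state_flow(1)[OF s'] T]
    by (auto intro: borel_measurable_mu0)
  ultimately show "\<nu> = distr \<mu>0 borel (\<Phi> T)"
    unfolding \<nu> by (intro distr_cong_AE) auto
qed

text \<open>Absorption run backwards from \<open>T\<close>. Both trajectories see the same measure
  and agents, so only the base point contributes, with coefficient \<open>2 * L\<close>; this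
  explains the rate \<open>4 * L\<close>. The bound holds for all pairs of points, not only in
  \<open>C\<close>.\<close>

lemma flow_inverse_lipschitz:
  fixes y :: "real \<Rightarrow> 'M::finite \<Rightarrow> 'a"
  assumes s: "is_state \<mu>0 K f g y0 T u \<Phi> y"
  shows "norm (x - x') \<le> 2 * norm (\<Phi> T x - \<Phi> T x') * exp (4 * L * T)"
proof -
  note sf = state_flow[OF s]
  have T: "T \<in> {0..T}" "0 \<in> {0..T}" using T_pos by auto
  define w where "w t = norm (\<Phi> t x - \<Phi> t x')" for t
  obtain B0 where B0: "0 \<le> B0" "\<And>t z. t \<in> {0..T} \<Longrightarrow> z \<in> {x, x'} \<Longrightarrow> norm (\<Phi> t z) \<le> B0"
    using flow_bounded[OF sf(1), of "{x, x'}"] by auto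
  have "w 0 \<le> 2 * norm (\<Phi> T x - \<Phi> T x') * exp (4 * L * (T - 0))"
  proof (rule weighted_bound_absorb[where I="{0..T}" and e="\<lambda>t. exp (4 * L * (T - t))" and ?B0.0 = "2 * B0", OF _ _ _ _ T(2)])
    show "w t \<le> 2 * B0" if "t \<in> {0..T}" for t
      using B0(2)[OF that, of x] B0(2)[OF that, of x'] norm_triangle_ineq4[of "\<Phi> t x" "\<Phi> t x'"] by (simp add: w_def)
    show "1 \<le> exp (4 * L * (T - t))" if "t \<in> {0..T}" for t using that L_pos by simp
    show "w t \<le> norm (\<Phi> T x - \<Phi> T x') + B / 2 * exp (4 * L * (T - t))"
      if B: "0 \<le> B" and H: "\<And>j. j \<in> {0..T} \<Longrightarrow> w j \<le> B * exp (4 * L * (T - j))" and t: "t \<in> {0..T}" for B t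
    proof -
      let ?b = "\<lambda>x s. velocity \<Phi> y s x"
      have i: "set_integrable lborel {0..T} (?b x)" for x by (intro velocity_set_integrable sf T)
      have i': "set_integrable lborel {t..T} (?b x)" for x using t by (intro set_integrable_subset[OF i]) auto
      have e: "\<Phi> T x = \<Phi> t x + (LINT s:{t..T}|lborel. ?b x s)" for x
        unfolding sf(3)[OF T(1), of x] sf(3)[OF t, of x] by (subst set_lebesgue_integral_split_Icc[OF i t]) simp
      have "\<Phi> t x - \<Phi> t x' = (\<Phi> T x - \<Phi> T x') - (LINT s:{t..T}|lborel. ?b x s - ?b x' s)"
        using i' e[of x] e[of x'] by (subst set_integral_diff) (auto simp: algebra_simps)
      then have "w t \<le> norm (\<Phi> T x - \<Phi> T x') + norm (LINT s:{t..T}|lborel. ?b x s - ?b x' s)"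
        unfolding w_def by (simp only: norm_triangle_ineq4)
      also have "norm (LINT s:{t..T}|lborel. ?b x s - ?b x' s) \<le> (- (B / 2) * exp (4 * L * (T - T))) - (- (B / 2) * exp (4 * L * (T - t)))"
      proof (rule norm_set_integral_le_FTC[where F = "\<lambda>s. - (B / 2) * exp (4 * L * (T - s))" and F' = "\<lambda>s. 2 * L * (B * exp (4 * L * (T - s)))"])
        show "t \<le> T" using t by simp
        fix s assume "s \<in> {t..T}"
        then have s: "s \<in> {0..T}" using t by auto
        have "norm (?b x s - ?b x' s) \<le> L * (0 + 2 * norm (\<Phi> s x - \<Phi> s x') + 0)"
          by (intro Fop_diff flow_section[OF sf(1) s]) auto
        also have "\<dots> \<le> 2 * L * (B * exp (4 * L * (T - s)))" using H[OF s] L_pos by (simp add: w_def)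
        finally show "norm (?b x s - ?b x' s) \<le> 2 * L * (B * exp (4 * L * (T - s)))" .
      qed (auto intro!: derivative_eq_intros continuous_intros)
      finally show ?thesis using B by simp
    qed
  qed simp
  moreover have "\<Phi> 0 z = z" for z
    by (subst sf(3)[OF T(2)]) (simp only: set_lebesgue_integral_singleton_Icc add_0_right)
  ultimately show ?thesis by (simp add: w_def)
qed

text \<open>The preimage of a null set is its image under the inverse of the flow on the range. That
  inverse is Lipschitz, and Lipschitz images of null sets in the same dimension are null.\<close>

lemma absolutely_continuous_flow:
  fixes y :: "real \<Rightarrow> 'M::finite \<Rightarrow> 'a"
  assumes s: "is_state \<mu>0 K f g y0 T u \<Phi> y" and ac: "absolutely_continuous lborel \<mu>0"
  shows "absolutely_continuous lborel (distr \<mu>0 borel (\<Phi> T))"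
  unfolding absolutely_continuous_def
proof
  fix N assume N: "N \<in> null_sets (lborel :: 'a measure)"
  have T: "T \<in> {0..T}" using T_pos by auto
  have \<Phi>m: "\<Phi> T \<in> borel_measurable borel" by (rule flow_section(2)[OF state_flow(1)[OF s] T])
  have Nb: "N \<in> sets borel" using N by (auto simp: null_sets_def)
  have negN: "negligible N" using N by (simp add: negligible_iff_null_sets null_sets_def)
  note inv = flow_inverse_lipschitz[OF s]
  have inj: "x = x'" if "\<Phi> T x = \<Phi> T x'" for x x' using inv[of x x'] that by simp
  define \<Psi> where "\<Psi> = the_inv (\<Phi> T)"
  have \<Psi>: "\<Psi> (\<Phi> T x) = x" for x unfolding \<Psi>_def using inj by (intro the_inv_f_f injI)
  have "negligible (\<Psi> ` (N \<inter> range (\<Phi> T)))"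
  proof (rule negligible_locally_Lipschitz_image)
    show "negligible (N \<inter> range (\<Phi> T))" using negN by (rule negligible_subset) auto
    fix p assume p: "p \<in> N \<inter> range (\<Phi> T)"
    have "norm (\<Psi> q - \<Psi> p) \<le> 2 * exp (4 * L * T) * norm (q - p)" if "q \<in> range (\<Phi> T)" for q
      using p that inv by (auto simp: \<Psi> mult_ac)
    then show "\<exists>S B. open S \<and> p \<in> S \<and> (\<forall>q\<in>(N \<inter> range (\<Phi> T)) \<inter> S. norm (\<Psi> q - \<Psi> p) \<le> B * norm (q - p))"
      by (intro exI[of _ UNIV] exI[of _ "2 * exp (4 * L * T)"]) auto
  qed simp
  moreover have "\<Phi> T -` N \<subseteq> \<Psi> ` (N \<inter> range (\<Phi> T))"
  proof
    fix x assume "x \<in> \<Phi> T -` N"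
    then show "x \<in> \<Psi> ` (N \<inter> range (\<Phi> T))" by (intro image_eqI[where x = "\<Phi> T x"]) (auto simp: \<Psi>)
  qed
  ultimately have "negligible (\<Phi> T -` N)" by (rule negligible_subset)
  moreover have m: "\<Phi> T -` N \<in> sets borel" using measurable_sets[OF \<Phi>m Nb] by simp
  ultimately have "\<Phi> T -` N \<in> null_sets lborel" by (simp add: negligible_iff_null_sets null_sets_def)
  then have "\<Phi> T -` N \<in> null_sets \<mu>0" using ac by (auto simp: absolutely_continuous_def)
  then show "N \<in> null_sets (distr \<mu>0 borel (\<Phi> T))"
    using Nb by (subst null_sets_distr_iff[OF borel_measurable_mu0[OF \<Phi>m]]) auto
qed

end

section \<open>Existence of states\<close>

instance bcontfun :: (metric_space, banach) banach ..

text \<open>Uniform convergence controls the function at the moving point, continuity of the limit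
  handles the point. This makes the constructed flow jointly continuous in time and space.\<close>

lemma tendsto_apply_bcontfun:
  fixes v :: "'b \<Rightarrow> ('a::metric_space \<Rightarrow>\<^sub>C 'e::real_normed_vector)"
  assumes v: "(v \<longlongrightarrow> v0) F" and h: "(h \<longlongrightarrow> x0) F"
  shows "((\<lambda>i. apply_bcontfun (v i) (h i)) \<longlongrightarrow> apply_bcontfun v0 x0) F"
proof -
  have "((\<lambda>i. apply_bcontfun v0 (h i)) \<longlongrightarrow> apply_bcontfun v0 x0) F"
    using continuous_on_tendsto_compose[OF continuous_on_apply_bcontfun[of UNIV v0] h] by simp
  moreover have "((\<lambda>i. apply_bcontfun (v i) (h i) - apply_bcontfun v0 (h i)) \<longlongrightarrow> 0) F"
  proof (rule Lim_null_comparison)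
    show "\<forall>\<^sub>F i in F. norm (apply_bcontfun (v i) (h i) - apply_bcontfun v0 (h i)) \<le> norm (v i - v0)"
      using norm_bounded[of "v _ - v0"] by (auto simp: minus_bcontfun.rep_eq)
    show "((\<lambda>i. norm (v i - v0)) \<longlongrightarrow> 0) F" using v by (intro tendsto_norm_zero LIM_zero)
  qed
  ultimately have "((\<lambda>i. (apply_bcontfun (v i) (h i) - apply_bcontfun v0 (h i)) + apply_bcontfun v0 (h i)) \<longlongrightarrow> 0 + apply_bcontfun v0 x0) F"
    by (intro tendsto_add)
  then show ?thesis by simp
qed

lemma bounded_linear_apply_bcontfun:
  "bounded_linear (\<lambda>v :: 'a::metric_space \<Rightarrow>\<^sub>C 'e::real_normed_vector. apply_bcontfun v x)"
  by (rule bounded_linear_intro[of _ 1]) (auto simp: plus_bcontfun.rep_eq scaleR_bcontfun.rep_eq norm_bounded)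

context splitting_model
begin

text \<open>A control is merely measurable in time, so the right side is not continuous. Subtracting
  \<open>y0\<close> and the primitive \<open>U\<close> of the control leaves an unknown
  \<open>v\<close> with a continuous right side, to which \<open>picard_global\<close>
  applies.\<close>

lemma agents_exist:
  fixes u :: "real \<Rightarrow> 'M::finite \<Rightarrow> 'a"
  assumes u: "\<And>m. set_integrable lborel {0..T} (\<lambda>t. u t m)"
  obtains y where "\<forall>m. continuous_on {0..T} (\<lambda>t. y t m)"
    "\<And>t m. t \<in> {0..T} \<Longrightarrow> y t m = y0 m + (LINT s:{0..t}|lborel. Gop g (y s) m + u s m)"
proof -
  define U where "U s m = integral {0..s} (\<lambda>r. u r m)" for s m
  have Uc: "continuous_on {0..T} (\<lambda>s. U s m)" for m
    unfolding U_def using set_borel_integral_eq_integral(1)[OF u] by (intro indefinite_integral_continuous_1)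
  define N where "N s v = (\<chi> m. Gop g (\<lambda>m. y0 m + U s m + v $ m) m)" for s and v :: "'a^'M"
  have Nc: "continuous_on ({0..T} \<times> UNIV) (\<lambda>(s, v). N s v)"
    unfolding N_def Gop_def split_beta
    by (intro continuous_intros continuous_on_compose2[OF g_cont[of UNIV]] continuous_on_compose2[OF Uc]) auto
  \<comment> \<open>The Euclidean norm of the vector of agents is bounded by the sum of component
    norms, which costs the factor \<open>CARD('M)\<close>.\<close>
  have lip: "norm (N s v - N s w) \<le> (2 * L * CARD('M)) * norm (v - w)" for s v w
  proof -
    have "norm (N s v - N s w) \<le> (\<Sum>m\<in>UNIV. norm ((N s v - N s w) $ m))"
      unfolding norm_vec_def by (rule L2_set_le_sum) auto
    also have "\<dots> \<le> (\<Sum>m\<in>(UNIV::'M set). 2 * L * norm (v - w))"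
    proof (rule sum_mono)
      fix m
      have "norm (Gop g (\<lambda>m. y0 m + U s m + v $ m) m - Gop g (\<lambda>m. y0 m + U s m + w $ m) m) \<le> 2 * L * norm (v - w)"
        using Finite_Cartesian_Product.norm_nth_le[of "v - w"] by (intro Gop_diff) auto
      then show "norm ((N s v - N s w) $ m) \<le> 2 * L * norm (v - w)" by (simp add: N_def)
    qed
    finally show ?thesis by (simp add: mult_ac)
  qed
  obtain v where v: "continuous_on {0..T} v" "\<And>t. t \<in> {0..T} \<Longrightarrow> ((\<lambda>s. N s (v s)) has_integral v t) {0..t}"
    using picard_global[of T "2 * L * CARD('M)" N] Nc lip T_pos L_pos by auto
  define y where "y t m = y0 m + U t m + v t $ m" for t m
  have yc: "\<forall>m. continuous_on {0..T} (\<lambda>t. y t m)"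
    unfolding y_def by (intro allI continuous_intros Uc v)
  show ?thesis
  proof (rule that[OF yc])
    fix t m assume t: "t \<in> {0..T}"
    have iu: "set_integrable lborel {0..t} (\<lambda>s. u s m)" using t by (intro set_integrable_subset[OF u]) auto
    have ig: "set_integrable lborel {0..t} (\<lambda>s. Gop g (y s) m)" by (rule Gop_set_integrable[OF yc t])
    have "((\<lambda>s. N s (v s) $ m) has_integral v t $ m) {0..t}"
      using has_integral_linear[OF v(2)[OF t] bounded_linear_vec_nth[of m]] by (simp add: comp_def)
    then have "v t $ m = integral {0..t} (\<lambda>s. Gop g (y s) m)"
      by (simp add: N_def y_def[abs_def] integral_unique)
    then have "v t $ m = (LINT s:{0..t}|lborel. Gop g (y s) m)"
      using set_borel_integral_eq_integral(2)[OF ig] by simp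
    moreover have "U t m = (LINT s:{0..t}|lborel. u s m)"
      using set_borel_integral_eq_integral(2)[OF iu] by (simp add: U_def)
    ultimately show "y t m = y0 m + (LINT s:{0..t}|lborel. Gop g (y s) m + u s m)"
      using set_integral_add(2)[OF ig iu] by (simp add: y_def)
  qed
qed

text \<open>The flow is unbounded in the initial point, so it is sought in the form
  \<open>\<Phi> t x = x + (1 + norm x) *\<^sub>R v t x\<close> with \<open>v t\<close> a bounded continuous function.\<close>

lemma flow_exists:
  fixes y :: "real \<Rightarrow> 'M::finite \<Rightarrow> 'a"
  assumes y: "\<forall>m. continuous_on {0..T} (\<lambda>t. y t m)"
  obtains \<Phi> where "continuous_on ({0..T} \<times> UNIV) (\<lambda>(t, x). \<Phi> t x)"
    "\<And>t x. t \<in> {0..T} \<Longrightarrow> \<Phi> t x = x + (LINT s:{0..t}|lborel. velocity \<Phi> y s x)"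
proof -
  obtain R where R: "0 < R" "\<And>\<zeta>. \<zeta> \<in> C \<Longrightarrow> norm \<zeta> \<le> R"
    using compact_imp_bounded[OF C_compact] bounded_pos by metis
  obtain A where A: "0 \<le> A" "\<And>t m. t \<in> {0..T} \<Longrightarrow> norm (y t m) \<le> A" using agents_bounded[OF y] by blast
  define X where "X v x = x + (1 + norm x) *\<^sub>R apply_bcontfun v x" for v :: "'a \<Rightarrow>\<^sub>C 'a" and x
  have Xc: "continuous_on S (X v)" for v S unfolding X_def by (intro continuous_intros) auto
  have Xm: "X v \<in> borel_measurable borel" for v by (intro borel_measurable_continuous_onI Xc)
  have Xb: "bounded (X v ` C)" for v by (intro compact_imp_bounded compact_continuous_image Xc C_compact)
  have pos: "0 < 1 + norm x" for x :: 'a by (simp add: add_pos_nonneg)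
  have Xd: "norm (X v x - X w x) \<le> (1 + norm x) * norm (v - w)" for v w x
  proof -
    have "X v x - X w x = (1 + norm x) *\<^sub>R apply_bcontfun (v - w) x"
      by (simp add: X_def minus_bcontfun.rep_eq scaleR_diff_right)
    then show ?thesis using norm_bounded[of "v - w" x] pos[of x] by (simp add: mult_left_mono)
  qed
  have XdC: "norm (X v \<zeta> - X w \<zeta>) \<le> (1 + R) * norm (v - w)" if "\<zeta> \<in> C" for v w \<zeta>
    using Xd[of v \<zeta> w] R(2)[OF that] by (auto elim!: order_trans intro!: mult_right_mono)
  \<comment> \<open>The velocity written for the rescaled unknown. Linear growth of
    \<open>Fop\<close> is compensated by the division, so the right side stays in the space of
    bounded functions.\<close>
  define V where "V s v x = (1 / (1 + norm x)) *\<^sub>R Fop K f (distr \<mu>0 borel (X v)) (X v x) (y (clamp s))" for s v x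
  have Fc: "continuous_on UNIV (\<lambda>a. Fop K f (distr \<mu>0 borel (X v)) a (y s))" for s v
  proof (rule lipschitz_on_continuous_on)
    show "(2 * L)-lipschitz_on UNIV (\<lambda>a. Fop K f (distr \<mu>0 borel (X v)) a (y s))"
    proof (rule lipschitz_onI)
      fix a b
      have "norm (Fop K f (distr \<mu>0 borel (X v)) a (y s) - Fop K f (distr \<mu>0 borel (X v)) b (y s)) \<le> L * (0 + 2 * norm (a - b) + 0)"
        by (intro Fop_diff Xm Xb) auto
      then show "dist (Fop K f (distr \<mu>0 borel (X v)) a (y s)) (Fop K f (distr \<mu>0 borel (X v)) b (y s)) \<le> 2 * L * dist a b"
        by (simp add: dist_norm)
    qed (use L_pos in simp)
  qed
  have Vc: "continuous_on UNIV (V s v)" for s v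
    unfolding V_def by (intro continuous_intros continuous_on_compose2[OF Fc Xc]) (use pos in \<open>auto simp: less_imp_neq[symmetric]\<close>)
  \<comment> \<open>Uniform in \<open>x\<close>: points of \<open>C\<close> move by at most
    \<open>1 + R\<close> times the distance of the unknowns, and for the base point the factor
    \<open>1 + norm x\<close> cancels, leaving 2.\<close>
  have Vd: "norm (V s v x - V s' w x) \<le> L * ((3 + R) * norm (v - w) + (\<Sum>m\<in>UNIV. norm (y (clamp s) m - y (clamp s') m)))" for s s' v w x
  proof -
    let ?e = "\<Sum>m\<in>UNIV. norm (y (clamp s) m - y (clamp s') m)"
    have e: "norm (y (clamp s) m - y (clamp s') m) \<le> ?e" for m by (rule member_le_sum) auto
    have e0: "0 \<le> ?e" by (intro sum_nonneg) auto
    have "norm (V s v x - V s' w x) = (1 / (1 + norm x)) * norm (Fop K f (distr \<mu>0 borel (X v)) (X v x) (y (clamp s)) - Fop K f (distr \<mu>0 borel (X w)) (X w x) (y (clamp s')))"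
      using pos[of x] by (simp add: V_def flip: scaleR_diff_right)
    also have "\<dots> \<le> (1 / (1 + norm x)) * (L * ((1 + R) * norm (v - w) + 2 * norm (X v x - X w x) + ?e))"
      using pos[of x] e XdC by (intro mult_left_mono Fop_diff Xm Xb) auto
    also have "\<dots> \<le> (1 / (1 + norm x)) * (L * ((1 + R) * norm (v - w) + 2 * ((1 + norm x) * norm (v - w)) + ?e))"
      using pos[of x] L_pos R(1) Xd[of v x w] by (intro mult_left_mono add_mono) auto
    also have "\<dots> = L * (((1 + R) * norm (v - w)) / (1 + norm x) + 2 * norm (v - w) + ?e / (1 + norm x))"
    proof -
      have "(1 / c) * (L * (p + 2 * (c * n) + q)) = L * (p / c + 2 * n + q / c)" if "0 < c" for c n p q :: real
        using that by (simp add: field_simps)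
      then show ?thesis using pos[of x] .
    qed
    also have "\<dots> \<le> L * ((1 + R) * norm (v - w) + 2 * norm (v - w) + ?e)"
    proof -
      have "a / (1 + norm x) \<le> a" if "0 \<le> a" for a
        using that pos[of x] by (simp add: divide_le_eq mult_le_cancel_left1 algebra_simps)
      then show ?thesis using L_pos R e0 by (intro mult_left_mono add_mono) auto
    qed
    finally show ?thesis by (simp add: algebra_simps)
  qed
  \<comment> \<open>Boundedness is inherited from the case of the zero function, which represents
    the identity map, by the Lipschitz estimate \<open>Vd\<close>.\<close>
  have VB: "V s v \<in> bcontfun" for s v
  proof (rule bcontfun_normI[OF Vc])
    fix x
    have "norm (V s v x - V s 0 x) \<le> L * ((3 + R) * norm v)" using Vd[of s v x s 0] by simp
    moreover have "norm (V s 0 x) \<le> L * (R + 2 + A)"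
    proof -
      have X0: "X 0 = (\<lambda>x. x)" by (auto simp: X_def)
      have "norm (Fop K f (distr \<mu>0 borel (X 0)) x (y (clamp s))) \<le> L * (R + 2 * norm x + A)"
        using R A clamp_mem by (intro Fop_bound Xm) (auto simp: X0)
      also have "\<dots> \<le> L * ((R + 2 + A) * (1 + norm x))"
        using L_pos R A by (intro mult_left_mono) (auto simp: algebra_simps)
      finally have "norm (Fop K f (distr \<mu>0 borel (X 0)) x (y (clamp s))) \<le> L * (R + 2 + A) * (1 + norm x)" by simp
      then show ?thesis using pos[of x] by (simp add: V_def X0 divide_le_eq)
    qed
    ultimately show "norm (V s v x) \<le> L * ((3 + R) * norm v) + L * (R + 2 + A)"
      using norm_triangle_ineq[of "V s v x - V s 0 x" "V s 0 x"] by simp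
  qed
  define N where "N s v = Bcontfun (V s v)" for s v
  have N: "apply_bcontfun (N s v) = V s v" for s v unfolding N_def using VB by (rule Bcontfun_inverse)
  have Nd: "norm (N s v - N s' w) \<le> L * ((3 + R) * norm (v - w) + (\<Sum>m\<in>UNIV. norm (y (clamp s) m - y (clamp s') m)))" for s s' v w
    by (rule norm_bound) (simp add: minus_bcontfun.rep_eq N Vd)
  have Nc: "continuous_on ({0..T} \<times> UNIV) (\<lambda>(s, v). N s v)"
    unfolding continuous_on_def
  proof (intro ballI)
    fix p0 assume "p0 \<in> {0..T} \<times> (UNIV :: ('a \<Rightarrow>\<^sub>C 'a) set)"
    let ?F = "at p0 within {0..T} \<times> (UNIV :: ('a \<Rightarrow>\<^sub>C 'a) set)"
    have yt: "((\<lambda>p. y (clamp (fst p)) m) \<longlongrightarrow> y (clamp (fst p0)) m) ?F" for m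
    proof -
      have "continuous_on UNIV (\<lambda>t. y (clamp t) m)"
        using y clamp_mem by (intro continuous_on_compose2[of "{0..T}" "\<lambda>t. y t m" UNIV clamp] clamp_cont) auto
      then have "isCont (\<lambda>t. y (clamp t) m) (fst p0)" by (simp add: continuous_on_eq_continuous_at)
      then show ?thesis by (rule isCont_tendsto_compose) (intro tendsto_intros)
    qed
    have "((\<lambda>p. L * ((3 + R) * norm (snd p - snd p0) + (\<Sum>m\<in>UNIV. norm (y (clamp (fst p)) m - y (clamp (fst p0)) m)))) \<longlongrightarrow>
        L * ((3 + R) * norm (snd p0 - snd p0) + (\<Sum>m\<in>UNIV. norm (y (clamp (fst p0)) m - y (clamp (fst p0)) m)))) ?F"
      by (intro tendsto_intros yt)
    then have "((\<lambda>p. L * ((3 + R) * norm (snd p - snd p0) + (\<Sum>m\<in>UNIV. norm (y (clamp (fst p)) m - y (clamp (fst p0)) m)))) \<longlongrightarrow> 0) ?F"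
      by simp
    then have "((\<lambda>p. N (fst p) (snd p) - N (fst p0) (snd p0)) \<longlongrightarrow> 0) ?F"
      by (rule Lim_null_comparison[rotated]) (simp add: Nd)
    then show "((\<lambda>(s, v). N s v) \<longlongrightarrow> (case p0 of (s, v) \<Rightarrow> N s v)) ?F"
      unfolding split_beta by (rule LIM_zero_cancel)
  qed
  have lip: "norm (N s v - N s w) \<le> (L * (3 + R)) * norm (v - w)" for s v w
    using Nd[of s v s w] by (simp add: mult.assoc)
  have LR: "0 < L * (3 + R)" using L_pos R by simp
  \<comment> \<open>Picard in the Banach space of bounded continuous functions: the mean-field
    equation is solved for all initial points simultaneously, because the velocity depends on the
    whole map.\<close>
  obtain v where v: "continuous_on {0..T} v" "\<And>t. t \<in> {0..T} \<Longrightarrow> ((\<lambda>s. N s (v s)) has_integral v t) {0..t}"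
    using picard_global[of T "L * (3 + R)" N] Nc lip LR T_pos by auto
  define \<Phi> where "\<Phi> t = X (v t)" for t
  have \<Phi>c: "continuous_on ({0..T} \<times> UNIV) (\<lambda>(t, x). \<Phi> t x)"
    unfolding continuous_on_def
  proof (intro ballI)
    fix p0 assume p0: "p0 \<in> {0..T} \<times> (UNIV :: 'a set)"
    let ?F = "at p0 within {0..T} \<times> (UNIV :: 'a set)"
    have "continuous_on ({0..T} \<times> (UNIV :: 'a set)) (\<lambda>p. v (fst p))"
      by (intro continuous_on_compose2[OF v(1)] continuous_intros) auto
    then have "((\<lambda>p. v (fst p)) \<longlongrightarrow> v (fst p0)) ?F" using p0 by (auto simp: continuous_on_def)
    then have "((\<lambda>p. apply_bcontfun (v (fst p)) (snd p)) \<longlongrightarrow> apply_bcontfun (v (fst p0)) (snd p0)) ?F"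
      by (intro tendsto_apply_bcontfun tendsto_intros)
    then show "((\<lambda>(t, x). \<Phi> t x) \<longlongrightarrow> (case p0 of (t, x) \<Rightarrow> \<Phi> t x)) ?F"
      unfolding split_beta \<Phi>_def X_def by (intro tendsto_intros)
  qed
  show ?thesis
  proof (rule that[OF \<Phi>c])
    fix t x assume t: "t \<in> {0..T}"
    have "((\<lambda>s. (1 + norm x) *\<^sub>R apply_bcontfun (N s (v s)) x) has_integral (1 + norm x) *\<^sub>R apply_bcontfun (v t) x) {0..t}"
      using has_integral_linear[OF v(2)[OF t] bounded_linear_apply_bcontfun[of x]]
      by (intro has_integral_cmul) (simp add: comp_def)
    moreover have "(1 + norm x) *\<^sub>R apply_bcontfun (N s (v s)) x = velocity \<Phi> y s x"
      if "s \<in> {0..t}" for s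
    proof -
      have "clamp s = s" using that t by (intro clamp_id) auto
      moreover have "(1 + norm x) *\<^sub>R ((1 / (1 + norm x)) *\<^sub>R z) = z" for z :: 'a using pos[of x] by simp
      ultimately show ?thesis by (simp only: N V_def \<Phi>_def)
    qed
    ultimately have "((\<lambda>s. velocity \<Phi> y s x) has_integral (1 + norm x) *\<^sub>R apply_bcontfun (v t) x) {0..t}"
      by (rule has_integral_eq[rotated]) 
    then have "integral {0..t} (\<lambda>s. velocity \<Phi> y s x) = (1 + norm x) *\<^sub>R apply_bcontfun (v t) x"
      by (rule integral_unique)
    then have "(LINT s:{0..t}|lborel. velocity \<Phi> y s x) = (1 + norm x) *\<^sub>R apply_bcontfun (v t) x"
      by (subst set_borel_integral_eq_integral(2)[OF velocity_set_integrable[OF \<Phi>c y t]])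
    then show "\<Phi> t x = x + (LINT s:{0..t}|lborel. velocity \<Phi> y s x)"
      by (simp only:) (simp add: \<Phi>_def X_def)
  qed
qed

lemma state_exists:
  fixes u :: "real \<Rightarrow> 'M::finite \<Rightarrow> 'a"
  assumes u: "\<And>m. set_integrable lborel {0..T} (\<lambda>t. u t m)"
  obtains \<Phi> y where "is_state \<mu>0 K f g y0 T u \<Phi> y"
proof (rule agents_exist[OF u, of y0])
  fix y assume y: "\<forall>m. continuous_on {0..T} (\<lambda>t. y t m)"
    "\<And>t m. t \<in> {0..T} \<Longrightarrow> y t m = y0 m + (LINT s:{0..t}|lborel. Gop g (y s) m + u s m)"
  show thesis
  proof (rule flow_exists[OF y(1)])
    fix \<Phi> assume \<Phi>: "continuous_on ({0..T} \<times> UNIV) (\<lambda>(t, x). \<Phi> t x)"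
      "\<And>t x. t \<in> {0..T} \<Longrightarrow> \<Phi> t x = x + (LINT s:{0..t}|lborel. velocity \<Phi> y s x)"
    show thesis
      by (rule that[of \<Phi> y], unfold is_state_def, intro conjI ballI allI \<Phi> y(2), rule y(1)[THEN spec])
  qed
qed

end

section \<open>Duality with the adjoint system\<close>

lemma (in pair_sigma_finite) integrable_pair_mult:
  fixes f g :: "_ \<Rightarrow> real"
  assumes f: "integrable M1 f" and g: "integrable M2 g"
  shows "integrable (M1 \<Otimes>\<^sub>M M2) (\<lambda>z. f (fst z) * g (snd z))"
proof (rule Fubini_integrable)
  note [measurable] = borel_measurable_integrable[OF f] borel_measurable_integrable[OF g]
  show "(\<lambda>z. f (fst z) * g (snd z)) \<in> borel_measurable (M1 \<Otimes>\<^sub>M M2)" by measurable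
  have "(\<lambda>x. \<integral>y. norm (f (fst (x, y)) * g (snd (x, y))) \<partial>M2) = (\<lambda>x. \<bar>f x\<bar> * (\<integral>y. \<bar>g y\<bar> \<partial>M2))"
    by (simp add: abs_mult)
  then show "integrable M1 (\<lambda>x. \<integral>y. norm (f (fst (x, y)) * g (snd (x, y))) \<partial>M2)" using f by simp
  show "AE x in M1. integrable M2 (\<lambda>y. f (fst (x, y)) * g (snd (x, y)))" using g by simp
qed

text \<open>Fubini on the triangle \<open>s \<le> r\<close>. It plays the role of integration by
  parts for curves given only as primitives, without differentiating anything.\<close>

lemma set_integral_inner_parts:
  fixes a b :: "real \<Rightarrow> 'b::euclidean_space"
  assumes a: "set_integrable lborel {c..d} a" and b: "set_integrable lborel {c..d} b"
  shows "(LINT s:{c..d}|lborel. (LINT r:{s..d}|lborel. a r) \<bullet> b s) = (LINT r:{c..d}|lborel. a r \<bullet> (LINT s:{c..r}|lborel. b s))"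
proof -
  define a' where "a' r = indicator {c..d} r *\<^sub>R a r" for r
  define b' where "b' r = indicator {c..d} r *\<^sub>R b r" for r
  have ia: "integrable lborel a'" and ib: "integrable lborel b'"
    using a b by (auto simp: set_integrable_def a'_def[abs_def] b'_def[abs_def])
  note [measurable] = borel_measurable_integrable[OF ia] borel_measurable_integrable[OF ib]
  \<comment> \<open>The integrand supported on the triangle; each iterated integral is one side of
    the claim.\<close>
  define F where "F s r = indicator {s..} r * (a' r \<bullet> b' s)" for s r
  have Fi: "integrable (lborel \<Otimes>\<^sub>M lborel) (\<lambda>(s, r). F s r)"
  proof (rule Bochner_Integration.integrable_bound)
    show "integrable (lborel \<Otimes>\<^sub>M lborel) (\<lambda>z. norm (b' (fst z)) * norm (a' (snd z)))"
      using ia ib by (intro lborel_pair.integrable_pair_mult integrable_norm)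
    have "(\<lambda>z. if fst z \<le> snd z then a' (snd z) \<bullet> b' (fst z) else 0) \<in> borel_measurable (lborel \<Otimes>\<^sub>M lborel)"
      by measurable
    moreover have "(\<lambda>z. if fst z \<le> snd z then a' (snd z) \<bullet> b' (fst z) else 0) = (\<lambda>(s, r). F s r)"
      by (auto simp: F_def fun_eq_iff indicator_def)
    ultimately show "(\<lambda>(s, r). F s r) \<in> borel_measurable (lborel \<Otimes>\<^sub>M lborel)" by simp
    have "norm (F s r) \<le> norm (b' s) * norm (a' r)" for s r
      using Cauchy_Schwarz_ineq2[of "a' r" "b' s"] by (simp add: F_def indicator_def mult.commute)
    then show "AE z in lborel \<Otimes>\<^sub>M lborel. norm (case z of (s, r) \<Rightarrow> F s r) \<le> norm (norm (b' (fst z)) * norm (a' (snd z)))"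
      by (intro AE_I2) (auto simp: split_beta)
  qed
  have 1: "(\<integral>r. F s r \<partial>lborel) = indicator {c..d} s *\<^sub>R ((LINT r:{s..d}|lborel. a r) \<bullet> b s)" for s
  proof (cases "s \<in> {c..d}")
    case True
    have "set_integrable lborel {s..d} a" using True by (intro set_integrable_subset[OF a]) auto
    then have "(\<integral>r. (indicator {s..d} r *\<^sub>R a r) \<bullet> b s \<partial>lborel) = (LINT r:{s..d}|lborel. a r) \<bullet> b s"
      unfolding set_lebesgue_integral_def set_integrable_def by (intro integral_inner_left)
    moreover have "F s r = (indicator {s..d} r *\<^sub>R a r) \<bullet> b s" for r
      using True by (auto simp: F_def a'_def b'_def indicator_def)
    ultimately show ?thesis using True by simp
  next
    case False
    then show ?thesis by (auto simp: F_def b'_def)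
  qed
  have 2: "(\<integral>s. F s r \<partial>lborel) = indicator {c..d} r *\<^sub>R (a r \<bullet> (LINT s:{c..r}|lborel. b s))" for r
  proof (cases "r \<in> {c..d}")
    case True
    have "set_integrable lborel {c..r} b" using True by (intro set_integrable_subset[OF b]) auto
    then have "(\<integral>s. a r \<bullet> (indicator {c..r} s *\<^sub>R b s) \<partial>lborel) = a r \<bullet> (LINT s:{c..r}|lborel. b s)"
      unfolding set_lebesgue_integral_def set_integrable_def by (intro integral_inner_right)
    moreover have "F s r = a r \<bullet> (indicator {c..r} s *\<^sub>R b s)" for s
      using True by (auto simp: F_def a'_def b'_def indicator_def)
    ultimately show ?thesis using True by simp
  next
    case False
    then show ?thesis by (auto simp: F_def a'_def)
  qed
  show ?thesis
    unfolding set_lebesgue_integral_def[of lborel "{c..d}"] 1[symmetric] 2[symmetric]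
    by (rule lborel_pair.Fubini_integral[OF Fi, symmetric])
qed

text \<open>Formally, \<open>p \<bullet> w\<close> has time derivative
  \<open>p \<bullet> b - a \<bullet> w\<close>, and \<open>w\<close> vanishes at time 0. Since
  \<open>p\<close> satisfies its equation only almost everywhere for each separate time, the
  argument is carried out on the product of time and space.\<close>

lemma integral_inner_parts_family:
  fixes p a b w :: "real \<Rightarrow> 'x \<Rightarrow> 'b::euclidean_space" and pT :: "'x \<Rightarrow> 'b"
  assumes M: "prob_space M" and T: "0 \<le> T" and B: "0 \<le> B"
    and pm: "(\<lambda>z. p (fst z) (snd z)) \<in> borel_measurable (lborel \<Otimes>\<^sub>M M)"
    and bm: "(\<lambda>z. b (fst z) (snd z)) \<in> borel_measurable (lborel \<Otimes>\<^sub>M M)"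
    and ai: "integrable (lborel \<Otimes>\<^sub>M M) (\<lambda>z. indicator {0..T} (fst z) *\<^sub>R a (fst z) (snd z))"
    and am: "(\<lambda>z. a (fst z) (snd z)) \<in> borel_measurable (lborel \<Otimes>\<^sub>M M)"
    and pTi: "integrable M pT"
    and pi: "integrable (lborel \<Otimes>\<^sub>M M) (\<lambda>z. indicator {0..T} (fst z) *\<^sub>R p (fst z) (snd z))"
    and b_le: "AE x in M. \<forall>t\<in>{0..T}. norm (b t x) \<le> B"
    and w: "\<And>t x. t \<in> {0..T} \<Longrightarrow> w t x = (LINT s:{0..t}|lborel. b s x)"
    and p_eq: "\<And>t. t \<in> {0..T} \<Longrightarrow> AE x in M. p t x = pT x + (LINT s:{t..T}|lborel. a s x)"
  shows "(\<integral>x. pT x \<bullet> w T x \<partial>M) = (LINT t:{0..T}|lborel. (\<integral>x. p t x \<bullet> b t x - a t x \<bullet> w t x \<partial>M))"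
    and "set_integrable lborel {0..T} (\<lambda>t. \<integral>x. p t x \<bullet> b t x - a t x \<bullet> w t x \<partial>M)"
proof -
  interpret M: prob_space M by fact
  interpret P: pair_sigma_finite lborel M ..
  note [measurable] = pm bm am borel_measurable_integrable[OF pTi]
  let ?E = "lborel \<Otimes>\<^sub>M M"
  let ?\<chi> = "\<lambda>s::real. indicator {0..T} s :: real"
  define W where "W s x = (LINT r:{s..T}|lborel. a r x)" for s x
  \<comment> \<open>\<open>w\<close> is prescribed only on \<open>{0..T}\<close>; this version is
    given by a formula at every time and is therefore jointly measurable.\<close>
  define w' where "w' t x = (LINT s:{0..t}|lborel. b s x)" for t x
  have comp: "(\<lambda>q. h (f q) (g q)) \<in> borel_measurable N"
    if h: "(\<lambda>z. h (fst z) (snd z)) \<in> borel_measurable ?E" and [measurable]: "f \<in> N \<rightarrow>\<^sub>M lborel" "g \<in> N \<rightarrow>\<^sub>M M"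
    for h :: "real \<Rightarrow> 'x \<Rightarrow> 'b" and f g and N :: "((real \<times> 'x) \<times> real) measure"
  proof -
    have "(\<lambda>q. (f q, g q)) \<in> N \<rightarrow>\<^sub>M ?E" by measurable
    from measurable_compose[OF this h] show ?thesis by simp
  qed
  have comp1: "(\<lambda>q. h q x) \<in> borel_measurable lborel"
    if h: "(\<lambda>z. h (fst z) (snd z)) \<in> borel_measurable ?E" and x: "x \<in> space M" for h :: "real \<Rightarrow> 'x \<Rightarrow> 'b" and x
  proof -
    have "(\<lambda>q. (q, x)) \<in> lborel \<rightarrow>\<^sub>M ?E" using x by measurable
    from measurable_compose[OF this h] show ?thesis by simp
  qed
  have Wm[measurable]: "(\<lambda>z. W (fst z) (snd z)) \<in> borel_measurable ?E"
  proof -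
    note [measurable] = comp[OF am]
    have "(\<lambda>z. \<integral>r. (if fst z \<le> r \<and> r \<le> T then a r (snd z) else 0) \<partial>lborel) \<in> borel_measurable ?E"
      by measurable
    moreover have "(\<lambda>z. \<integral>r. (if fst z \<le> r \<and> r \<le> T then a r (snd z) else 0) \<partial>lborel) = (\<lambda>z. W (fst z) (snd z))"
      by (auto simp: W_def set_lebesgue_integral_def indicator_def fun_eq_iff intro!: Bochner_Integration.integral_cong)
    ultimately show ?thesis by simp
  qed
  have wm[measurable]: "(\<lambda>z. w' (fst z) (snd z)) \<in> borel_measurable ?E"
  proof -
    note [measurable] = comp[OF bm]
    have "(\<lambda>z. \<integral>r. (if 0 \<le> r \<and> r \<le> fst z then b r (snd z) else 0) \<partial>lborel) \<in> borel_measurable ?E"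
      by measurable
    moreover have "(\<lambda>z. \<integral>r. (if 0 \<le> r \<and> r \<le> fst z then b r (snd z) else 0) \<partial>lborel) = (\<lambda>z. w' (fst z) (snd z))"
      by (auto simp: w'_def set_lebesgue_integral_def indicator_def fun_eq_iff intro!: Bochner_Integration.integral_cong)
    ultimately show ?thesis by simp
  qed
  \<comment> \<open>The exceptional null set may vary with time; joint measurability lets these sets
    be assembled into one null set of the product.\<close>
  have e0: "AE z in ?E. fst z \<in> {0..T} \<longrightarrow> Q (fst z) (snd z)"
    if "{z \<in> space ?E. fst z \<in> {0..T} \<longrightarrow> Q (fst z) (snd z)} \<in> sets ?E" "\<And>t. t \<in> {0..T} \<Longrightarrow> AE x in M. Q t x" for Q
    using that by (intro P.AE_pair_measure) auto
  have e1: "AE z in ?E. fst z \<in> {0..T} \<longrightarrow> norm (b (fst z) (snd z)) \<le> B"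
  proof (rule e0)
    show "AE x in M. norm (b t x) \<le> B" if "t \<in> {0..T}" for t
      using b_le that by (auto elim!: eventually_mono)
  qed measurable
  have e2: "AE z in ?E. fst z \<in> {0..T} \<longrightarrow> p (fst z) (snd z) = pT (snd z) + W (fst z) (snd z)"
  proof (rule e0)
    show "AE x in M. p t x = pT x + W t x" if "t \<in> {0..T}" for t
      using p_eq[OF that] by (simp add: W_def)
  qed measurable
  have e3: "AE x in M. set_integrable lborel {0..T} (\<lambda>s. b s x)"
    using b_le AE_space
  proof eventually_elim
    case (elim x)
    show ?case unfolding set_integrable_def
    proof (rule integrableI_bounded_set[of "{0..T}" _ _ B])
      show "(\<lambda>s. indicator {0..T} s *\<^sub>R b s x) \<in> borel_measurable lborel"
        using comp1[OF bm elim(2)] by measurable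
    qed (use elim in \<open>auto simp: emeasure_lborel_Icc_eq\<close>)
  qed
  have e4: "AE x in M. set_integrable lborel {0..T} (\<lambda>s. a s x)"
    unfolding set_integrable_def using P.AE_integrable_snd[of "\<lambda>s x. indicator {0..T} s *\<^sub>R a s x"] ai
    by (simp add: split_beta')
  have e5: "AE z in ?E. fst z \<in> {0..T} \<longrightarrow> norm (w' (fst z) (snd z)) \<le> B * T"
  proof (rule e0)
    fix t assume t: "t \<in> {0..T}"
    show "AE x in M. norm (w' t x) \<le> B * T"
      using b_le
    proof eventually_elim
      case (elim x)
      have "norm (LINT s:{0..t}|lborel. b s x) \<le> B * t - B * 0"
        by (rule norm_set_integral_le_FTC[where F = "\<lambda>s. B * s" and F' = "\<lambda>_. B"])
          (use t elim in \<open>auto intro!: derivative_eq_intros continuous_intros\<close>)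
      also have "\<dots> \<le> B * T" using t B by (simp add: mult_left_mono)
      finally show ?case by (simp add: w'_def)
    qed
  qed measurable
  \<comment> \<open>An integrable majorant of all tails \<open>W\<close>, independent of time; with
    \<open>b\<close> bounded it makes the product \<open>W \<bullet> b\<close> integrable.\<close>
  define \<alpha> where "\<alpha> x = (\<integral>r. norm (?\<chi> r *\<^sub>R a r x) \<partial>lborel)" for x
  have \<alpha>i: "integrable M \<alpha>"
    unfolding \<alpha>_def using P.integrable_snd[of "\<lambda>s x. norm (?\<chi> s *\<^sub>R a s x)"] integrable_norm[OF ai]
    by (simp add: split_beta')
  note [measurable] = borel_measurable_integrable[OF \<alpha>i]
  have e6: "AE z in ?E. fst z \<in> {0..T} \<longrightarrow> norm (W (fst z) (snd z)) \<le> \<alpha> (snd z)"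
  proof (rule e0)
    fix t assume t: "t \<in> {0..T}"
    show "AE x in M. norm (W t x) \<le> \<alpha> x"
      using e4
    proof eventually_elim
      case (elim x)
      have "set_integrable lborel {t..T} (\<lambda>s. a s x)" using t by (intro set_integrable_subset[OF elim]) auto
      then have "norm (W t x) \<le> (\<integral>r. norm (indicator {t..T} r *\<^sub>R a r x) \<partial>lborel)"
        unfolding W_def set_lebesgue_integral_def by (intro integral_norm_bound)
      also have "\<dots> \<le> \<alpha> x" unfolding \<alpha>_def
      proof (rule Bochner_Integration.integral_mono)
        show "integrable lborel (\<lambda>r. norm (indicator {t..T} r *\<^sub>R a r x))"
          using \<open>set_integrable lborel {t..T} (\<lambda>s. a s x)\<close> unfolding set_integrable_def by (rule integrable_norm)
        show "integrable lborel (\<lambda>r. norm (?\<chi> r *\<^sub>R a r x))"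
          using elim unfolding set_integrable_def by (rule integrable_norm)
      qed (use t in \<open>auto simp: indicator_def\<close>)
      finally show ?case .
    qed
  qed measurable
  have iE: "integrable ?E (\<lambda>z. ?\<chi> (fst z) * (h (fst z) (snd z) \<bullet> k (fst z) (snd z)))"
    if [measurable]: "(\<lambda>z. h (fst z) (snd z)) \<in> borel_measurable ?E" "(\<lambda>z. k (fst z) (snd z)) \<in> borel_measurable ?E"
      and kb: "AE z in ?E. fst z \<in> {0..T} \<longrightarrow> norm (k (fst z) (snd z)) \<le> B'" and "0 \<le> B'"
      and hb: "AE z in ?E. fst z \<in> {0..T} \<longrightarrow> norm (h (fst z) (snd z)) \<le> \<beta> z"
      and \<beta>: "integrable ?E (\<lambda>z. ?\<chi> (fst z) * \<beta> z)" for h k :: "real \<Rightarrow> 'x \<Rightarrow> 'b" and B' \<beta>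
  proof (rule Bochner_Integration.integrable_bound)
    show "integrable ?E (\<lambda>z. B' * (?\<chi> (fst z) * \<beta> z))" using \<beta> by (rule integrable_mult_right)
    show "AE z in ?E. norm (?\<chi> (fst z) * (h (fst z) (snd z) \<bullet> k (fst z) (snd z))) \<le> norm (B' * (?\<chi> (fst z) * \<beta> z))"
      using kb hb
    proof eventually_elim
      case (elim z)
      show ?case
      proof (cases "fst z \<in> {0..T}")
        case True
        have "\<bar>h (fst z) (snd z) \<bullet> k (fst z) (snd z)\<bar> \<le> norm (h (fst z) (snd z)) * norm (k (fst z) (snd z))"
          by (rule Cauchy_Schwarz_ineq2)
        also have "\<dots> \<le> \<beta> z * B'"
          using elim True by (intro mult_mono) (auto intro: order_trans[OF norm_ge_zero])
        also have "\<dots> \<le> \<bar>B' * \<beta> z\<bar>" by (simp add: mult.commute)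
        finally show ?thesis using True by simp
      qed simp
    qed
  qed measurable
  have J1: "integrable ?E (\<lambda>z. ?\<chi> (fst z) * (pT (snd z) \<bullet> b (fst z) (snd z)))"
  proof (rule iE[of "\<lambda>_. pT" b B "\<lambda>z. norm (pT (snd z))", OF _ bm e1 B])
    show "integrable ?E (\<lambda>z. ?\<chi> (fst z) * norm (pT (snd z)))"
      using pTi by (intro P.integrable_pair_mult) (auto simp: emeasure_lborel_Icc_eq)
  qed auto
  have J2: "integrable ?E (\<lambda>z. ?\<chi> (fst z) * (p (fst z) (snd z) \<bullet> b (fst z) (snd z)))"
    by (rule iE[of p b B "\<lambda>z. norm (p (fst z) (snd z))", OF pm bm e1 B])
      (use integrable_norm[OF pi] in auto)
  have J3: "integrable ?E (\<lambda>z. ?\<chi> (fst z) * (W (fst z) (snd z) \<bullet> b (fst z) (snd z)))"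
    by (rule iE[of W b B "\<lambda>z. \<alpha> (snd z)", OF Wm bm e1 B e6])
      (use \<alpha>i in \<open>auto intro!: P.integrable_pair_mult simp: emeasure_lborel_Icc_eq\<close>)
  have J4: "integrable ?E (\<lambda>z. ?\<chi> (fst z) * (a (fst z) (snd z) \<bullet> w' (fst z) (snd z)))"
    by (rule iE[of a w' "B * T" "\<lambda>z. norm (a (fst z) (snd z))", OF am wm e5])
      (use integrable_norm[OF ai] B T in auto)
  have "(\<integral>x. pT x \<bullet> w T x \<partial>M) = (\<integral>x. \<integral>s. ?\<chi> s * (pT x \<bullet> b s x) \<partial>lborel \<partial>M)"
  proof (rule integral_cong_AE)
    have "(\<lambda>x. (T, x)) \<in> M \<rightarrow>\<^sub>M ?E" by measurable
    from measurable_compose[OF this wm] have "(\<lambda>x. w' T x) \<in> borel_measurable M" by simp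
    moreover have "w T = w' T" using w[of T] T by (auto simp: w'_def)
    ultimately show "(\<lambda>x. pT x \<bullet> w T x) \<in> borel_measurable M" by simp
    show "(\<lambda>x. \<integral>s. ?\<chi> s * (pT x \<bullet> b s x) \<partial>lborel) \<in> borel_measurable M"
      using P.integrable_snd[of "\<lambda>s x. ?\<chi> s * (pT x \<bullet> b s x)"] J1 by (simp add: split_beta')
    show "AE x in M. pT x \<bullet> w T x = (\<integral>s. ?\<chi> s * (pT x \<bullet> b s x) \<partial>lborel)"
      using e3
    proof eventually_elim
      case (elim x)
      then have "(\<integral>s. pT x \<bullet> (?\<chi> s *\<^sub>R b s x) \<partial>lborel) = pT x \<bullet> (\<integral>s. ?\<chi> s *\<^sub>R b s x \<partial>lborel)"
        unfolding set_integrable_def by (intro integral_inner_right)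
      then show ?case using w[of T x] T by (simp add: set_lebesgue_integral_def)
    qed
  qed
  also have "\<dots> = (\<integral>z. ?\<chi> (fst z) * (pT (snd z) \<bullet> b (fst z) (snd z)) \<partial>?E)"
    using P.integral_snd[of "\<lambda>s x. ?\<chi> s * (pT x \<bullet> b s x)"] J1 by (simp add: split_beta')
  also have "\<dots> = (\<integral>z. ?\<chi> (fst z) * (p (fst z) (snd z) \<bullet> b (fst z) (snd z)) - ?\<chi> (fst z) * (W (fst z) (snd z) \<bullet> b (fst z) (snd z)) \<partial>?E)"
  proof (rule integral_cong_AE)
    show "AE z in ?E. ?\<chi> (fst z) * (pT (snd z) \<bullet> b (fst z) (snd z)) =
       ?\<chi> (fst z) * (p (fst z) (snd z) \<bullet> b (fst z) (snd z)) - ?\<chi> (fst z) * (W (fst z) (snd z) \<bullet> b (fst z) (snd z))"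
      using e2 by eventually_elim (auto simp: indicator_def inner_add_left)
  qed (use J1 J2 J3 in auto)
  also have "\<dots> = (\<integral>z. ?\<chi> (fst z) * (p (fst z) (snd z) \<bullet> b (fst z) (snd z)) \<partial>?E) - (\<integral>z. ?\<chi> (fst z) * (W (fst z) (snd z) \<bullet> b (fst z) (snd z)) \<partial>?E)"
    by (rule Bochner_Integration.integral_diff[OF J2 J3])
  also have "(\<integral>z. ?\<chi> (fst z) * (W (fst z) (snd z) \<bullet> b (fst z) (snd z)) \<partial>?E) = (\<integral>x. \<integral>s. ?\<chi> s * (W s x \<bullet> b s x) \<partial>lborel \<partial>M)"
    using P.integral_snd[of "\<lambda>s x. ?\<chi> s * (W s x \<bullet> b s x)"] J3 by (simp add: split_beta')
  also have "\<dots> = (\<integral>x. \<integral>s. ?\<chi> s * (a s x \<bullet> w' s x) \<partial>lborel \<partial>M)"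
  proof (rule integral_cong_AE)
    show "AE x in M. (\<integral>s. ?\<chi> s * (W s x \<bullet> b s x) \<partial>lborel) = (\<integral>s. ?\<chi> s * (a s x \<bullet> w' s x) \<partial>lborel)"
      using e3 e4
    proof eventually_elim
      case (elim x)
      from set_integral_inner_parts[OF elim(2,1)] show ?case
        unfolding W_def w'_def set_lebesgue_integral_def[of lborel "{0..T}"] by simp
    qed
    show "(\<lambda>x. \<integral>s. ?\<chi> s * (W s x \<bullet> b s x) \<partial>lborel) \<in> borel_measurable M"
      using P.integrable_snd[of "\<lambda>s x. ?\<chi> s * (W s x \<bullet> b s x)"] J3 by (simp add: split_beta')
    show "(\<lambda>x. \<integral>s. ?\<chi> s * (a s x \<bullet> w' s x) \<partial>lborel) \<in> borel_measurable M"
      using P.integrable_snd[of "\<lambda>s x. ?\<chi> s * (a s x \<bullet> w' s x)"] J4 by (simp add: split_beta')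
  qed
  also have "\<dots> = (\<integral>z. ?\<chi> (fst z) * (a (fst z) (snd z) \<bullet> w' (fst z) (snd z)) \<partial>?E)"
    using P.integral_snd[of "\<lambda>s x. ?\<chi> s * (a s x \<bullet> w' s x)"] J4 by (simp add: split_beta')
  also have "(\<integral>z. ?\<chi> (fst z) * (p (fst z) (snd z) \<bullet> b (fst z) (snd z)) \<partial>?E) - \<dots> = 
     (\<integral>z. ?\<chi> (fst z) * (p (fst z) (snd z) \<bullet> b (fst z) (snd z)) - ?\<chi> (fst z) * (a (fst z) (snd z) \<bullet> w' (fst z) (snd z)) \<partial>?E)"
    by (rule Bochner_Integration.integral_diff[OF J2 J4, symmetric])
  also have "\<dots> = (\<integral>s. \<integral>x. ?\<chi> s * (p s x \<bullet> b s x) - ?\<chi> s * (a s x \<bullet> w' s x) \<partial>M \<partial>lborel)"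
    using P.integral_fst[of "\<lambda>s x. ?\<chi> s * (p s x \<bullet> b s x) - ?\<chi> s * (a s x \<bullet> w' s x)"] Bochner_Integration.integrable_diff[OF J2 J4]
    by (simp add: split_beta')
  finally have fin: "(\<integral>x. pT x \<bullet> w T x \<partial>M) = (\<integral>s. \<integral>x. ?\<chi> s * (p s x \<bullet> b s x) - ?\<chi> s * (a s x \<bullet> w' s x) \<partial>M \<partial>lborel)" .
  have cong: "(\<lambda>s. \<integral>x. ?\<chi> s * (p s x \<bullet> b s x) - ?\<chi> s * (a s x \<bullet> w' s x) \<partial>M)
      = (\<lambda>s. ?\<chi> s *\<^sub>R (\<integral>x. p s x \<bullet> b s x - a s x \<bullet> w s x \<partial>M))"
    using w by (auto simp: fun_eq_iff indicator_def w'_def)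
  show "(\<integral>x. pT x \<bullet> w T x \<partial>M) = (LINT t:{0..T}|lborel. (\<integral>x. p t x \<bullet> b t x - a t x \<bullet> w t x \<partial>M))"
    unfolding fin cong set_lebesgue_integral_def ..
  show "set_integrable lborel {0..T} (\<lambda>t. \<integral>x. p t x \<bullet> b t x - a t x \<bullet> w t x \<partial>M)"
    using P.integrable_fst[of "\<lambda>s x. ?\<chi> s * (p s x \<bullet> b s x) - ?\<chi> s * (a s x \<bullet> w' s x)"] Bochner_Integration.integrable_diff[OF J2 J4]
    unfolding set_integrable_def cong[symmetric] by (simp add: split_beta')
qed

section \<open>Adjoints, parity and uniform linearisation of the kernels\<close>

lemma inner_adjoint_blinfun:
  fixes A :: "'a::euclidean_space \<Rightarrow>\<^sub>L 'a"
  shows "adjoint (blinfun_apply A) v \<bullet> w = v \<bullet> blinfun_apply A w"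
  using adjoint_works[of "blinfun_apply A" w v] by (simp add: blinfun.bounded_linear_right bounded_linear.linear inner_commute)

lemma norm_adjoint_blinfun_le:
  fixes A :: "'a::euclidean_space \<Rightarrow>\<^sub>L 'a"
  shows "norm (adjoint (blinfun_apply A) v) \<le> norm A * norm v"
proof (cases "adjoint (blinfun_apply A) v = 0")
  case False
  let ?w = "adjoint (blinfun_apply A) v"
  have "norm ?w * norm ?w = v \<bullet> blinfun_apply A ?w"
    using inner_adjoint_blinfun[of A v ?w] by (simp add: dot_square_norm power2_eq_square)
  also have "\<dots> \<le> norm v * (norm A * norm ?w)"
    by (intro order_trans[OF norm_cauchy_schwarz] mult_left_mono norm_blinfun) auto
  finally have "norm ?w * norm ?w \<le> (norm A * norm v) * norm ?w" by (simp add: mult_ac)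
  then show ?thesis using False by simp
qed simp

lemma continuous_on_blinfun_family:
  fixes D :: "'a::euclidean_space \<Rightarrow> 'a \<Rightarrow>\<^sub>L 'a"
  assumes "continuous_on UNIV D"
  shows "continuous_on UNIV (\<lambda>z. D (fst z) (snd z))"
    and "continuous_on UNIV (\<lambda>z. adjoint (blinfun_apply (D (fst z))) (snd z))"
proof -
  have D: "continuous_on UNIV (\<lambda>z::'a \<times> 'a. D (fst z))"
    by (intro continuous_on_compose2[OF assms] continuous_intros) auto
  then show "continuous_on UNIV (\<lambda>z. D (fst z) (snd z))"
    by (intro continuous_intros)
  \<comment> \<open>In coordinates the adjoint is a polynomial expression in values of
    \<open>A\<close>, so its continuity reduces to that of evaluation.\<close>
  have "adjoint (blinfun_apply A) v = (\<Sum>b\<in>Basis. (v \<bullet> blinfun_apply A b) *\<^sub>R b)" for A :: "'a \<Rightarrow>\<^sub>L 'a" and v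
    unfolding inner_adjoint_blinfun[symmetric] by (rule euclidean_representation[symmetric])
  then show "continuous_on UNIV (\<lambda>z. adjoint (blinfun_apply (D (fst z))) (snd z))"
    using D by (simp only:) (intro continuous_intros)
qed

lemma borel_measurable_blinfun_family:
  fixes D :: "'a::euclidean_space \<Rightarrow> 'a \<Rightarrow>\<^sub>L 'a"
  assumes D: "continuous_on UNIV D" and [measurable]: "h \<in> borel_measurable M" "k \<in> borel_measurable M"
  shows "(\<lambda>x. D (h x) (k x)) \<in> borel_measurable M"
    and "(\<lambda>x. adjoint (blinfun_apply (D (h x))) (k x)) \<in> borel_measurable M"
proof -
  have m: "(\<lambda>x. (h x, k x)) \<in> borel_measurable M" by (rule borel_measurable_Pair) measurable
  show "(\<lambda>x. D (h x) (k x)) \<in> borel_measurable M"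
    using measurable_compose[OF m borel_measurable_continuous_onI[OF continuous_on_blinfun_family(1)[OF D]]] by simp
  show "(\<lambda>x. adjoint (blinfun_apply (D (h x))) (k x)) \<in> borel_measurable M"
    using measurable_compose[OF m borel_measurable_continuous_onI[OF continuous_on_blinfun_family(2)[OF D]]] by simp
qed

text \<open>Differentiate the oddness identity; the two signs from the inner and outer negation
  cancel.\<close>

lemma odd_derivative_even:
  fixes h :: "'a::euclidean_space \<Rightarrow> 'a" and Dh :: "'a \<Rightarrow> 'a \<Rightarrow>\<^sub>L 'a"
  assumes odd: "\<And>x. h (- x) = - h x" and d: "\<And>x. (h has_derivative blinfun_apply (Dh x)) (at x)"
  shows "Dh (- x) = Dh x"
proof -
  have "((\<lambda>x. h (- x)) has_derivative (\<lambda>v. Dh (- x) (- v))) (at x)"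
    by (rule has_derivative_compose[of uminus uminus x UNIV h]) (auto intro!: derivative_eq_intros d)
  then have "((\<lambda>x. - h (- x)) has_derivative (\<lambda>v. - Dh (- x) (- v))) (at x)"
    by (rule has_derivative_minus)
  then have "(h has_derivative blinfun_apply (Dh (- x))) (at x)"
    by (simp add: odd blinfun.minus_right)
  from has_derivative_unique[OF this d[of x]] show ?thesis by (simp add: blinfun_apply_inject)
qed

text \<open>The derivative is uniformly continuous on the compact ball of radius
  \<open>R + 1\<close>, which makes the first-order remainder uniform over base points of norm at
  most \<open>R\<close>.\<close>

lemma uniform_linear_approx:
  fixes h :: "'a::euclidean_space \<Rightarrow> 'a" and Dh :: "'a \<Rightarrow> 'a \<Rightarrow>\<^sub>L 'a"
  assumes d: "\<And>x. (h has_derivative blinfun_apply (Dh x)) (at x)" and c: "continuous_on UNIV Dh" and e: "0 < e"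
  obtains \<delta> where "0 < \<delta>" "\<And>a v. norm a \<le> R \<Longrightarrow> norm v \<le> \<delta> \<Longrightarrow> norm (h (a + v) - h a - Dh a v) \<le> e * norm v"
proof -
  have "uniformly_continuous_on (cball 0 (R + 1)) Dh"
    by (intro compact_uniformly_continuous continuous_on_subset[OF c]) auto
  then obtain \<delta>0 where \<delta>0: "0 < \<delta>0" "\<And>x x'. x \<in> cball 0 (R + 1) \<Longrightarrow> x' \<in> cball 0 (R + 1) \<Longrightarrow> dist x' x < \<delta>0 \<Longrightarrow> dist (Dh x') (Dh x) < e"
    using e unfolding uniformly_continuous_on_def by metis
  \<comment> \<open>The bound 1 keeps the segment inside the larger ball; the halving turns a
    non-strict distance bound into the strict one required.\<close>
  define \<delta> where "\<delta> = min (\<delta>0 / 2) 1"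
  show ?thesis
  proof (rule that[of \<delta>])
    show "0 < \<delta>" using \<delta>0 by (simp add: \<delta>_def)
    fix a v :: 'a assume a: "norm a \<le> R" and v: "norm v \<le> \<delta>"
    have "norm (h (a + v) - h a - Dh a ((a + v) - a)) \<le> norm ((a + v) - a) * e"
    proof (rule differentiable_bound_linearization[where S = "cball a \<delta>" and f' = "\<lambda>x. blinfun_apply (Dh x)"])
      show "a + t *\<^sub>R ((a + v) - a) \<in> cball a \<delta>" if "t \<in> {0..1}" for t
      proof -
        have "\<bar>t\<bar> * norm v \<le> 1 * \<delta>" using that v \<delta>0 by (intro mult_mono) (auto simp: \<delta>_def)
        then show ?thesis by (simp add: dist_norm)
      qed
      show "(h has_derivative blinfun_apply (Dh x)) (at x within cball a \<delta>)" for x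
        by (rule has_derivative_at_withinI[OF d])
      show "onorm (blinfun_apply (Dh x) - blinfun_apply (Dh a)) \<le> e" if x: "x \<in> cball a \<delta>" for x
      proof -
        have xa: "dist x a \<le> \<delta>" using x by (simp add: dist_commute)
        have "norm x \<le> norm a + dist x a" using norm_triangle_ineq[of "x - a" a] by (simp add: dist_norm)
        then have "norm x \<le> R + 1" using a xa by (simp add: \<delta>_def)
        moreover have "dist x a < \<delta>0" using xa \<delta>0(1) by (auto simp: \<delta>_def min_def split: if_splits)
        ultimately have "dist (Dh x) (Dh a) < e" using a by (intro \<delta>0(2)) auto
        then show ?thesis by (simp add: dist_norm norm_blinfun.rep_eq minus_blinfun.rep_eq fun_diff_def)
      qed
      show "a \<in> cball a \<delta>" using \<delta>0 by (simp add: \<delta>_def)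
    qed
    then show "norm (h (a + v) - h a - Dh a v) \<le> e * norm v" by (simp add: mult.commute)
  qed
qed

context splitting_model
begin

text \<open>The derivatives of \<open>Fop\<close> and \<open>Gop\<close> at the state \<open>(\<phi>, y)\<close> in the direction \<open>(w, \<eta>)\<close>.\<close>

definition linF :: "('a \<Rightarrow> 'a) \<Rightarrow> ('M::finite \<Rightarrow> 'a) \<Rightarrow> ('a \<Rightarrow> 'a) \<Rightarrow> ('M \<Rightarrow> 'a) \<Rightarrow> 'a \<Rightarrow> 'a" where
  "linF \<phi> y w \<eta> x = (\<integral>\<zeta>. DK (\<phi> \<zeta> - \<phi> x) (w \<zeta> - w x) \<partial>\<mu>0)
    + (1 / real CARD('M)) *\<^sub>R (\<Sum>m\<in>UNIV. Df (y m - \<phi> x) (\<eta> m - w x))"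

definition linG :: "('M::finite \<Rightarrow> 'a) \<Rightarrow> ('M \<Rightarrow> 'a) \<Rightarrow> 'M \<Rightarrow> 'a" where
  "linG y \<eta> m = (1 / real CARD('M)) *\<^sub>R (\<Sum>j\<in>UNIV. Dg (y j - y m) (\<eta> j - \<eta> m))"

lemmas DK_meas = borel_measurable_blinfun_family[OF DK_cont]
lemmas Df_meas = borel_measurable_blinfun_family[OF Df_cont]

text \<open>Exchange the two summation indices. Evenness of \<open>Dg\<close> makes the coefficients
  symmetric in the two agents, so the term in \<open>\<eta> j\<close> becomes one in
  \<open>\<eta> m\<close> with \<open>q j\<close> in place of \<open>q m\<close>.\<close>

lemma linear_duality_agents:
  fixes y \<eta> q :: "'M::finite \<Rightarrow> 'a"
  shows "(\<Sum>m\<in>UNIV. q m \<bullet> linG y \<eta> m)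
    = (\<Sum>m\<in>UNIV. ((1 / real CARD('M)) *\<^sub>R (\<Sum>j\<in>UNIV. adjoint (blinfun_apply (Dg (y j - y m))) (q j - q m))) \<bullet> \<eta> m)"
proof -
  have ev: "Dg (y j - y m) = Dg (y m - y j)" for j m
    using odd_derivative_even[of g Dg "y m - y j", OF g_odd g_deriv] by simp
  have "(\<Sum>m\<in>UNIV. \<Sum>j\<in>UNIV. q m \<bullet> Dg (y j - y m) (\<eta> j))
      = (\<Sum>j\<in>UNIV. \<Sum>m\<in>UNIV. q m \<bullet> Dg (y j - y m) (\<eta> j))"
    by (rule sum.swap)
  also have "\<dots> = (\<Sum>m\<in>UNIV. \<Sum>j\<in>UNIV. q j \<bullet> Dg (y j - y m) (\<eta> m))"
    by (intro sum.cong refl) (simp add: ev)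
  finally have sw: "(\<Sum>m\<in>UNIV. \<Sum>j\<in>UNIV. q m \<bullet> Dg (y j - y m) (\<eta> j)) =
     (\<Sum>m\<in>UNIV. \<Sum>j\<in>UNIV. q j \<bullet> Dg (y j - y m) (\<eta> m))" .
  have "(\<Sum>m\<in>UNIV. q m \<bullet> linG y \<eta> m) = (1 / real CARD('M)) *
     ((\<Sum>m\<in>UNIV. \<Sum>j\<in>UNIV. q m \<bullet> Dg (y j - y m) (\<eta> j)) - (\<Sum>m\<in>UNIV. \<Sum>j\<in>UNIV. q m \<bullet> Dg (y j - y m) (\<eta> m)))"
    by (simp add: linG_def inner_sum_right blinfun.diff_right inner_diff_right sum_subtractf flip: sum_divide_distrib)
  also have "\<dots> = (\<Sum>m\<in>UNIV. ((1 / real CARD('M)) *\<^sub>R (\<Sum>j\<in>UNIV. adjoint (blinfun_apply (Dg (y j - y m))) (q j - q m))) \<bullet> \<eta> m)"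
    unfolding sw
    by (simp add: inner_sum_left inner_adjoint_blinfun inner_diff_left sum_subtractf flip: sum_divide_distrib)
  finally show ?thesis .
qed

text \<open>At a fixed time the adjoint right sides are the transpose of the linearised dynamics.
  The nonlocal interaction is transposed by Fubini, for which integrability of \<open>p\<close> and
  boundedness of \<open>w\<close> on \<open>C\<close> suffice; the local terms are transposed
  pointwise.\<close>

lemma linear_duality:
  fixes y \<eta> q :: "'M::finite \<Rightarrow> 'a" and p \<phi> w :: "'a \<Rightarrow> 'a"
  assumes \<phi>: "\<phi> \<in> borel_measurable borel" and w: "w \<in> borel_measurable borel" "bounded (w ` C)"
    and p: "integrable \<mu>0 p"
  shows "integrable \<mu>0 (\<lambda>x. p x \<bullet> linF \<phi> y w \<eta> x)" 
    and "integrable \<mu>0 (\<lambda>x. adj_p_rhs \<mu>0 DK Df (\<lambda>_. \<phi>) (\<lambda>_. y) (\<lambda>_. p) t x \<bullet> w x)"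
    and "(\<integral>x. p x \<bullet> linF \<phi> y w \<eta> x \<partial>\<mu>0) + (\<Sum>m\<in>UNIV. q m \<bullet> linG y \<eta> m)
      = (\<integral>x. adj_p_rhs \<mu>0 DK Df (\<lambda>_. \<phi>) (\<lambda>_. y) (\<lambda>_. p) t x \<bullet> w x \<partial>\<mu>0)
        + (\<Sum>m\<in>UNIV. adj_q_rhs \<mu>0 Df Dg (\<lambda>_. \<phi>) (\<lambda>_. y) (\<lambda>_. p) (\<lambda>_. q) t m \<bullet> \<eta> m)"
proof -
  note [measurable] = borel_measurable_mu0[OF \<phi>] borel_measurable_mu0[OF w(1)] borel_measurable_integrable[OF p] DK_meas Df_meas
  interpret P: pair_sigma_finite \<mu>0 \<mu>0 ..
  let ?E = "\<mu>0 \<Otimes>\<^sub>M \<mu>0"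
  let ?M = "real CARD('M)"
  obtain B where B: "AE \<zeta> in \<mu>0. norm (w \<zeta>) \<le> B" using AE_bounded_image[OF w(2)] .
  define A where "A x \<zeta> = DK (\<phi> \<zeta> - \<phi> x)" for x \<zeta>
  have A_sym: "A x \<zeta> = A \<zeta> x" for x \<zeta>
    unfolding A_def using odd_derivative_even[of K DK "\<phi> x - \<phi> \<zeta>", OF K_odd K_deriv] by simp
  have D_le: "\<bar>u \<bullet> blinfun_apply D v\<bar> \<le> L * (norm u * norm v)" if "norm D \<le> L" for D :: "'a \<Rightarrow>\<^sub>L 'a" and u v
  proof -
    have "\<bar>u \<bullet> blinfun_apply D v\<bar> \<le> norm u * (norm D * norm v)"
      by (intro order_trans[OF Cauchy_Schwarz_ineq2] mult_left_mono norm_blinfun) auto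
    also have "\<dots> \<le> norm u * (L * norm v)" using that by (intro mult_left_mono mult_right_mono) auto
    finally show ?thesis by (simp add: mult_ac)
  qed
  \<comment> \<open>\<open>H1\<close> and \<open>H2\<close> agree after exchanging the variables because \<open>DK\<close> is even\<close>
  define H1 where "H1 = (\<lambda>x \<zeta>. p x \<bullet> A x \<zeta> (w \<zeta>))"
  define H2 where "H2 = (\<lambda>x \<zeta>. p \<zeta> \<bullet> A x \<zeta> (w x))"
  have np: "integrable \<mu>0 (\<lambda>x. norm (p x))" using p by (rule integrable_norm)
  have H1i: "integrable ?E (\<lambda>(x, \<zeta>). H1 x \<zeta>)"
  proof (rule Bochner_Integration.integrable_bound)
    show "integrable ?E (\<lambda>z. norm (p (fst z)) * (L * B))"
      using P.integrable_pair_mult[OF np, of "\<lambda>_. L * B"] by simp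
    show "(\<lambda>(x, \<zeta>). H1 x \<zeta>) \<in> borel_measurable ?E" unfolding H1_def A_def by measurable
    have "AE z in ?E. norm (w (snd z)) \<le> B"
      using B by (intro P.AE_pair_measure) auto
    then show "AE z in ?E. norm (case z of (x, \<zeta>) \<Rightarrow> H1 x \<zeta>) \<le> norm (norm (p (fst z)) * (L * B))"
    proof eventually_elim
      case (elim z)
      have "\<bar>H1 (fst z) (snd z)\<bar> \<le> L * (norm (p (fst z)) * norm (w (snd z)))"
        unfolding H1_def A_def by (rule D_le[OF DK_le])
      also have "\<dots> \<le> L * (norm (p (fst z)) * B)" using elim L_pos by (intro mult_left_mono) auto
      also have "\<dots> \<le> \<bar>norm (p (fst z)) * (L * B)\<bar>" by (simp add: mult_ac)
      finally show ?case by (simp add: split_beta)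
    qed
  qed
  have sw: "H2 x \<zeta> = H1 \<zeta> x" for x \<zeta> unfolding H1_def H2_def by (simp add: A_sym)
  have H2i: "integrable ?E (\<lambda>(x, \<zeta>). H2 x \<zeta>)"
    using P.integrable_product_swap[OF H1i] by (simp add: sw split_beta')
  have H12: "(\<integral>x. \<integral>\<zeta>. H1 x \<zeta> \<partial>\<mu>0 \<partial>\<mu>0) = (\<integral>x. \<integral>\<zeta>. H2 x \<zeta> \<partial>\<mu>0 \<partial>\<mu>0)"
    unfolding sw by (rule P.Fubini_integral[OF H1i, symmetric])
  have iA: "integrable \<mu>0 (\<lambda>\<zeta>. A x \<zeta> (v \<zeta>))" 
    if [measurable]: "v \<in> borel_measurable \<mu>0" and vB: "AE \<zeta> in \<mu>0. norm (v \<zeta>) \<le> B'" for v x B'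
  proof (rule integrable_const_bound)
    show "AE \<zeta> in \<mu>0. norm (A x \<zeta> (v \<zeta>)) \<le> L * B'"
      using vB
    proof eventually_elim
      case (elim \<zeta>)
      have "norm (A x \<zeta> (v \<zeta>)) \<le> norm (A x \<zeta>) * norm (v \<zeta>)" by (rule norm_blinfun)
      also have "\<dots> \<le> L * B'" using elim DK_le L_pos by (intro mult_mono) (auto simp: A_def)
      finally show ?case .
    qed
  qed (unfold A_def, measurable)
  have iadj: "integrable \<mu>0 (\<lambda>\<zeta>. adjoint (blinfun_apply (A x \<zeta>)) (v \<zeta>))"
    if v: "integrable \<mu>0 v" for v :: "'a \<Rightarrow> 'a" and x
  proof (rule Bochner_Integration.integrable_bound)
    note [measurable] = borel_measurable_integrable[OF v]
    show "integrable \<mu>0 (\<lambda>\<zeta>. L * norm (v \<zeta>))" using v by simp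
    show "AE \<zeta> in \<mu>0. norm (adjoint (blinfun_apply (A x \<zeta>)) (v \<zeta>)) \<le> norm (L * norm (v \<zeta>))"
    proof (rule AE_I2)
      fix \<zeta>
      have "norm (adjoint (blinfun_apply (A x \<zeta>)) (v \<zeta>)) \<le> norm (A x \<zeta>) * norm (v \<zeta>)" by (rule norm_adjoint_blinfun_le)
      also have "\<dots> \<le> L * norm (v \<zeta>)" using DK_le by (intro mult_right_mono) (auto simp: A_def)
      finally show "norm (adjoint (blinfun_apply (A x \<zeta>)) (v \<zeta>)) \<le> norm (L * norm (v \<zeta>))" using L_pos by simp
    qed
    show "(\<lambda>\<zeta>. adjoint (blinfun_apply (A x \<zeta>)) (v \<zeta>)) \<in> borel_measurable \<mu>0" unfolding A_def by measurable
  qed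
  \<comment> \<open>\<open>k2\<close> and \<open>k3\<close> are the local terms caused by moving the
    base point and occur alike on both sides. \<open>k4\<close>, the response to moving the agents,
    is matched by the part of \<open>adj_q_rhs\<close> containing \<open>p\<close>.\<close>
  define k2 where "k2 x = (\<integral>\<zeta>. p x \<bullet> A x \<zeta> (w x) \<partial>\<mu>0)" for x
  define k3 where "k3 m x = p x \<bullet> Df (y m - \<phi> x) (w x)" for m x
  define k4 where "k4 m x = p x \<bullet> Df (y m - \<phi> x) (\<eta> m)" for m x
  have k34: "integrable \<mu>0 (\<lambda>x. p x \<bullet> Df (y m - \<phi> x) (v x))" 
    if [measurable]: "v \<in> borel_measurable \<mu>0" and vB: "AE \<zeta> in \<mu>0. norm (v \<zeta>) \<le> B'" for v m B'
  proof (rule Bochner_Integration.integrable_bound)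
    show "integrable \<mu>0 (\<lambda>x. L * (norm (p x) * B'))" using np by simp
    show "AE x in \<mu>0. norm (p x \<bullet> Df (y m - \<phi> x) (v x)) \<le> norm (L * (norm (p x) * B'))"
      using vB
    proof eventually_elim
      case (elim x)
      have "\<bar>p x \<bullet> Df (y m - \<phi> x) (v x)\<bar> \<le> L * (norm (p x) * norm (v x))" by (rule D_le[OF Df_le])
      also have "\<dots> \<le> L * (norm (p x) * B')" using elim L_pos by (intro mult_left_mono) auto
      finally show ?case by simp
    qed
  qed measurable
  have k3i: "integrable \<mu>0 (k3 m)" for m unfolding k3_def using B by (intro k34) auto
  have k4i: "integrable \<mu>0 (k4 m)" for m unfolding k4_def using k34[of "\<lambda>_. \<eta> m" "norm (\<eta> m)" m] by simp
  have k2i: "integrable \<mu>0 k2"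
  proof (rule Bochner_Integration.integrable_bound)
    show "integrable \<mu>0 (\<lambda>x. L * (norm (p x) * B))" using np by simp
    show "k2 \<in> borel_measurable \<mu>0" unfolding k2_def[abs_def] A_def by measurable
    show "AE x in \<mu>0. norm (k2 x) \<le> norm (L * (norm (p x) * B))"
      using B
    proof eventually_elim
      case (elim x)
      have "norm (k2 x) \<le> (\<integral>\<zeta>. L * (norm (p x) * norm (w x)) \<partial>\<mu>0)"
        unfolding k2_def using D_le[OF DK_le] iA[of "\<lambda>_. w x" "norm (w x)" x]
        by (intro Bochner_Integration.integral_norm_bound_integral) (auto simp: A_def)
      also have "\<dots> \<le> L * (norm (p x) * B)" using elim L_pos by (auto intro!: mult_left_mono)
      finally show ?case by simp
    qed
  qed
  have H1i': "integrable \<mu>0 (\<lambda>x. \<integral>\<zeta>. H1 x \<zeta> \<partial>\<mu>0)" by (rule P.integrable_fst[OF H1i])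
  have H2i': "integrable \<mu>0 (\<lambda>x. \<integral>\<zeta>. H2 x \<zeta> \<partial>\<mu>0)" by (rule P.integrable_fst[OF H2i])
  have e1: "p x \<bullet> linF \<phi> y w \<eta> x = (\<integral>\<zeta>. H1 x \<zeta> \<partial>\<mu>0) - k2 x + (1 / ?M) * ((\<Sum>m\<in>UNIV. k4 m x) - (\<Sum>m\<in>UNIV. k3 m x))" for x
  proof -
    have i: "integrable \<mu>0 (\<lambda>\<zeta>. A x \<zeta> (w \<zeta>))" "integrable \<mu>0 (\<lambda>\<zeta>. A x \<zeta> (w x))"
      using B iA[of w B x] iA[of "\<lambda>_. w x" "norm (w x)" x] by auto
    have "(\<integral>\<zeta>. A x \<zeta> (w \<zeta> - w x) \<partial>\<mu>0) = (\<integral>\<zeta>. A x \<zeta> (w \<zeta>) \<partial>\<mu>0) - (\<integral>\<zeta>. A x \<zeta> (w x) \<partial>\<mu>0)"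
      using i by (simp add: blinfun.diff_right)
    then have "p x \<bullet> (\<integral>\<zeta>. A x \<zeta> (w \<zeta> - w x) \<partial>\<mu>0) = (\<integral>\<zeta>. H1 x \<zeta> \<partial>\<mu>0) - k2 x"
      using i by (simp add: H1_def k2_def inner_diff_right)
    then show ?thesis
      by (simp add: linF_def A_def k3_def k4_def inner_add_right inner_sum_right blinfun.diff_right inner_diff_right sum_subtractf flip: sum_divide_distrib)
  qed
  have e2: "adj_p_rhs \<mu>0 DK Df (\<lambda>_. \<phi>) (\<lambda>_. y) (\<lambda>_. p) t x \<bullet> w x
      = - k2 x - (1 / ?M) * (\<Sum>m\<in>UNIV. k3 m x) + (\<integral>\<zeta>. H2 x \<zeta> \<partial>\<mu>0)" for x
  proof -
    have d: "(\<integral>\<zeta>. adjoint (blinfun_apply (DK (\<zeta> - \<phi> x))) (p x) \<partial>(distr \<mu>0 borel \<phi>)) = (\<integral>\<zeta>. adjoint (blinfun_apply (A x \<zeta>)) (p x) \<partial>\<mu>0)"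
      unfolding A_def by (rule integral_distr) measurable
    have "(\<integral>\<zeta>. adjoint (blinfun_apply (A x \<zeta>)) (p x) \<partial>\<mu>0) \<bullet> w x = k2 x"
      unfolding k2_def using iadj[of "\<lambda>_. p x" x] by (simp add: inner_adjoint_blinfun flip: integral_inner_left)
    moreover have "(\<integral>\<zeta>. adjoint (blinfun_apply (A x \<zeta>)) (p \<zeta>) \<partial>\<mu>0) \<bullet> w x = (\<integral>\<zeta>. H2 x \<zeta> \<partial>\<mu>0)"
      unfolding H2_def using iadj[OF p, of x] by (simp add: inner_adjoint_blinfun flip: integral_inner_left)
    ultimately show ?thesis
      unfolding adj_p_rhs_def d
      by (simp add: A_def[symmetric] k3_def inner_add_left inner_diff_left inner_sum_left inner_adjoint_blinfun flip: sum_divide_distrib)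
  qed
  have e3: "((1 / ?M) *\<^sub>R (\<integral>\<zeta>. adjoint (blinfun_apply (Df (y m - \<phi> \<zeta>))) (p \<zeta>) \<partial>\<mu>0)) \<bullet> \<eta> m = (1 / ?M) * (\<integral>x. k4 m x \<partial>\<mu>0)" for m
  proof -
    have "integrable \<mu>0 (\<lambda>\<zeta>. adjoint (blinfun_apply (Df (y m - \<phi> \<zeta>))) (p \<zeta>))"
    proof (rule Bochner_Integration.integrable_bound)
      show "integrable \<mu>0 (\<lambda>\<zeta>. L * norm (p \<zeta>))" using np by simp
      show "AE \<zeta> in \<mu>0. norm (adjoint (blinfun_apply (Df (y m - \<phi> \<zeta>))) (p \<zeta>)) \<le> norm (L * norm (p \<zeta>))"
      proof (rule AE_I2)
        fix \<zeta>
        have "norm (adjoint (blinfun_apply (Df (y m - \<phi> \<zeta>))) (p \<zeta>)) \<le> norm (Df (y m - \<phi> \<zeta>)) * norm (p \<zeta>)" by (rule norm_adjoint_blinfun_le)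
        also have "\<dots> \<le> L * norm (p \<zeta>)" using Df_le by (intro mult_right_mono) auto
        finally show "norm (adjoint (blinfun_apply (Df (y m - \<phi> \<zeta>))) (p \<zeta>)) \<le> norm (L * norm (p \<zeta>))" using L_pos by simp
      qed
    qed measurable
    then show ?thesis unfolding k4_def by (simp add: inner_adjoint_blinfun flip: integral_inner_left)
  qed
  show "integrable \<mu>0 (\<lambda>x. p x \<bullet> linF \<phi> y w \<eta> x)" unfolding e1 using H1i' k2i k3i k4i by auto
  show "integrable \<mu>0 (\<lambda>x. adj_p_rhs \<mu>0 DK Df (\<lambda>_. \<phi>) (\<lambda>_. y) (\<lambda>_. p) t x \<bullet> w x)" unfolding e2 using H2i' k2i k3i by auto
  have "(\<integral>x. p x \<bullet> linF \<phi> y w \<eta> x \<partial>\<mu>0) = (\<integral>x. \<integral>\<zeta>. H1 x \<zeta> \<partial>\<mu>0 \<partial>\<mu>0) - (\<integral>x. k2 x \<partial>\<mu>0)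
      + (1 / ?M) * ((\<Sum>m\<in>UNIV. \<integral>x. k4 m x \<partial>\<mu>0) - (\<Sum>m\<in>UNIV. \<integral>x. k3 m x \<partial>\<mu>0))"
    unfolding e1 using H1i' k2i k3i k4i by simp
  moreover have "(\<integral>x. adj_p_rhs \<mu>0 DK Df (\<lambda>_. \<phi>) (\<lambda>_. y) (\<lambda>_. p) t x \<bullet> w x \<partial>\<mu>0)
      = - (\<integral>x. k2 x \<partial>\<mu>0) - (1 / ?M) * (\<Sum>m\<in>UNIV. \<integral>x. k3 m x \<partial>\<mu>0) + (\<integral>x. \<integral>\<zeta>. H2 x \<zeta> \<partial>\<mu>0 \<partial>\<mu>0)"
    unfolding e2 using H2i' k2i k3i by simp
  moreover have "(\<Sum>m\<in>UNIV. adj_q_rhs \<mu>0 Df Dg (\<lambda>_. \<phi>) (\<lambda>_. y) (\<lambda>_. p) (\<lambda>_. q) t m \<bullet> \<eta> m)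
      = (1 / ?M) * (\<Sum>m\<in>UNIV. \<integral>x. k4 m x \<partial>\<mu>0) + (\<Sum>m\<in>UNIV. q m \<bullet> linG y \<eta> m)"
    unfolding adj_q_rhs_def inner_add_left e3 linear_duality_agents sum.distrib sum_distrib_left ..
  ultimately show "(\<integral>x. p x \<bullet> linF \<phi> y w \<eta> x \<partial>\<mu>0) + (\<Sum>m\<in>UNIV. q m \<bullet> linG y \<eta> m)
      = (\<integral>x. adj_p_rhs \<mu>0 DK Df (\<lambda>_. \<phi>) (\<lambda>_. y) (\<lambda>_. p) t x \<bullet> w x \<partial>\<mu>0)
        + (\<Sum>m\<in>UNIV. adj_q_rhs \<mu>0 Df Dg (\<lambda>_. \<phi>) (\<lambda>_. y) (\<lambda>_. p) (\<lambda>_. q) t m \<bullet> \<eta> m)"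
    using H12 by (simp add: algebra_simps)
qed

end

section \<open>Linearisation errors and the first-variation estimate\<close>

lemma set_integrable_inner_continuous:
  fixes h k :: "real \<Rightarrow> 'b::euclidean_space"
  assumes h: "continuous_on {a..b} h" and k: "set_integrable lborel {a..b} k"
  shows "set_integrable lborel {a..b} (\<lambda>t. h t \<bullet> k t)"
proof -
  obtain B where B: "\<And>t. t \<in> {a..b} \<Longrightarrow> norm (h t) \<le> B"
    using compact_imp_bounded[OF compact_continuous_image[OF h compact_Icc]] unfolding bounded_iff by blast
  have hm: "(\<lambda>t. indicator {a..b} t *\<^sub>R h t) \<in> borel_measurable lborel"
    using borel_measurable_continuous_on_indicator[OF _ h] by simp
  have km: "(\<lambda>t. indicator {a..b} t *\<^sub>R k t) \<in> borel_measurable lborel"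
    using k unfolding set_integrable_def by (rule borel_measurable_integrable)
  show ?thesis
    unfolding set_integrable_def
  proof (rule Bochner_Integration.integrable_bound)
    show "integrable lborel (\<lambda>t. B * norm (indicator {a..b} t *\<^sub>R k t))"
      using k unfolding set_integrable_def by (intro integrable_mult_right integrable_norm)
    have "(\<lambda>t. indicator {a..b} t *\<^sub>R (h t \<bullet> k t)) = (\<lambda>t. (indicator {a..b} t *\<^sub>R h t) \<bullet> (indicator {a..b} t *\<^sub>R k t))"
      by (auto simp: indicator_def fun_eq_iff)
    then show "(\<lambda>t. indicator {a..b} t *\<^sub>R (h t \<bullet> k t)) \<in> borel_measurable lborel"
      using borel_measurable_inner[OF hm km] by simp
    have "\<bar>h t \<bullet> k t\<bar> \<le> \<bar>B * norm (k t)\<bar>" if "t \<in> {a..b}" for t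
    proof -
      have "\<bar>h t \<bullet> k t\<bar> \<le> norm (h t) * norm (k t)" by (rule Cauchy_Schwarz_ineq2)
      also have "\<dots> \<le> B * norm (k t)" using B[OF that] by (intro mult_right_mono) auto
      finally show ?thesis by linarith
    qed
    then show "AE t in lborel. norm (indicator {a..b} t *\<^sub>R (h t \<bullet> k t)) \<le> norm (B * norm (indicator {a..b} t *\<^sub>R k t))"
      by (intro AE_I2) (simp add: indicator_def)
  qed
qed

context splitting_model
begin

lemma DK_norm_le: "norm (DK a v) \<le> L * norm v"
  by (rule order_trans[OF norm_blinfun mult_right_mono[OF DK_le norm_ge_zero]])

lemma linF_meas:
  assumes [measurable]: "\<phi> \<in> borel_measurable borel" "w \<in> borel_measurable borel"
  shows "linF \<phi> y w \<eta> \<in> borel_measurable \<mu>0"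
proof -
  note [measurable] = borel_measurable_mu0[OF assms(1)] borel_measurable_mu0[OF assms(2)] DK_meas Df_meas
  show ?thesis unfolding linF_def[abs_def] by measurable
qed

text \<open>A kernel argument is a difference of two positions: two norms of at most
  \<open>R / 2\<close> give base points of norm at most \<open>R\<close>, and two displacements of
  at most \<open>B\<close> give increments of at most \<open>2 * B\<close>. The interaction and
  agent terms each contribute \<open>e * (2 * B)\<close>.\<close>

lemma Fop_linearization:
  fixes y y' :: "'M::finite \<Rightarrow> 'a"
  assumes \<phi>: "\<phi> \<in> borel_measurable borel" and \<phi>': "\<phi>' \<in> borel_measurable borel"
    and w: "\<And>\<zeta>. \<zeta> \<in> C \<Longrightarrow> norm (\<phi>' \<zeta> - \<phi> \<zeta>) \<le> B" and \<eta>: "\<And>m. norm (y' m - y m) \<le> B"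
    and R: "\<And>\<zeta>. \<zeta> \<in> C \<Longrightarrow> norm (\<phi> \<zeta>) \<le> R / 2" "\<And>m. norm (y m) \<le> R / 2"
    and e: "0 \<le> e"
    and Ka: "\<And>a v. norm a \<le> R \<Longrightarrow> norm v \<le> 2 * B \<Longrightarrow> norm (K (a + v) - K a - DK a v) \<le> e * norm v"
    and fa: "\<And>a v. norm a \<le> R \<Longrightarrow> norm v \<le> 2 * B \<Longrightarrow> norm (f (a + v) - f a - Df a v) \<le> e * norm v"
    and x: "x \<in> C"
  shows "norm (Fop K f (distr \<mu>0 borel \<phi>') (\<phi>' x) y' - Fop K f (distr \<mu>0 borel \<phi>) (\<phi> x) y
      - linF \<phi> y (\<lambda>x. \<phi>' x - \<phi> x) (\<lambda>m. y' m - y m) x) \<le> 4 * e * B"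
proof -
  let ?w = "\<lambda>x. \<phi>' x - \<phi> x" and ?\<eta> = "\<lambda>m. y' m - y m"
  have b\<phi>: "bounded (\<phi> ` C)" using R(1) unfolding bounded_iff by blast
  have b\<phi>': "bounded (\<phi>' ` C)"
  proof -
    have "norm (\<phi>' \<zeta>) \<le> B + R / 2" if "\<zeta> \<in> C" for \<zeta>
      using norm_triangle_ineq[of "\<phi>' \<zeta> - \<phi> \<zeta>" "\<phi> \<zeta>"] w[OF that] R(1)[OF that] by simp
    then show ?thesis unfolding bounded_iff by blast
  qed
  have rem: "norm (h (a' - b') - h (a - b) - D (a - b) ((a' - a) - (b' - b))) \<le> e * (2 * B)"
    if h: "\<And>a v. norm a \<le> R \<Longrightarrow> norm v \<le> 2 * B \<Longrightarrow> norm (h (a + v) - h a - D a v) \<le> e * norm v"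
      and n: "norm (a' - a) \<le> B" "norm (b' - b) \<le> B" "norm a \<le> R / 2" "norm b \<le> R / 2"
    for h :: "'a \<Rightarrow> 'a" and D :: "'a \<Rightarrow> 'a \<Rightarrow>\<^sub>L 'a" and a' a b' b
  proof -
    have v: "norm ((a' - a) - (b' - b)) \<le> 2 * B" using norm_triangle_ineq4[of "a' - a" "b' - b"] n by linarith
    have "norm (a - b) \<le> R" using norm_triangle_ineq4[of a b] n by linarith
    from h[OF this v] have "norm (h (a' - b') - h (a - b) - D (a - b) ((a' - a) - (b' - b))) \<le> e * norm ((a' - a) - (b' - b))"
      by (simp add: algebra_simps)
    also have "\<dots> \<le> e * (2 * B)" using v e by (rule mult_left_mono)
    finally show ?thesis .
  qed
  note [measurable] = borel_measurable_mu0[OF \<phi>] borel_measurable_mu0[OF \<phi>'] DK_meas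
  have iK: "integrable \<mu>0 (\<lambda>\<zeta>. K (\<phi> \<zeta> - \<phi> x))" "integrable \<mu>0 (\<lambda>\<zeta>. K (\<phi>' \<zeta> - \<phi>' x))"
    by (auto intro!: integrable_K \<phi> \<phi>' b\<phi> b\<phi>')
  have iD: "integrable \<mu>0 (\<lambda>\<zeta>. DK (\<phi> \<zeta> - \<phi> x) (?w \<zeta> - ?w x))"
  proof (rule integrable_const_bound)
    show "AE \<zeta> in \<mu>0. norm (DK (\<phi> \<zeta> - \<phi> x) (?w \<zeta> - ?w x)) \<le> L * (B + B)"
      using AE_C
    proof eventually_elim
      case (elim \<zeta>)
      have "norm (?w \<zeta> - ?w x) \<le> B + B" using norm_triangle_ineq4[of "?w \<zeta>" "?w x"] w[OF elim] w[OF x] by linarith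
      then show ?case using L_pos by (intro order_trans[OF DK_norm_le] mult_left_mono) auto
    qed
  qed measurable
  have 1: "norm (\<integral>\<zeta>. K (\<phi>' \<zeta> - \<phi>' x) - K (\<phi> \<zeta> - \<phi> x) - DK (\<phi> \<zeta> - \<phi> x) (?w \<zeta> - ?w x) \<partial>\<mu>0) \<le> e * (2 * B)"
  proof -
    have "norm (\<integral>\<zeta>. K (\<phi>' \<zeta> - \<phi>' x) - K (\<phi> \<zeta> - \<phi> x) - DK (\<phi> \<zeta> - \<phi> x) (?w \<zeta> - ?w x) \<partial>\<mu>0)
      \<le> (\<integral>\<zeta>. norm (K (\<phi>' \<zeta> - \<phi>' x) - K (\<phi> \<zeta> - \<phi> x) - DK (\<phi> \<zeta> - \<phi> x) (?w \<zeta> - ?w x)) \<partial>\<mu>0)"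
      by (rule integral_norm_bound)
    also have "\<dots> \<le> (\<integral>\<zeta>. e * (2 * B) \<partial>\<mu>0)"
    proof (rule integral_mono_AE)
      show "AE \<zeta> in \<mu>0. norm (K (\<phi>' \<zeta> - \<phi>' x) - K (\<phi> \<zeta> - \<phi> x) - DK (\<phi> \<zeta> - \<phi> x) (?w \<zeta> - ?w x)) \<le> e * (2 * B)"
        using AE_C by eventually_elim (intro rem[of K DK] Ka w R x)
    qed (use iK iD in auto)
    finally show ?thesis by simp
  qed
  have 2: "norm ((1 / real CARD('M)) *\<^sub>R (\<Sum>m\<in>UNIV. f (y' m - \<phi>' x) - f (y m - \<phi> x) - Df (y m - \<phi> x) (?\<eta> m - ?w x))) \<le> e * (2 * B)"
    by (intro norm_average_le rem[of f Df] fa \<eta> w R x)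
  have "Fop K f (distr \<mu>0 borel \<phi>') (\<phi>' x) y' - Fop K f (distr \<mu>0 borel \<phi>) (\<phi> x) y - linF \<phi> y ?w ?\<eta> x
     = (\<integral>\<zeta>. K (\<phi>' \<zeta> - \<phi>' x) - K (\<phi> \<zeta> - \<phi> x) - DK (\<phi> \<zeta> - \<phi> x) (?w \<zeta> - ?w x) \<partial>\<mu>0)
     + (1 / real CARD('M)) *\<^sub>R (\<Sum>m\<in>UNIV. f (y' m - \<phi>' x) - f (y m - \<phi> x) - Df (y m - \<phi> x) (?\<eta> m - ?w x))"
    unfolding Fop_distr[OF \<phi>] Fop_distr[OF \<phi>'] linF_def
    using iK iD by (simp add: sum_subtractf scaleR_diff_right)
  also have "norm \<dots> \<le> e * (2 * B) + e * (2 * B)" using 1 2 by (rule norm_triangle_mono)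
  finally show ?thesis by (simp add: algebra_simps)
qed

lemma Gop_linearization:
  fixes y y' :: "'M::finite \<Rightarrow> 'a"
  assumes \<eta>: "\<And>m. norm (y' m - y m) \<le> B" and R: "\<And>m. norm (y m) \<le> R / 2" and e: "0 \<le> e"
    and ga: "\<And>a v. norm a \<le> R \<Longrightarrow> norm v \<le> 2 * B \<Longrightarrow> norm (g (a + v) - g a - Dg a v) \<le> e * norm v"
  shows "norm (Gop g y' m - Gop g y m - linG y (\<lambda>m. y' m - y m) m) \<le> 2 * e * B"
proof -
  have "Gop g y' m - Gop g y m - linG y (\<lambda>m. y' m - y m) m = (1 / real CARD('M)) *\<^sub>R
     (\<Sum>j\<in>UNIV. g (y' j - y' m) - g (y j - y m) - Dg (y j - y m) ((y' j - y j) - (y' m - y m)))"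
    by (simp add: Gop_def linG_def sum_subtractf scaleR_diff_right)
  also have "norm \<dots> \<le> e * (2 * B)"
  proof (rule norm_average_le)
    fix j
    let ?v = "(y' j - y j) - (y' m - y m)"
    have v: "norm ?v \<le> 2 * B" using norm_triangle_ineq4[of "y' j - y j" "y' m - y m"] \<eta>[of j] \<eta>[of m] by linarith
    have "norm (y j - y m) \<le> R" using norm_triangle_ineq4[of "y j" "y m"] R[of j] R[of m] by linarith
    from ga[OF this v] have "norm (g (y' j - y' m) - g (y j - y m) - blinfun_apply (Dg (y j - y m)) ?v) \<le> e * norm ?v"
      by (simp add: algebra_simps)
    also have "\<dots> \<le> e * (2 * B)" using v e by (rule mult_left_mono)
    finally show "norm (g (y' j - y' m) - g (y j - y m) - blinfun_apply (Dg (y j - y m)) ?v) \<le> e * (2 * B)" .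
  qed
  finally show ?thesis by simp
qed

lemma adjoint_clamp_meas:
  fixes p :: "real \<Rightarrow> 'a \<Rightarrow> 'a"
  assumes p: "(\<lambda>(t, x). p t x) \<in> borel_measurable (restrict_space lborel {0..T} \<Otimes>\<^sub>M \<mu>0)"
    and [measurable]: "h \<in> borel_measurable N" "k \<in> borel_measurable N"
  shows "(\<lambda>z. p (clamp (h z)) (k z)) \<in> borel_measurable N"
proof -
  have "(\<lambda>z. clamp (h z)) \<in> N \<rightarrow>\<^sub>M restrict_space lborel {0..T}"
    using clamp_mem by (intro measurable_restrict_space2) auto
  moreover have "k \<in> N \<rightarrow>\<^sub>M \<mu>0" using measurable_cong_sets[OF refl sets_mu0] by simp
  ultimately have "(\<lambda>z. (clamp (h z), k z)) \<in> N \<rightarrow>\<^sub>M restrict_space lborel {0..T} \<Otimes>\<^sub>M \<mu>0"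
    by (rule measurable_Pair)
  from measurable_compose[OF this p] show ?thesis by simp
qed

text \<open>The adjoint right sides at time \<open>t\<close> depend only on the time slices at
  \<open>t\<close>, which lets the fixed-time duality be applied along curves.\<close>

lemma adj_rhs_freeze:
  "adj_p_rhs \<mu>0 DK Df \<Phi> y p t x = adj_p_rhs \<mu>0 DK Df (\<lambda>_. \<Phi> t) (\<lambda>_. y t) (\<lambda>_. p t) t x"
  "adj_q_rhs \<mu>0 Df Dg \<Phi> y p q t m = adj_q_rhs \<mu>0 Df Dg (\<lambda>_. \<Phi> t) (\<lambda>_. y t) (\<lambda>_. p t) (\<lambda>_. q t) t m"
  by (simp_all add: adj_p_rhs_def adj_q_rhs_def)

text \<open>A non-integrable integrand has integral 0, which satisfies the bound, so a pointwise
  estimate of \<open>D\<close> is enough.\<close>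

lemma norm_integral_adjoint_le:
  fixes D :: "'a \<Rightarrow> 'a \<Rightarrow>\<^sub>L 'a" and p :: "'a \<Rightarrow> 'a"
  assumes D: "\<And>\<zeta>. norm (D \<zeta>) \<le> L" and p: "integrable \<mu>0 p"
  shows "norm (\<integral>\<zeta>. adjoint (blinfun_apply (D \<zeta>)) (p \<zeta>) \<partial>\<mu>0) \<le> L * (\<integral>\<zeta>. norm (p \<zeta>) \<partial>\<mu>0)"
proof (cases "integrable \<mu>0 (\<lambda>\<zeta>. adjoint (blinfun_apply (D \<zeta>)) (p \<zeta>))")
  case True
  have "norm (adjoint (blinfun_apply (D \<zeta>)) (p \<zeta>)) \<le> L * norm (p \<zeta>)" for \<zeta>
    by (rule order_trans[OF norm_adjoint_blinfun_le mult_right_mono[OF D norm_ge_zero]])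
  then have "norm (\<integral>\<zeta>. adjoint (blinfun_apply (D \<zeta>)) (p \<zeta>) \<partial>\<mu>0) \<le> (\<integral>\<zeta>. L * norm (p \<zeta>) \<partial>\<mu>0)"
    using True p by (intro Bochner_Integration.integral_norm_bound_integral) auto
  then show ?thesis by simp
next
  case False
  then show ?thesis using L_pos by (simp add: not_integrable_integral_eq)
qed

lemma adj_p_rhs_distr:
  fixes y :: "real \<Rightarrow> 'M::finite \<Rightarrow> 'a"
  assumes [measurable]: "\<Phi> t \<in> borel_measurable borel"
  shows "adj_p_rhs \<mu>0 DK Df \<Phi> y p t x =
      - (\<integral>\<zeta>. adjoint (blinfun_apply (DK (\<Phi> t \<zeta> - \<Phi> t x))) (p t x) \<partial>\<mu>0)
      - (1 / real CARD('M)) *\<^sub>R (\<Sum>m\<in>UNIV. adjoint (blinfun_apply (Df (y t m - \<Phi> t x))) (p t x))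
      + (\<integral>\<zeta>. adjoint (blinfun_apply (DK (\<Phi> t \<zeta> - \<Phi> t x))) (p t \<zeta>) \<partial>\<mu>0)"
proof -
  show ?thesis unfolding adj_p_rhs_def
    by (subst integral_distr) (auto intro!: borel_measurable_mu0[OF assms] DK_meas(2))
qed

lemma norm_adj_p_rhs_le:
  fixes y :: "real \<Rightarrow> 'M::finite \<Rightarrow> 'a"
  assumes "\<Phi> t \<in> borel_measurable borel" and p: "integrable \<mu>0 (p t)"
  shows "norm (adj_p_rhs \<mu>0 DK Df \<Phi> y p t x) \<le> 2 * L * norm (p t x) + L * (\<integral>\<zeta>. norm (p t \<zeta>) \<partial>\<mu>0)"
proof -
  let ?A = "\<integral>\<zeta>. adjoint (blinfun_apply (DK (\<Phi> t \<zeta> - \<Phi> t x))) (p t x) \<partial>\<mu>0"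
  let ?B = "(1 / real CARD('M)) *\<^sub>R (\<Sum>m\<in>UNIV. adjoint (blinfun_apply (Df (y t m - \<Phi> t x))) (p t x))"
  let ?C = "\<integral>\<zeta>. adjoint (blinfun_apply (DK (\<Phi> t \<zeta> - \<Phi> t x))) (p t \<zeta>) \<partial>\<mu>0"
  have "norm ?A \<le> L * norm (p t x)"
    using norm_integral_adjoint_le[of "\<lambda>\<zeta>. DK (\<Phi> t \<zeta> - \<Phi> t x)" "\<lambda>_. p t x"] DK_le by simp
  moreover have "norm ?B \<le> L * norm (p t x)"
    by (intro norm_average_le order_trans[OF norm_adjoint_blinfun_le mult_right_mono[OF Df_le norm_ge_zero]])
  moreover have "norm ?C \<le> L * (\<integral>\<zeta>. norm (p t \<zeta>) \<partial>\<mu>0)"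
    using norm_integral_adjoint_le[of "\<lambda>\<zeta>. DK (\<Phi> t \<zeta> - \<Phi> t x)" "p t"] DK_le p by simp
  moreover have "norm (- ?A - ?B + ?C) \<le> norm ?A + norm ?B + norm ?C"
    using norm_triangle_ineq[of "- ?A - ?B" ?C] norm_triangle_ineq4[of "- ?A" ?B] by simp
  ultimately show ?thesis unfolding adj_p_rhs_distr[where \<Phi> = \<Phi> and t = t, OF assms(1)] by linarith
qed

lemma norm_adj_q_rhs_le:
  fixes y q :: "real \<Rightarrow> 'M::finite \<Rightarrow> 'a"
  assumes p: "integrable \<mu>0 (p t)" and q: "\<And>m. norm (q t m) \<le> Q"
  shows "norm (adj_q_rhs \<mu>0 Df Dg \<Phi> y p q t m) \<le> L * (\<integral>\<zeta>. norm (p t \<zeta>) \<partial>\<mu>0) + L * (2 * Q)"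
proof -
  have "norm ((1 / real CARD('M)) *\<^sub>R (\<integral>\<zeta>. adjoint (blinfun_apply (Df (y t m - \<Phi> t \<zeta>))) (p t \<zeta>) \<partial>\<mu>0))
    \<le> norm (\<integral>\<zeta>. adjoint (blinfun_apply (Df (y t m - \<Phi> t \<zeta>))) (p t \<zeta>) \<partial>\<mu>0)"
    using divide_left_mono[of 1 "real CARD('M)" "norm (\<integral>\<zeta>. adjoint (blinfun_apply (Df (y t m - \<Phi> t \<zeta>))) (p t \<zeta>) \<partial>\<mu>0)"]
    by (simp add: Suc_le_eq)
  also have "\<dots> \<le> L * (\<integral>\<zeta>. norm (p t \<zeta>) \<partial>\<mu>0)" by (intro norm_integral_adjoint_le Df_le p)
  moreover have "norm ((1 / real CARD('M)) *\<^sub>R (\<Sum>j\<in>UNIV. adjoint (blinfun_apply (Dg (y t j - y t m))) (q t j - q t m))) \<le> L * (2 * Q)"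
  proof (rule norm_average_le)
    fix j
    have "norm (q t j - q t m) \<le> 2 * Q" using norm_triangle_ineq4[of "q t j" "q t m"] q[of j] q[of m] by linarith
    then show "norm (adjoint (blinfun_apply (Dg (y t j - y t m))) (q t j - q t m)) \<le> L * (2 * Q)"
      using L_pos Dg_le by (intro order_trans[OF norm_adjoint_blinfun_le] mult_mono) auto
  qed
  ultimately show ?thesis unfolding adj_q_rhs_def by (intro norm_triangle_mono) auto
qed


text \<open>From \<open>s \<le> 1 + s\<^sup>2\<close> and total mass 1. This is the origin of the
  factor \<open>1 + Pb\<close> in the later estimates.\<close>

lemma norm_integrable_of_square:
  fixes v :: "'a \<Rightarrow> 'a"
  assumes "v \<in> borel_measurable \<mu>0" "integrable \<mu>0 (\<lambda>x. (norm (v x))\<^sup>2)"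
  shows "integrable \<mu>0 v" "(\<integral>x. norm (v x) \<partial>\<mu>0) \<le> 1 + (\<integral>x. (norm (v x))\<^sup>2 \<partial>\<mu>0)"
proof -
  have le: "norm (v x) \<le> 1 + (norm (v x))\<^sup>2" for x
    using zero_le_power2[of "norm (v x) - 1 / 2"] by (simp add: power2_eq_square algebra_simps)
  have i: "integrable \<mu>0 (\<lambda>x. 1 + (norm (v x))\<^sup>2)" using assms(2) by simp
  show 1: "integrable \<mu>0 v"
    by (rule Bochner_Integration.integrable_bound[OF i assms(1)]) (use le in \<open>auto intro: order_trans[OF _ abs_ge_self]\<close>)
  have "(\<integral>x. norm (v x) \<partial>\<mu>0) \<le> (\<integral>x. 1 + (norm (v x))\<^sup>2 \<partial>\<mu>0)"
    using 1 i le by (intro Bochner_Integration.integral_mono) auto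
  then show "(\<integral>x. norm (v x) \<partial>\<mu>0) \<le> 1 + (\<integral>x. (norm (v x))\<^sup>2 \<partial>\<mu>0)"
    using assms(2) by simp
qed

text \<open>The difference on the left equals the time integral of \<open>Rm\<close>, in which all
  linear terms cancel. What remains is the linearisation error: \<open>4 * e * B\<close> against the
  L1 norm of \<open>p\<close>, and \<open>2 * e * B\<close> against \<open>q\<close> for each
  agent.\<close>

lemma first_variation_estimate:
  fixes y y' q u u' :: "real \<Rightarrow> 'M::finite \<Rightarrow> 'a"
  assumes s: "is_state \<mu>0 K f g y0 T u \<Phi> y" and s': "is_state \<mu>0 K f g y0 T u' \<Phi>' y'"
    and u: "\<And>m. set_integrable lborel {0..T} (\<lambda>t. u t m)" and u': "\<And>m. set_integrable lborel {0..T} (\<lambda>t. u' t m)"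
    and adj: "is_adjoint_solution \<mu>0 DK Df Dg T \<Phi> y \<T> p q"
    and B: "0 \<le> B" "\<And>t x. t \<in> {0..T} \<Longrightarrow> x \<in> C \<Longrightarrow> norm (\<Phi>' t x - \<Phi> t x) \<le> B"
      "\<And>t m. t \<in> {0..T} \<Longrightarrow> norm (y' t m - y t m) \<le> B"
    and R: "\<And>t x. t \<in> {0..T} \<Longrightarrow> x \<in> C \<Longrightarrow> norm (\<Phi> t x) \<le> R / 2" "\<And>t m. t \<in> {0..T} \<Longrightarrow> norm (y t m) \<le> R / 2"
    and e: "0 \<le> e"
    and Ka: "\<And>a v. norm a \<le> R \<Longrightarrow> norm v \<le> 2 * B \<Longrightarrow> norm (K (a + v) - K a - DK a v) \<le> e * norm v"
    and fa: "\<And>a v. norm a \<le> R \<Longrightarrow> norm v \<le> 2 * B \<Longrightarrow> norm (f (a + v) - f a - Df a v) \<le> e * norm v"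
    and ga: "\<And>a v. norm a \<le> R \<Longrightarrow> norm v \<le> 2 * B \<Longrightarrow> norm (g (a + v) - g a - Dg a v) \<le> e * norm v"
    and Pb: "\<And>t. t \<in> {0..T} \<Longrightarrow> (\<integral>x. (norm (p t x))\<^sup>2 \<partial>\<mu>0) \<le> Pb"
    and Qb: "\<And>t m. t \<in> {0..T} \<Longrightarrow> norm (q t m) \<le> Qb"
  shows "\<bar>(\<integral>x. p T x \<bullet> (\<Phi>' T x - \<Phi> T x) \<partial>\<mu>0) - (LINT t:{0..T}|lborel. \<Sum>m\<in>UNIV. q t m \<bullet> (u' t m - u t m))\<bar>
    \<le> e * B * (T * (4 * (1 + Pb) + 2 * real CARD('M) * Qb))"
proof -
  note sf = state_flow[OF s] and sf' = state_flow[OF s']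
  have T: "T \<in> {0..T}" "0 \<le> T" using T_pos by auto
  have pm: "(\<lambda>(t, x). p t x) \<in> borel_measurable (restrict_space lborel {0..T} \<Otimes>\<^sub>M \<mu>0)"
    and p2: "\<And>t. t \<in> {0..T} \<Longrightarrow> p t \<in> borel_measurable \<mu>0" "\<And>t. t \<in> {0..T} \<Longrightarrow> integrable \<mu>0 (\<lambda>x. (norm (p t x))\<^sup>2)"
    and qc: "\<And>m. continuous_on {0..T} (\<lambda>t. q t m)"
    and p_eq: "\<And>t. t \<in> {0..T} \<Longrightarrow> AE x in \<mu>0. p t x = p T x + (LINT s:{t..T}|lborel. adj_p_rhs \<mu>0 DK Df \<Phi> y p s x)"
    and q_eq: "\<And>t m. t \<in> {0..T} \<Longrightarrow> q t m = (LINT s:{t..T}|lborel. adj_q_rhs \<mu>0 Df Dg \<Phi> y p q s m)"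
    using adj unfolding is_adjoint_solution_def by blast+
  have pi: "integrable \<mu>0 (p t)" and pn: "(\<integral>x. norm (p t x) \<partial>\<mu>0) \<le> 1 + Pb" if "t \<in> {0..T}" for t
    using norm_integrable_of_square[OF p2(1)[OF that] p2(2)[OF that]] Pb[OF that] by auto
  have Pb0: "0 \<le> 1 + Pb" by (rule order_trans[OF Bochner_Integration.integral_nonneg pn[OF T(1)]]) simp
  have Qb0: "0 \<le> Qb" using Qb[OF T(1)] norm_ge_zero order_trans by blast
  let ?E = "lborel \<Otimes>\<^sub>M \<mu>0"
  let ?\<chi> = "\<lambda>s::real. indicator {0..T} s :: real"
  define w where "w t x = \<Phi>' t x - \<Phi> t x" for t x
  define \<eta> where "\<eta> t m = y' t m - y t m" for t m
  define V where "V t x = velocity \<Phi>' y' t x - velocity \<Phi> y t x" for t x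
  define G where "G t m = Gop g (y' t) m - Gop g (y t) m" for t m
  define a where "a t x = adj_p_rhs \<mu>0 DK Df \<Phi> y p t x" for t x
  define c where "c t m = adj_q_rhs \<mu>0 Df Dg \<Phi> y p q t m" for t m
  note pcm = adjoint_clamp_meas[OF pm]
  have sec: "\<Phi> t \<in> borel_measurable borel" "\<Phi>' t \<in> borel_measurable borel" "bounded (\<Phi> t ` C)" "bounded (\<Phi>' t ` C)" if "t \<in> {0..T}" for t
    using flow_section[OF sf(1) that] flow_section[OF sf'(1) that] by auto
  have pEm: "(\<lambda>z. p (clamp (fst z)) (snd z)) \<in> borel_measurable ?E" by (intro pcm) measurable
  have aEm: "(\<lambda>z. a (clamp (fst z)) (snd z)) \<in> borel_measurable ?E"
  proof -
    note [measurable] = agents_clamp_meas[OF sf(2)] flow_clamp_meas_comp[OF sf(1)] pcm DK_meas Df_meas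
    show ?thesis unfolding a_def adj_p_rhs_distr[where \<Phi> = \<Phi>, OF sec(1)[OF clamp_mem]] by measurable
  qed
  have VEm: "(\<lambda>z. V (clamp (fst z)) (snd z)) \<in> borel_measurable ?E"
  proof -
    have id: "(\<lambda>z. z) \<in> ?E \<rightarrow>\<^sub>M (borel \<Otimes>\<^sub>M borel :: (real \<times> 'a) measure)"
      by (intro measurable_ident_sets sets_pair_measure_cong) (simp_all add: sets_mu0)
    show ?thesis unfolding V_def
      by (intro borel_measurable_diff measurable_compose[OF id velocity_meas[OF sf'(1,2)]] measurable_compose[OF id velocity_meas[OF sf(1,2)]])
  qed
  interpret P: pair_sigma_finite lborel \<mu>0 ..
  have pnm: "(\<lambda>t. \<integral>x. norm (p (clamp t) x) \<partial>\<mu>0) \<in> borel_measurable lborel"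
  proof -
    note [measurable] = pcm
    show ?thesis by measurable
  qed
  have pnorm_i: "integrable lborel (\<lambda>t. ?\<chi> t * (\<integral>x. norm (p (clamp t) x) \<partial>\<mu>0))"
  proof (rule integrableI_bounded_set[of "{0..T}" _ _ "1 + Pb"])
    show "AE t in lborel. t \<in> {0..T} \<longrightarrow> norm (?\<chi> t * (\<integral>x. norm (p (clamp t) x) \<partial>\<mu>0)) \<le> 1 + Pb"
      using pn by (intro AE_I2) (auto simp: clamp_id intro!: Bochner_Integration.integral_nonneg)
  qed (use pnm in \<open>auto simp: emeasure_lborel_Icc_eq\<close>)
  have pEi: "integrable ?E (\<lambda>z. ?\<chi> (fst z) *\<^sub>R p (clamp (fst z)) (snd z))"
  proof (rule P.Fubini_integrable)
    show "(\<lambda>z. ?\<chi> (fst z) *\<^sub>R p (clamp (fst z)) (snd z)) \<in> borel_measurable ?E" using pEm by measurable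
    show "integrable lborel (\<lambda>t. \<integral>x. norm (?\<chi> (fst (t, x)) *\<^sub>R p (clamp (fst (t, x))) (snd (t, x))) \<partial>\<mu>0)"
      using pnorm_i by simp
    show "AE t in lborel. integrable \<mu>0 (\<lambda>x. ?\<chi> (fst (t, x)) *\<^sub>R p (clamp (fst (t, x))) (snd (t, x)))"
      using pi[OF clamp_mem] by (intro AE_I2) simp
  qed
  have aEi: "integrable ?E (\<lambda>z. ?\<chi> (fst z) *\<^sub>R a (clamp (fst z)) (snd z))"
  proof (rule Bochner_Integration.integrable_bound)
    have "integrable ?E (\<lambda>z. (?\<chi> (fst z) * (\<integral>x. norm (p (clamp (fst z)) x) \<partial>\<mu>0)) * 1)"
      by (rule P.integrable_pair_mult[OF pnorm_i]) simp
    then show "integrable ?E (\<lambda>z. 2 * L * norm (?\<chi> (fst z) *\<^sub>R p (clamp (fst z)) (snd z)) + L * (?\<chi> (fst z) * (\<integral>x. norm (p (clamp (fst z)) x) \<partial>\<mu>0)))"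
      using integrable_norm[OF pEi] by (intro Bochner_Integration.integrable_add integrable_mult_right) auto
    show "(\<lambda>z. ?\<chi> (fst z) *\<^sub>R a (clamp (fst z)) (snd z)) \<in> borel_measurable ?E" using aEm by measurable
    show "AE z in ?E. norm (?\<chi> (fst z) *\<^sub>R a (clamp (fst z)) (snd z)) \<le>
       norm (2 * L * norm (?\<chi> (fst z) *\<^sub>R p (clamp (fst z)) (snd z)) + L * (?\<chi> (fst z) * (\<integral>x. norm (p (clamp (fst z)) x) \<partial>\<mu>0)))"
    proof (rule AE_I2)
      fix z :: "real \<times> 'a"
      have "norm (a (clamp (fst z)) (snd z)) \<le> 2 * L * norm (p (clamp (fst z)) (snd z)) + L * (\<integral>x. norm (p (clamp (fst z)) x) \<partial>\<mu>0)"
        unfolding a_def by (intro norm_adj_p_rhs_le sec pi clamp_mem)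
      then show "norm (?\<chi> (fst z) *\<^sub>R a (clamp (fst z)) (snd z)) \<le>
       norm (2 * L * norm (?\<chi> (fst z) *\<^sub>R p (clamp (fst z)) (snd z)) + L * (?\<chi> (fst z) * (\<integral>x. norm (p (clamp (fst z)) x) \<partial>\<mu>0)))"
        by (auto simp: indicator_def intro: order_trans[OF _ abs_ge_self])
    qed
  qed
  have Vb: "norm (V t x) \<le> 4 * L * B" if t: "t \<in> {0..T}" and x: "x \<in> C" for t x
  proof -
    have "norm (V t x) \<le> L * (B + 2 * norm (\<Phi>' t x - \<Phi> t x) + B)"
      unfolding V_def using B t by (intro Fop_diff sec) auto
    also have "\<dots> \<le> L * (B + 2 * B + B)" using B(2)[OF t x] L_pos by (intro mult_left_mono) auto
    finally show ?thesis by simp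
  qed
  have cl: "(LINT s:{t1..t2}|lborel. h (clamp s)) = (LINT s:{t1..t2}|lborel. h s)" if "t1 \<in> {0..T}" "t2 \<in> {0..T}" for h :: "real \<Rightarrow> 'a" and t1 t2
    using that by (intro set_lebesgue_integral_cong) (auto simp: clamp_id)
  have clr: "(LINT s:{0..T}|lborel. h (clamp s)) = (LINT s:{0..T}|lborel. h s)" for h :: "real \<Rightarrow> real"
    by (intro set_lebesgue_integral_cong) (auto simp: clamp_id)
  define J where "J t = (\<integral>x. p t x \<bullet> V t x - a t x \<bullet> w t x \<partial>\<mu>0)" for t
  \<comment> \<open>Applied to the clamped curves, which are jointly measurable on the whole line
    and agree with the originals on \<open>{0..T}\<close>.\<close>
  have fam: "(\<integral>x. p T x \<bullet> w T x \<partial>\<mu>0) = (LINT t:{0..T}|lborel. J (clamp t)) \<and> set_integrable lborel {0..T} (\<lambda>t. J (clamp t))"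
  proof -
    have hyp: "0 \<le> 4 * L * B" "AE x in \<mu>0. \<forall>t\<in>{0..T}. norm (V (clamp t) x) \<le> 4 * L * B"
      using L_pos B Vb AE_C clamp_mem by (auto elim!: eventually_mono)
    have wV: "w (clamp t) x = (LINT s:{0..t}|lborel. V (clamp s) x)" if t: "t \<in> {0..T}" for t x
    proof -
      have "w t x = (LINT s:{0..t}|lborel. V s x)"
        unfolding w_def V_def sf(3)[OF t, of x] sf'(3)[OF t, of x]
        by (subst set_integral_diff) (auto intro!: velocity_set_integrable[OF _ _ t] sf sf')
      then show ?thesis using cl[of 0 t "\<lambda>s. V s x"] t by (simp add: clamp_id)
    qed
    have pa: "AE x in \<mu>0. p (clamp t) x = p T x + (LINT s:{t..T}|lborel. a (clamp s) x)" if t: "t \<in> {0..T}" for t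
      using p_eq[OF t] by eventually_elim (use cl[of t T "\<lambda>s. a s _"] t in \<open>simp add: a_def clamp_id\<close>)
    note * = integral_inner_parts_family[where p = "\<lambda>t. p (clamp t)" and a = "\<lambda>t. a (clamp t)" and b = "\<lambda>t. V (clamp t)" and w = "\<lambda>t. w (clamp t)"
        and pT = "p T", OF prob_space_axioms T(2) hyp(1) pEm VEm aEi aEm pi[OF T(1)] pEi hyp(2) wV pa]
    show ?thesis using *(1) *(2) clamp_id[OF T(1)] unfolding J_def by simp
  qed
  have I1: "(\<integral>x. p T x \<bullet> w T x \<partial>\<mu>0) = (LINT t:{0..T}|lborel. J t)" and Ji: "set_integrable lborel {0..T} J"
  proof -
    show "(\<integral>x. p T x \<bullet> w T x \<partial>\<mu>0) = (LINT t:{0..T}|lborel. J t)" using fam clr[of J] by simp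
    have "set_integrable lborel {0..T} (\<lambda>t. J (clamp t)) = set_integrable lborel {0..T} J"
      by (intro set_integrable_cong) (auto simp: clamp_id)
    then show "set_integrable lborel {0..T} J" using fam by simp
  qed
  have ci: "set_integrable lborel {0..T} (\<lambda>t. c t m)" for m
  proof (rule set_integrable_bounded[OF _ _ T(1)])
    note [measurable] = agents_clamp_meas[OF sf(2)] agents_clamp_meas[of q] flow_clamp_meas_comp[OF sf(1)] pcm DK_meas Df_meas borel_measurable_blinfun_family[OF Dg_cont]
    have [measurable]: "(\<lambda>t. q (clamp t) m) \<in> borel_measurable borel" for m using agents_clamp_meas[of q] qc by blast
    show "(\<lambda>t. c (clamp t) m) \<in> borel_measurable borel" unfolding c_def adj_q_rhs_def by measurable
    fix t assume t: "t \<in> {0..T}"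
    have "norm (c t m) \<le> L * (\<integral>\<zeta>. norm (p t \<zeta>) \<partial>\<mu>0) + L * (2 * Qb)"
      unfolding c_def by (intro norm_adj_q_rhs_le pi t Qb)
    also have "\<dots> \<le> L * (1 + Pb) + L * (2 * Qb)" using pn[OF t] L_pos by (intro add_mono mult_left_mono) auto
    finally show "norm (c t m) \<le> L * (1 + Pb) + L * (2 * Qb)" .
  qed
  have Gi: "set_integrable lborel {0..T} (\<lambda>t. G t m)" for m
    unfolding G_def by (intro set_integral_diff(1) Gop_set_integrable sf sf' T)
  have ui: "set_integrable lborel {0..T} (\<lambda>t. u' t m - u t m)" for m by (intro set_integral_diff(1) u u')
  have \<eta>c: "continuous_on {0..T} (\<lambda>t. \<eta> t m)" for m
    unfolding \<eta>_def using sf(2) sf'(2) by (intro continuous_intros) auto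
  \<comment> \<open>The same integration by parts for the agents. There is no boundary term, as
    \<open>q\<close> vanishes at \<open>T\<close> and \<open>\<eta>\<close> at 0.\<close>
  have parts: "(LINT t:{0..T}|lborel. q t m \<bullet> G t m + q t m \<bullet> (u' t m - u t m)) = (LINT t:{0..T}|lborel. \<eta> t m \<bullet> c t m)" for m
  proof -
    have bi: "set_integrable lborel {0..T} (\<lambda>t. G t m + (u' t m - u t m))" by (rule set_integral_add(1)[OF Gi ui])
    have "(LINT t:{0..T}|lborel. q t m \<bullet> G t m + q t m \<bullet> (u' t m - u t m))
      = (LINT t:{0..T}|lborel. (LINT r:{t..T}|lborel. c r m) \<bullet> (G t m + (u' t m - u t m)))"
      by (intro set_lebesgue_integral_cong) (auto simp: q_eq c_def inner_add_right)
    also have "\<dots> = (LINT t:{0..T}|lborel. c t m \<bullet> (LINT r:{0..t}|lborel. G r m + (u' r m - u r m)))"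
      by (rule set_integral_inner_parts[OF ci bi])
    also have "\<dots> = (LINT t:{0..T}|lborel. \<eta> t m \<bullet> c t m)"
    proof (rule set_lebesgue_integral_cong, simp, intro allI impI)
      fix t assume t: "t \<in> {0..T}"
      have sub: "set_integrable lborel {0..t} h" if "set_integrable lborel {0..T} h" for h :: "real \<Rightarrow> 'a"
        using t by (intro set_integrable_subset[OF that]) auto
      have iu: "set_integrable lborel {0..t} (\<lambda>s. Gop g (y s) m + u s m)" "set_integrable lborel {0..t} (\<lambda>s. Gop g (y' s) m + u' s m)"
        by (intro set_integral_add(1) Gop_set_integrable t sf(2) sf'(2) sub[OF u] sub[OF u'])+
      have "\<eta> t m = (LINT s:{0..t}|lborel. (Gop g (y' s) m + u' s m) - (Gop g (y s) m + u s m))"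
        unfolding \<eta>_def sf(4)[OF t, of m] sf'(4)[OF t, of m] using iu by (subst set_integral_diff) auto
      also have "\<dots> = (LINT r:{0..t}|lborel. G r m + (u' r m - u r m))"
        by (intro set_lebesgue_integral_cong) (auto simp: G_def)
      finally show "c t m \<bullet> (LINT r:{0..t}|lborel. G r m + (u' r m - u r m)) = \<eta> t m \<bullet> c t m"
        by (simp add: inner_commute)
    qed
    finally show ?thesis .
  qed
  \<comment> \<open>Everything left of the two integrations by parts once the control term is split
    off. It still contains the exact velocity differences \<open>V\<close> and
    \<open>G\<close>.\<close>
  define Rm where "Rm t = J t + (\<Sum>m\<in>UNIV. q t m \<bullet> G t m - \<eta> t m \<bullet> c t m)" for t
  have qGi: "set_integrable lborel {0..T} (\<lambda>t. q t m \<bullet> G t m)" for m by (rule set_integrable_inner_continuous[OF qc Gi])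
  have qui: "set_integrable lborel {0..T} (\<lambda>t. q t m \<bullet> (u' t m - u t m))" for m by (rule set_integrable_inner_continuous[OF qc ui])
  have eci: "set_integrable lborel {0..T} (\<lambda>t. \<eta> t m \<bullet> c t m)" for m by (rule set_integrable_inner_continuous[OF \<eta>c ci])
  have sumi: "(LINT t:{0..T}|lborel. \<Sum>m\<in>UNIV. h t m) = (\<Sum>m\<in>UNIV. LINT t:{0..T}|lborel. h t m)"
    and sumi': "set_integrable lborel {0..T} (\<lambda>t. \<Sum>m\<in>UNIV. h t m)"
    if "\<And>m. set_integrable lborel {0..T} (\<lambda>t. h t m)" for h :: "real \<Rightarrow> 'M \<Rightarrow> real"
    using that unfolding set_integrable_def set_lebesgue_integral_def scaleR_sum_right
    by (rule Bochner_Integration.integral_sum, rule Bochner_Integration.integrable_sum)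
  have "(LINT t:{0..T}|lborel. Rm t) = (LINT t:{0..T}|lborel. J t) + (\<Sum>m\<in>UNIV. (LINT t:{0..T}|lborel. q t m \<bullet> G t m) - (LINT t:{0..T}|lborel. \<eta> t m \<bullet> c t m))"
    unfolding Rm_def using Ji qGi eci by (subst set_integral_add) (auto intro!: sumi' simp: sumi)
  also have "\<dots> = (\<integral>x. p T x \<bullet> w T x \<partial>\<mu>0) - (\<Sum>m\<in>UNIV. LINT t:{0..T}|lborel. q t m \<bullet> (u' t m - u t m))"
  proof -
    have "(LINT t:{0..T}|lborel. q t m \<bullet> G t m) - (LINT t:{0..T}|lborel. \<eta> t m \<bullet> c t m) = - (LINT t:{0..T}|lborel. q t m \<bullet> (u' t m - u t m))" for m
      using parts[of m] set_integral_add(2)[OF qGi qui, of m m] by simp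
    then show ?thesis using I1 by (simp add: sum_negf)
  qed
  finally have key: "(\<integral>x. p T x \<bullet> w T x \<partial>\<mu>0) - (LINT t:{0..T}|lborel. \<Sum>m\<in>UNIV. q t m \<bullet> (u' t m - u t m)) = (LINT t:{0..T}|lborel. Rm t)"
    using sumi[OF qui] by simp
  let ?c = "e * B * (4 * (1 + Pb) + 2 * real CARD('M) * Qb)"
  have Rb: "norm (Rm t) \<le> ?c" if t: "t \<in> {0..T}" for t
  proof -
    let ?l = "\<lambda>x. linF (\<Phi> t) (y t) (w t) (\<eta> t) x"
    have wm: "w t \<in> borel_measurable borel" unfolding w_def using sec[OF t] by measurable
    have wb: "bounded (w t ` C)" unfolding bounded_iff w_def using B(2)[OF t] by blast
    note ld = linear_duality[OF sec(1)[OF t] wm wb pi[OF t]]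
    have Vm: "V t \<in> borel_measurable \<mu>0"
    proof -
      have "(\<lambda>x. (t, x)) \<in> \<mu>0 \<rightarrow>\<^sub>M ?E" by measurable
      from measurable_compose[OF this VEm] show ?thesis using t by (simp add: clamp_id)
    qed
    note [measurable] = Vm linF_meas[OF sec(1)[OF t] wm] borel_measurable_integrable[OF pi[OF t]]
    have Vl: "norm (V t x - ?l x) \<le> 4 * e * B" if x: "x \<in> C" for x
      unfolding V_def w_def \<eta>_def by (rule Fop_linearization[OF sec(1)[OF t] sec(2)[OF t] B(2)[OF t] B(3)[OF t] R(1)[OF t] R(2)[OF t] e Ka fa x])
    have bd: "AE x in \<mu>0. norm (p t x \<bullet> (V t x - ?l x)) \<le> norm (p t x) * (4 * e * B)"
      using AE_C
    proof eventually_elim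
      case (elim x)
      have "norm (p t x \<bullet> (V t x - ?l x)) \<le> norm (p t x) * norm (V t x - ?l x)" using Cauchy_Schwarz_ineq2 by simp
      also have "\<dots> \<le> norm (p t x) * (4 * e * B)" using Vl[OF elim] by (intro mult_left_mono) auto
      finally show ?case .
    qed
    have iVl: "integrable \<mu>0 (\<lambda>x. p t x \<bullet> (V t x - ?l x))"
    proof (rule Bochner_Integration.integrable_bound)
      show "integrable \<mu>0 (\<lambda>x. norm (p t x) * (4 * e * B))" using pi[OF t] by simp
      show "AE x in \<mu>0. norm (p t x \<bullet> (V t x - ?l x)) \<le> norm (norm (p t x) * (4 * e * B))"
        using bd by eventually_elim (auto intro: order_trans[OF _ abs_ge_self])
    qed measurable
    have "\<bar>\<integral>x. p t x \<bullet> (V t x - ?l x) \<partial>\<mu>0\<bar> \<le> (\<integral>x. norm (p t x) * (4 * e * B) \<partial>\<mu>0)"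
      using pi[OF t] iVl bd by (intro integral_abs_bound[THEN order_trans] integral_mono_AE) auto
    also have "\<dots> \<le> (1 + Pb) * (4 * e * B)"
      using pn[OF t] e B by (simp add: mult_right_mono)
    finally have 1: "\<bar>\<integral>x. p t x \<bullet> (V t x - ?l x) \<partial>\<mu>0\<bar> \<le> (1 + Pb) * (4 * e * B)" .
    have "\<bar>\<Sum>m\<in>UNIV. q t m \<bullet> (G t m - linG (y t) (\<eta> t) m)\<bar> \<le> (\<Sum>m\<in>(UNIV::'M set). Qb * (2 * e * B))"
    proof (rule sum_abs[THEN order_trans], rule sum_mono)
      fix m
      have "\<bar>q t m \<bullet> (G t m - linG (y t) (\<eta> t) m)\<bar> \<le> norm (q t m) * norm (G t m - linG (y t) (\<eta> t) m)" by (rule Cauchy_Schwarz_ineq2)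
      also have "\<dots> \<le> Qb * (2 * e * B)"
        unfolding G_def \<eta>_def using Qb0 Qb[OF t] e B(1)
        by (intro mult_mono Gop_linearization[OF B(3)[OF t] R(2)[OF t] e ga]) auto
      finally show "\<bar>q t m \<bullet> (G t m - linG (y t) (\<eta> t) m)\<bar> \<le> Qb * (2 * e * B)" .
    qed
    then have 2: "\<bar>\<Sum>m\<in>UNIV. q t m \<bullet> (G t m - linG (y t) (\<eta> t) m)\<bar> \<le> real CARD('M) * (Qb * (2 * e * B))" by simp
    have a': "a t x = adj_p_rhs \<mu>0 DK Df (\<lambda>_. \<Phi> t) (\<lambda>_. y t) (\<lambda>_. p t) t x" for x
      unfolding a_def by (rule adj_rhs_freeze)
    have c': "c t m = adj_q_rhs \<mu>0 Df Dg (\<lambda>_. \<Phi> t) (\<lambda>_. y t) (\<lambda>_. p t) (\<lambda>_. q t) t m" for m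
      unfolding c_def by (rule adj_rhs_freeze)
    have ia: "integrable \<mu>0 (\<lambda>x. a t x \<bullet> w t x)" unfolding a' by (rule ld(2))
    have il: "integrable \<mu>0 (\<lambda>x. p t x \<bullet> ?l x)" by (rule ld(1))
    have "J t = (\<integral>x. p t x \<bullet> (V t x - ?l x) + p t x \<bullet> ?l x - a t x \<bullet> w t x \<partial>\<mu>0)"
      unfolding J_def by (simp add: inner_diff_right)
    also have "\<dots> = (\<integral>x. p t x \<bullet> (V t x - ?l x) \<partial>\<mu>0) + (\<integral>x. p t x \<bullet> ?l x \<partial>\<mu>0) - (\<integral>x. a t x \<bullet> w t x \<partial>\<mu>0)"
      using iVl il ia by (subst Bochner_Integration.integral_diff) (auto simp del: inner_diff_right)
    finally have J: "J t = (\<integral>x. p t x \<bullet> (V t x - ?l x) \<partial>\<mu>0) + (\<integral>x. p t x \<bullet> ?l x \<partial>\<mu>0) - (\<integral>x. a t x \<bullet> w t x \<partial>\<mu>0)" .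
    \<comment> \<open>Duality trades the adjoint terms for the linearised velocities, so that only
      \<open>V\<close> minus \<open>linF\<close> and \<open>G\<close> minus \<open>linG\<close>
      survive in \<open>Rm\<close>.\<close>
    have lin: "(\<integral>x. p t x \<bullet> ?l x \<partial>\<mu>0) + (\<Sum>m\<in>UNIV. q t m \<bullet> linG (y t) (\<eta> t) m) = (\<integral>x. a t x \<bullet> w t x \<partial>\<mu>0) + (\<Sum>m\<in>UNIV. c t m \<bullet> \<eta> t m)"
      unfolding a' c' by (rule ld(3))
    have "Rm t = (\<integral>x. p t x \<bullet> (V t x - ?l x) \<partial>\<mu>0) + (\<Sum>m\<in>UNIV. q t m \<bullet> (G t m - linG (y t) (\<eta> t) m))"
      using J lin unfolding Rm_def inner_diff_right sum_subtractf by (simp add: inner_commute)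
    then have "norm (Rm t) \<le> (1 + Pb) * (4 * e * B) + real CARD('M) * (Qb * (2 * e * B))"
      using 1 2 by simp
    also have "\<dots> = ?c" by (simp add: algebra_simps)
    finally show ?thesis .
  qed
  have "norm (LINT t:{0..T}|lborel. Rm t) \<le> ?c * T - ?c * 0"
    by (rule norm_set_integral_le_FTC[where F = "\<lambda>s. ?c * s" and F' = "\<lambda>_. ?c"])
      (use Rb T in \<open>auto intro!: derivative_eq_intros continuous_intros\<close>)
  then show ?thesis using key unfolding w_def by (simp add: mult_ac)
qed

end

section \<open>First variation and minimum principle\<close>

lemma admissible_set_integrable:
  fixes u :: "real \<Rightarrow> 'M::finite \<Rightarrow> 'a::euclidean_space"
  assumes "admissible Us T u" "compact (Us m)"
  shows "set_integrable lborel {0..T} (\<lambda>t. u t m)"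
proof -
  obtain b where b: "\<And>v. v \<in> Us m \<Longrightarrow> norm v \<le> b"
    using compact_imp_bounded[OF assms(2)] unfolding bounded_iff by blast
  show ?thesis
    unfolding set_integrable_def
  proof (rule integrableI_bounded_set[of "{0..T}" _ _ b])
    show "(\<lambda>t. indicator {0..T} t *\<^sub>R u t m) \<in> borel_measurable lborel"
      using assms(1) by (simp add: admissible_def borel_measurable_restrict_space_iff)
    show "AE t in lborel. t \<in> {0..T} \<longrightarrow> norm (indicator {0..T} t *\<^sub>R u t m) \<le> b"
      using assms(1) b by (auto simp: admissible_def)
  qed (auto simp: emeasure_lborel_Icc_eq)
qed

lemma empirical_finite_support:
  fixes z :: "nat \<Rightarrow> 'a::euclidean_space"
  assumes "P \<ge> 1"
  shows "prob_space (empirical P z)" "sets (empirical P z) = sets borel" "AE y in empirical P z. y \<in> z ` {..<P}"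
proof -
  show "prob_space (empirical P z)" unfolding empirical_def by (rule measure_pmf.prob_space_distr) simp
  show "sets (empirical P z) = sets borel" by (simp add: empirical_def)
  have "{..<P} \<noteq> {}" using assms by (auto simp: lessThan_empty_iff)
  then have "AE i in measure_pmf (pmf_of_set {..<P}). z i \<in> z ` {..<P}"
    by (auto simp: AE_measure_pmf_iff set_pmf_of_set)
  moreover have "{y \<in> space borel. y \<in> z ` {..<P}} \<in> sets borel"
    by (simp add: finite_imp_closed borel_closed)
  ultimately show "AE y in empirical P z. y \<in> z ` {..<P}"
    unfolding empirical_def by (subst AE_distr_iff) auto
qed

text \<open>The error quotient is a sum of two: \<open>lim1\<close> linearises the transport cost in
  the displacement of the terminal flow, \<open>lim2\<close> rewrites that linear term through the
  adjoint. They meet in the pairing with \<open>p T\<close>.\<close>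

lemma (in splitting_model) gateaux_derivative:
  fixes us \<delta>u qs y :: "real \<Rightarrow> 'M::finite \<Rightarrow> 'a"
  assumes P: "P \<ge> 1" and Us: "\<And>m. compact (Us m)" and us: "admissible Us T us"
    and ac: "absolutely_continuous lborel \<mu>0"
    and s: "is_state \<mu>0 K f g y0 T us \<Phi> y"
    and OT: "is_OT_map (distr \<mu>0 borel (\<Phi> T)) (empirical P z) \<T>"
    and adj: "is_adjoint_solution \<mu>0 DK Df Dg T \<Phi> y \<T> p qs"
    and \<epsilon>0: "0 < \<epsilon>0" and adm: "\<And>\<epsilon>. 0 < \<epsilon> \<Longrightarrow> \<epsilon> \<le> \<epsilon>0 \<Longrightarrow> admissible Us T (\<lambda>t m. us t m + \<epsilon> *\<^sub>R \<delta>u t m)"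
  shows "((\<lambda>\<epsilon>. (Jinf \<mu>0 K f g y0 T P z (\<lambda>t m. us t m + \<epsilon> *\<^sub>R \<delta>u t m) - Jinf \<mu>0 K f g y0 T P z us
      - \<epsilon> * (LINT t:{0..T}|lborel. (\<Sum>m\<in>UNIV. qs t m \<bullet> \<delta>u t m))) / \<epsilon>) \<longlongrightarrow> 0) (at_right 0)"
proof -
  have T: "T \<in> {0..T}" using T_pos by auto
  note sf = state_flow[OF s]
  obtain b where b: "\<And>v m. v \<in> Us m \<Longrightarrow> norm v \<le> b"
  proof -
    have "bounded (\<Union>m. Us m)" using compact_imp_bounded[OF Us] by (intro bounded_UN) auto
    then show thesis unfolding bounded_iff using that by blast
  qed
  \<comment> \<open>Both \<open>us\<close> and \<open>us\<close> shifted by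
    \<open>\<epsilon>0\<close> times the direction take values in sets of radius \<open>b\<close>,
    so the direction itself is bounded at every time.\<close>
  define D where "D = 2 * b / \<epsilon>0"
  have \<delta>D: "norm (\<delta>u t m) \<le> D" if t: "t \<in> {0..T}" for t m
  proof -
    have "norm (us t m) \<le> b" "norm (us t m + \<epsilon>0 *\<^sub>R \<delta>u t m) \<le> b"
      using us adm[OF \<epsilon>0 order_refl] t b unfolding admissible_def by blast+
    then have "norm (\<epsilon>0 *\<^sub>R \<delta>u t m) \<le> 2 * b"
      using norm_triangle_ineq4[of "us t m + \<epsilon>0 *\<^sub>R \<delta>u t m" "us t m"] by simp
    then show ?thesis using \<epsilon>0 by (simp add: D_def pos_le_divide_eq mult.commute)
  qed
  have D0: "0 \<le> D" using \<delta>D[OF T] norm_ge_zero order_trans by blast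
  let ?u = "\<lambda>\<epsilon> t m. us t m + \<epsilon> *\<^sub>R \<delta>u t m"
  have ui: "set_integrable lborel {0..T} (\<lambda>t. us t m)" for m by (rule admissible_set_integrable[OF us Us])
  have uei: "set_integrable lborel {0..T} (\<lambda>t. ?u \<epsilon> t m)" if "0 < \<epsilon>" "\<epsilon> \<le> \<epsilon>0" for \<epsilon> m
    by (rule admissible_set_integrable[OF adm[OF that] Us])
  \<comment> \<open>One state is selected for every \<epsilon>, so that the terminal displacement
    becomes a function of \<epsilon>.\<close>
  have "\<forall>\<epsilon>. \<exists>S. 0 < \<epsilon> \<and> \<epsilon> \<le> \<epsilon>0 \<longrightarrow> is_state \<mu>0 K f g y0 T (?u \<epsilon>) (fst S) (snd S)"
  proof
    fix \<epsilon>
    show "\<exists>S. 0 < \<epsilon> \<and> \<epsilon> \<le> \<epsilon>0 \<longrightarrow> is_state \<mu>0 K f g y0 T (?u \<epsilon>) (fst S) (snd S)"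
    proof (cases "0 < \<epsilon> \<and> \<epsilon> \<le> \<epsilon>0")
      case True
      then have "set_integrable lborel {0..T} (\<lambda>t. ?u \<epsilon> t m)" for m using uei by blast
      then obtain \<Phi>' y' where "is_state \<mu>0 K f g y0 T (?u \<epsilon>) \<Phi>' y'"
        by (rule state_exists[where ?y0.0 = y0])
      then show ?thesis by (intro exI[of _ "(\<Phi>', y')"]) simp
    qed auto
  qed
  then obtain S where "\<forall>\<epsilon>. 0 < \<epsilon> \<and> \<epsilon> \<le> \<epsilon>0 \<longrightarrow> is_state \<mu>0 K f g y0 T (?u \<epsilon>) (fst (S \<epsilon>)) (snd (S \<epsilon>))"
    unfolding choice_iff by blast
  then have se: "is_state \<mu>0 K f g y0 T (?u \<epsilon>) (fst (S \<epsilon>)) (snd (S \<epsilon>))" if "0 < \<epsilon>" "\<epsilon> \<le> \<epsilon>0" for \<epsilon>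
    using that by blast
  \<comment> \<open>The stability constant at the final time with the factor \<epsilon> taken out;
    the exponential is largest there.\<close>
  define A where "A = 2 * D * T * exp (8 * L * T)"
  have A0: "0 \<le> A" using D0 T_pos by (simp add: A_def)
  have stab: "t \<in> {0..T} \<Longrightarrow> x \<in> C \<Longrightarrow> norm (fst (S \<epsilon>) t x - \<Phi> t x) \<le> A * \<epsilon>"
    "t \<in> {0..T} \<Longrightarrow> norm (snd (S \<epsilon>) t m - y t m) \<le> A * \<epsilon>" if \<epsilon>: "0 < \<epsilon>" "\<epsilon> \<le> \<epsilon>0" for \<epsilon> t x m
  proof -
    have d: "0 \<le> \<epsilon> * D" "norm (?u \<epsilon> t m - us t m) \<le> \<epsilon> * D" if "t \<in> {0..T}" for t m
      using \<delta>D[OF that] \<epsilon> D0 by (auto intro: mult_left_mono)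
    have e: "2 * (\<epsilon> * D * T) * exp (8 * L * t) \<le> A * \<epsilon>" if "t \<in> {0..T}" for t
    proof -
      have "2 * (\<epsilon> * D * T) * exp (8 * L * t) \<le> 2 * (\<epsilon> * D * T) * exp (8 * L * T)"
        using that D0 T_pos L_pos \<epsilon> by (intro mult_left_mono) auto
      then show ?thesis by (simp add: A_def mult_ac)
    qed
    note ss = state_stability[OF s se[OF \<epsilon>] ui uei[OF \<epsilon>] d(1)[OF T] d(2)]
    show "norm (fst (S \<epsilon>) t x - \<Phi> t x) \<le> A * \<epsilon>" if "t \<in> {0..T}" "x \<in> C"
      using ss(1)[OF _ that] e[OF that(1)] by force
    show "norm (snd (S \<epsilon>) t m - y t m) \<le> A * \<epsilon>" if "t \<in> {0..T}"
      by (rule order_trans[OF ss(2)[OF _ that] e[OF that]])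
  qed
  define W where "W \<epsilon> x = fst (S \<epsilon>) T x - \<Phi> T x" for \<epsilon> x
  have \<Phi>m: "\<Phi> T \<in> borel_measurable \<mu>0" by (intro borel_measurable_mu0 flow_section(2)[OF sf(1) T])
  have Wm: "W \<epsilon> \<in> borel_measurable \<mu>0" if "0 < \<epsilon>" "\<epsilon> \<le> \<epsilon>0" for \<epsilon>
    unfolding W_def using flow_section(2)[OF state_flow(1)[OF se[OF that]] T] \<Phi>m
    by (intro borel_measurable_diff borel_measurable_mu0) auto
  have Wb: "AE x in \<mu>0. norm (W \<epsilon> x) \<le> A * \<epsilon>" if "0 < \<epsilon>" "\<epsilon> \<le> \<epsilon>0" for \<epsilon>
    using AE_C by eventually_elim (use stab(1)[OF that T] in \<open>simp add: W_def\<close>)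
  have Ju: "Jinf \<mu>0 K f g y0 T P z us = 1/2 * (W2 (distr \<mu>0 borel (\<Phi> T)) (empirical P z))\<^sup>2"
    unfolding Jinf_def final_measure_eq[OF s ui] ..
  have Je: "Jinf \<mu>0 K f g y0 T P z (?u \<epsilon>) = 1/2 * (W2 (distr \<mu>0 borel (\<lambda>x. \<Phi> T x + W \<epsilon> x)) (empirical P z))\<^sup>2"
    if "0 < \<epsilon>" "\<epsilon> \<le> \<epsilon>0" for \<epsilon>
    unfolding Jinf_def final_measure_eq[OF se[OF that] uei[OF that]] W_def by simp
  obtain RX where RX: "AE x in \<mu>0. norm (\<Phi> T x) \<le> RX" using AE_bounded_image[OF flow_section(3)[OF sf(1) T]] .
  have Zne: "z ` {..<P} \<noteq> {}" using P by (auto simp: lessThan_empty_iff)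
  let ?I = "\<lambda>\<epsilon>. \<integral>x. (\<Phi> T x - \<T> (\<Phi> T x)) \<bullet> W \<epsilon> x \<partial>\<mu>0"
  have lim1: "((\<lambda>\<epsilon>. (1/2 * (W2 (distr \<mu>0 borel (\<lambda>x. \<Phi> T x + W \<epsilon> x)) (empirical P z))\<^sup>2
      - 1/2 * (W2 (distr \<mu>0 borel (\<Phi> T)) (empirical P z))\<^sup>2 - ?I \<epsilon>) / \<epsilon>) \<longlongrightarrow> 0) (at_right 0)"
    by (rule W2_squared_directional_derivative[OF prob_space_axioms \<Phi>m RX empirical_finite_support(1,2)[OF P] _ Zne
          empirical_finite_support(3)[OF P] absolutely_continuous_flow[OF s ac] OT \<epsilon>0 Wm Wb A0]) auto
  let ?Lin = "LINT t:{0..T}|lborel. (\<Sum>m\<in>UNIV. qs t m \<bullet> \<delta>u t m)"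
  have ev0: "\<forall>\<^sub>F \<epsilon> in at_right (0::real). 0 < \<epsilon> \<and> \<epsilon> \<le> \<epsilon>0"
    using eventually_at_right_less[of "0::real"] eventually_at_right_real[OF \<epsilon>0] by eventually_elim auto
  have lim2: "((\<lambda>\<epsilon>. (?I \<epsilon> - \<epsilon> * ?Lin) / \<epsilon>) \<longlongrightarrow> 0) (at_right 0)"
  proof (rule tendstoI)
    fix e :: real assume e: "0 < e"
    obtain B1 where B1: "0 \<le> B1" "\<And>t x. t \<in> {0..T} \<Longrightarrow> x \<in> C \<Longrightarrow> norm (\<Phi> t x) \<le> B1"
      using flow_bounded[OF sf(1) C_compact] by blast
    obtain B2 where B2: "0 \<le> B2" "\<And>t m. t \<in> {0..T} \<Longrightarrow> norm (y t m) \<le> B2" using agents_bounded[OF sf(2)] by blast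
    have pT: "AE x in \<mu>0. p T x = \<Phi> T x - \<T> (\<Phi> T x)" and pTm: "p T \<in> borel_measurable \<mu>0"
      and qc: "\<forall>m. continuous_on {0..T} (\<lambda>t. qs t m)"
      using adj T unfolding is_adjoint_solution_def by blast+
    obtain Pb where Pb: "\<And>t. t \<in> {0..T} \<Longrightarrow> (\<integral>x. (norm (p t x))\<^sup>2 \<partial>\<mu>0) \<le> Pb"
      using adj unfolding is_adjoint_solution_def by blast
    obtain Qb where Qb: "0 \<le> Qb" "\<And>t m. t \<in> {0..T} \<Longrightarrow> norm (qs t m) \<le> Qb" using agents_bounded[OF qc] by blast
    define R where "R = 2 * (B1 + B2)"
    define Q where "Q = A * (T * (4 * (1 + Pb) + 2 * real CARD('M) * Qb))"
    have Pb0: "0 \<le> Pb" by (rule order_trans[OF Bochner_Integration.integral_nonneg Pb[OF T]]) simp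
    have Q0: "0 \<le> Q" unfolding Q_def using A0 T_pos Pb0 Qb(1) by simp
    \<comment> \<open>\<open>Q\<close> is the constant of the first-variation estimate per unit of
      \<epsilon>. Adding 1 avoids division by zero, and the 2 leaves a strict inequality.\<close>
    define e1 where "e1 = e / (2 * (Q + 1))"
    have e1: "0 < e1" using e Q0 by (simp add: e1_def)
    obtain d1 where d1: "0 < d1" "\<And>a v. norm a \<le> R \<Longrightarrow> norm v \<le> d1 \<Longrightarrow> norm (K (a + v) - K a - DK a v) \<le> e1 * norm v"
      using uniform_linear_approx[OF K_deriv DK_cont e1, of R] by blast
    obtain d2 where d2: "0 < d2" "\<And>a v. norm a \<le> R \<Longrightarrow> norm v \<le> d2 \<Longrightarrow> norm (f (a + v) - f a - Df a v) \<le> e1 * norm v"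
      using uniform_linear_approx[OF f_deriv Df_cont e1, of R] by blast
    obtain d3 where d3: "0 < d3" "\<And>a v. norm a \<le> R \<Longrightarrow> norm v \<le> d3 \<Longrightarrow> norm (g (a + v) - g a - Dg a v) \<le> e1 * norm v"
      using uniform_linear_approx[OF g_deriv Dg_cont e1, of R] by blast
    have "((\<lambda>\<epsilon>::real. 2 * (A * \<epsilon>)) \<longlongrightarrow> 2 * (A * 0)) (at_right 0)" by (intro tendsto_intros)
    \<comment> \<open>The factor 2 is that of the kernel increments: differences of two
      displacements, each at most \<open>A * \<epsilon>\<close>.\<close>
    then have "\<forall>\<^sub>F \<epsilon> in at_right 0. 2 * (A * \<epsilon>) < min d1 (min d2 d3)"
      using d1(1) d2(1) d3(1) by (intro order_tendstoD(2)) auto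
    then show "\<forall>\<^sub>F \<epsilon> in at_right 0. dist ((?I \<epsilon> - \<epsilon> * ?Lin) / \<epsilon>) 0 < e"
      using ev0
    proof eventually_elim
      case (elim \<epsilon>)
      then have \<epsilon>: "0 < \<epsilon>" "\<epsilon> \<le> \<epsilon>0" and sm: "2 * (A * \<epsilon>) \<le> d1" "2 * (A * \<epsilon>) \<le> d2" "2 * (A * \<epsilon>) \<le> d3" by auto
      have "\<bar>(\<integral>x. p T x \<bullet> (fst (S \<epsilon>) T x - \<Phi> T x) \<partial>\<mu>0) - (LINT t:{0..T}|lborel. \<Sum>m\<in>UNIV. qs t m \<bullet> (?u \<epsilon> t m - us t m))\<bar>
          \<le> e1 * (A * \<epsilon>) * (T * (4 * (1 + Pb) + 2 * real CARD('M) * Qb))"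
      proof (rule first_variation_estimate[OF s se[OF \<epsilon>] ui uei[OF \<epsilon>] adj, where R = R])
        show "0 \<le> A * \<epsilon>" using A0 \<epsilon> by simp
        show "norm (\<Phi> t x) \<le> R / 2" if "t \<in> {0..T}" "x \<in> C" for t x using B1(2)[OF that] B2(1) by (simp add: R_def)
        show "norm (y t m) \<le> R / 2" if "t \<in> {0..T}" for t m using B2(2)[OF that, of m] B1(1) by (simp add: R_def)
        show "0 \<le> e1" using e1 by simp
        show "norm (K (a + v) - K a - DK a v) \<le> e1 * norm v" if "norm a \<le> R" "norm v \<le> 2 * (A * \<epsilon>)" for a v
          by (rule d1(2)[OF that(1) order_trans[OF that(2) sm(1)]])
        show "norm (f (a + v) - f a - Df a v) \<le> e1 * norm v" if "norm a \<le> R" "norm v \<le> 2 * (A * \<epsilon>)" for a v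
          by (rule d2(2)[OF that(1) order_trans[OF that(2) sm(2)]])
        show "norm (g (a + v) - g a - Dg a v) \<le> e1 * norm v" if "norm a \<le> R" "norm v \<le> 2 * (A * \<epsilon>)" for a v
          by (rule d3(2)[OF that(1) order_trans[OF that(2) sm(3)]])
      qed (use stab[OF \<epsilon>] Pb Qb in auto)
      moreover have "(\<integral>x. p T x \<bullet> (fst (S \<epsilon>) T x - \<Phi> T x) \<partial>\<mu>0) = ?I \<epsilon>"
        unfolding W_def[symmetric]
      proof (rule integral_cong_AE)
        have "\<T> \<in> borel_measurable borel" using OT by (simp add: is_OT_map_def)
        then have "(\<lambda>x. \<T> (\<Phi> T x)) \<in> borel_measurable \<mu>0" using \<Phi>m by (rule measurable_compose[rotated])
        then show "(\<lambda>x. (\<Phi> T x - \<T> (\<Phi> T x)) \<bullet> W \<epsilon> x) \<in> borel_measurable \<mu>0"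
          using \<Phi>m Wm[OF \<epsilon>] by (intro borel_measurable_inner borel_measurable_diff)
        show "(\<lambda>x. p T x \<bullet> W \<epsilon> x) \<in> borel_measurable \<mu>0" using pTm Wm[OF \<epsilon>] by (rule borel_measurable_inner)
        show "AE x in \<mu>0. p T x \<bullet> W \<epsilon> x = (\<Phi> T x - \<T> (\<Phi> T x)) \<bullet> W \<epsilon> x" using pT by eventually_elim simp
      qed
      moreover have "(LINT t:{0..T}|lborel. \<Sum>m\<in>UNIV. qs t m \<bullet> (?u \<epsilon> t m - us t m)) = \<epsilon> * ?Lin"
        by (simp flip: sum_distrib_left)
      moreover have "e1 * (A * \<epsilon>) * (T * (4 * (1 + Pb) + 2 * real CARD('M) * Qb)) = e1 * Q * \<epsilon>" by (simp add: Q_def mult_ac)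
      ultimately have "\<bar>?I \<epsilon> - \<epsilon> * ?Lin\<bar> \<le> e1 * Q * \<epsilon>" by (simp only:)
      then have "\<bar>?I \<epsilon> - \<epsilon> * ?Lin\<bar> / \<epsilon> \<le> e1 * Q" using \<epsilon> by (simp add: divide_le_eq)
      also have "e1 * Q \<le> e1 * (Q + 1)" using e1 by simp
      also have "\<dots> = e / 2" using Q0 by (simp add: e1_def field_simps)
      also have "\<dots> < e" using e by simp
      finally show ?case using \<epsilon> by (simp add: dist_real_def abs_divide)
    qed
  qed
  from tendsto_add[OF lim1 lim2] have "((\<lambda>\<epsilon>. (1/2 * (W2 (distr \<mu>0 borel (\<lambda>x. \<Phi> T x + W \<epsilon> x)) (empirical P z))\<^sup>2
      - 1/2 * (W2 (distr \<mu>0 borel (\<Phi> T)) (empirical P z))\<^sup>2 - ?I \<epsilon>) / \<epsilon> + (?I \<epsilon> - \<epsilon> * ?Lin) / \<epsilon>) \<longlongrightarrow> 0) (at_right 0)" by simp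
  then show ?thesis
  proof (rule Lim_transform_eventually)
    show "\<forall>\<^sub>F \<epsilon> in at_right 0. (1/2 * (W2 (distr \<mu>0 borel (\<lambda>x. \<Phi> T x + W \<epsilon> x)) (empirical P z))\<^sup>2
      - 1/2 * (W2 (distr \<mu>0 borel (\<Phi> T)) (empirical P z))\<^sup>2 - ?I \<epsilon>) / \<epsilon> + (?I \<epsilon> - \<epsilon> * ?Lin) / \<epsilon>
      = (Jinf \<mu>0 K f g y0 T P z (?u \<epsilon>) - Jinf \<mu>0 K f g y0 T P z us - \<epsilon> * ?Lin) / \<epsilon>"
      using ev0
    proof eventually_elim
      case (elim \<epsilon>)
      then show ?case unfolding Je[OF conjunct1[OF elim] conjunct2[OF elim]] Ju by (simp flip: add_divide_distrib)
    qed
  qed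
qed

text \<open>The objective is a sum over agents, so each component can be compared separately with a
  fixed value. Only countably many values are tested, which gives a single null set; continuity
  extends the inequality to all of \<open>Us m\<close>.\<close>

lemma pointwise_minimum_principle:
  fixes q u :: "real \<Rightarrow> 'M::finite \<Rightarrow> 'a::euclidean_space"
  assumes Us: "\<And>m. compact (Us m)" and u: "admissible Us T u" and q: "\<And>m. continuous_on {0..T} (\<lambda>t. q t m)"
    and var: "\<And>v. admissible Us T v \<Longrightarrow> 0 \<le> (LINT t:{0..T}|lborel. (\<Sum>m\<in>UNIV. q t m \<bullet> (v t m - u t m)))"
  shows "AE t in lborel. t \<in> {0..T} \<longrightarrow>
      (\<Sum>m\<in>UNIV. q t m \<bullet> u t m) = (INF \<omega>\<in>{\<omega>. \<forall>m. \<omega> m \<in> Us m}. \<Sum>m\<in>UNIV. q t m \<bullet> \<omega> m)"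
proof -
  have uU: "u t m \<in> Us m" if "t \<in> {0..T}" for t m using u that by (auto simp: admissible_def)
  have um: "(\<lambda>t. indicator {0..T} t *\<^sub>R u t m) \<in> borel_measurable lborel" for m
    using u by (simp add: admissible_def borel_measurable_restrict_space_iff)
  have point: "AE t in lborel. t \<in> {0..T} \<longrightarrow> q t m \<bullet> u t m \<le> q t m \<bullet> \<omega>" if \<omega>: "\<omega> \<in> Us m" for m \<omega>
  proof -
    define k where "k t = indicator {0..T} t * (q t m \<bullet> (u t m - \<omega>))" for t
    define v where "v t n = (if n = m \<and> 0 < k t then \<omega> else u t n)" for t n
    have "set_integrable lborel {0..T} (\<lambda>t. \<omega>)"
      by (intro borel_integrable_atLeastAtMost' continuous_intros)
    then have "set_integrable lborel {0..T} (\<lambda>t. q t m \<bullet> (u t m - \<omega>))"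
      by (intro set_integrable_inner_continuous q set_integral_diff(1) admissible_set_integrable[OF u Us])
    then have ki: "integrable lborel k" by (simp add: set_integrable_def k_def[abs_def])
    note [measurable] = borel_measurable_integrable[OF ki] um
    have v: "admissible Us T v"
      unfolding admissible_def
    proof (intro conjI allI ballI)
      fix n
      have "(\<lambda>t. if n = m \<and> 0 < k t then indicator {0..T} t *\<^sub>R \<omega> else indicator {0..T} t *\<^sub>R u t n) \<in> borel_measurable lborel"
        by measurable
      also have "(\<lambda>t. if n = m \<and> 0 < k t then indicator {0..T} t *\<^sub>R \<omega> else indicator {0..T} t *\<^sub>R u t n) = (\<lambda>t. indicator {0..T} t *\<^sub>R v t n)"
        by (auto simp: v_def fun_eq_iff)
      finally show "(\<lambda>t. v t n) \<in> borel_measurable (restrict_space lborel {0..T})"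
        by (simp add: borel_measurable_restrict_space_iff)
      show "v t n \<in> Us n" if "t \<in> {0..T}" for t using uU[OF that] \<omega> by (simp add: v_def)
    qed
    \<comment> \<open>\<open>k\<close> is the possible decrease. Switching turns the variational
      inequality into a sign condition on the integral of its positive part, which must therefore
      vanish.\<close>
    have "(LINT t:{0..T}|lborel. (\<Sum>n\<in>UNIV. q t n \<bullet> (v t n - u t n))) = (\<integral>t. - max (k t) 0 \<partial>lborel)"
      unfolding set_lebesgue_integral_def
    proof (rule Bochner_Integration.integral_cong)
      fix t
      have "(\<Sum>n\<in>UNIV. q t n \<bullet> (v t n - u t n)) = (\<Sum>n\<in>UNIV. if n = m then q t m \<bullet> (v t m - u t m) else 0)"
        by (intro sum.cong) (auto simp: v_def)
      also have "\<dots> = q t m \<bullet> (v t m - u t m)" by simp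
      finally show "indicator {0..T} t *\<^sub>R (\<Sum>n\<in>UNIV. q t n \<bullet> (v t n - u t n)) = - max (k t) 0"
        by (auto simp: v_def k_def indicator_def inner_diff_right max_def)
    qed simp
    then have "(\<integral>t. max (k t) 0 \<partial>lborel) \<le> 0" using var[OF v] by simp
    moreover have "0 \<le> (\<integral>t. max (k t) 0 \<partial>lborel)" by (intro Bochner_Integration.integral_nonneg) simp
    ultimately have "(\<integral>t. max (k t) 0 \<partial>lborel) = 0" by simp
    moreover have "integrable lborel (\<lambda>t. max (k t) 0)" using ki by (intro integrable_max) auto
    ultimately have "AE t in lborel. max (k t) 0 = 0"
      by (subst (asm) integral_nonneg_eq_0_iff_AE) auto
    then show ?thesis
      by eventually_elim (auto simp: k_def inner_diff_right max_def split: if_splits)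
  qed
  have "\<exists>D. countable D \<and> D \<subseteq> Us m \<and> Us m \<subseteq> closure D" for m using separable[of "Us m"] by metis
  then obtain D where D: "\<And>m. countable (D m)" "\<And>m. D m \<subseteq> Us m" "\<And>m. Us m \<subseteq> closure (D m)" by metis
  have "AE t in lborel. t \<in> {0..T} \<longrightarrow> (\<forall>m. \<forall>\<omega>\<in>D m. q t m \<bullet> u t m \<le> q t m \<bullet> \<omega>)"
  proof -
    have "AE t in lborel. \<forall>\<omega>\<in>D m. t \<in> {0..T} \<longrightarrow> q t m \<bullet> u t m \<le> q t m \<bullet> \<omega>" for m
      using point D by (subst AE_ball_countable[OF D(1)]) blast
    then have "AE t in lborel. \<forall>m\<in>UNIV. \<forall>\<omega>\<in>D m. t \<in> {0..T} \<longrightarrow> q t m \<bullet> u t m \<le> q t m \<bullet> \<omega>"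
      by (rule AE_finite_allI[OF finite])
    then show ?thesis by eventually_elim blast
  qed
  then show ?thesis
  proof eventually_elim
    case (elim t)
    show ?case
    proof
      assume t: "t \<in> {0..T}"
      have le: "q t m \<bullet> u t m \<le> q t m \<bullet> \<omega>" if "\<omega> \<in> Us m" for m \<omega>
      proof -
        have "closed {\<omega>. q t m \<bullet> u t m \<le> q t m \<bullet> \<omega>}" by (intro closed_Collect_le continuous_intros)
        then have "closure (D m) \<subseteq> {\<omega>. q t m \<bullet> u t m \<le> q t m \<bullet> \<omega>}"
          using elim t by (intro closure_minimal) auto
        then show ?thesis using D(3) that by blast
      qed
      \<comment> \<open>\<open>u t\<close> itself belongs to the index set, so the infimum is
        attained and is a genuine minimum.\<close>
      show "(\<Sum>m\<in>UNIV. q t m \<bullet> u t m) = (INF \<omega>\<in>{\<omega>. \<forall>m. \<omega> m \<in> Us m}. \<Sum>m\<in>UNIV. q t m \<bullet> \<omega> m)"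
        by (rule cInf_eq_minimum[symmetric]) (use uU[OF t] le in \<open>auto intro!: sum_mono\<close>)
    qed
  qed
qed

theorem mainTheorem9:
  fixes \<mu>0 :: "'a::euclidean_space measure"
    and K f g :: "'a \<Rightarrow> 'a" and DK Df Dg :: "'a \<Rightarrow> 'a \<Rightarrow>\<^sub>L 'a"
    and Us :: "'M::finite \<Rightarrow> 'a set" and y0 :: "'M \<Rightarrow> 'a"
    and T :: real and P :: nat and z :: "nat \<Rightarrow> 'a"
    and us :: "real \<Rightarrow> 'M \<Rightarrow> 'a" and \<Phi>s :: "real \<Rightarrow> 'a \<Rightarrow> 'a" and ys :: "real \<Rightarrow> 'M \<Rightarrow> 'a"
    and \<T> :: "'a \<Rightarrow> 'a" and ps :: "real \<Rightarrow> 'a \<Rightarrow> 'a" and qs :: "real \<Rightarrow> 'M \<Rightarrow> 'a"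
  assumes T_pos: "T > 0" and P_pos: "P \<ge> 1"
    and K_odd: "\<And>x. K (- x) = - K x" and f_odd: "\<And>x. f (- x) = - f x" and g_odd: "\<And>x. g (- x) = - g x"
    and K_deriv: "\<And>x. (K has_derivative blinfun_apply (DK x)) (at x)"
    and f_deriv: "\<And>x. (f has_derivative blinfun_apply (Df x)) (at x)"
    and g_deriv: "\<And>x. (g has_derivative blinfun_apply (Dg x)) (at x)"
    and DK_cont: "continuous_on UNIV DK" and Df_cont: "continuous_on UNIV Df" and Dg_cont: "continuous_on UNIV Dg"
    and DK_bdd: "bounded (range DK)" and Df_bdd: "bounded (range Df)" and Dg_bdd: "bounded (range Dg)"
    and U_cc: "\<And>m. compact (Us m) \<and> convex (Us m)"
    and mu0_prob: "prob_space \<mu>0" and mu0_sets: "sets \<mu>0 = sets borel"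
    and mu0_cpt: "\<exists>C. compact C \<and> emeasure \<mu>0 (UNIV - C) = 0"
    and mu0_ac: "absolutely_continuous lborel \<mu>0"
    and us_adm: "admissible Us T us"
    and state: "is_state \<mu>0 K f g y0 T us \<Phi>s ys"
    and OT: "is_OT_map (distr \<mu>0 borel (\<Phi>s T)) (empirical P z) \<T>"
    and adj: "is_adjoint_solution \<mu>0 DK Df Dg T \<Phi>s ys \<T> ps qs"
  shows
    "(\<forall>\<delta>u :: real \<Rightarrow> 'M \<Rightarrow> 'a.
        (\<forall>m. (\<lambda>t. \<delta>u t m) \<in> borel_measurable (restrict_space lborel {0..T})
             \<and> integrable (restrict_space lborel {0..T}) (\<lambda>t. (norm (\<delta>u t m))\<^sup>2))
        \<and> (\<exists>\<epsilon>0>0. \<forall>\<epsilon>. 0 < \<epsilon> \<and> \<epsilon> \<le> \<epsilon>0 \<longrightarrow> admissible Us T (\<lambda>t m. us t m + \<epsilon> *\<^sub>R \<delta>u t m))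
      \<longrightarrow> ((\<lambda>\<epsilon>. (Jinf \<mu>0 K f g y0 T P z (\<lambda>t m. us t m + \<epsilon> *\<^sub>R \<delta>u t m)
                   - Jinf \<mu>0 K f g y0 T P z us
                   - \<epsilon> * (LINT t:{0..T}|lborel. (\<Sum>m\<in>UNIV. qs t m \<bullet> \<delta>u t m))) / \<epsilon>)
            \<longlongrightarrow> 0) (at_right 0))
   \<and> ((\<exists>r>0. \<forall>v. admissible Us T v \<and> L2dist T v us < r
              \<longrightarrow> Jinf \<mu>0 K f g y0 T P z us \<le> Jinf \<mu>0 K f g y0 T P z v)
      \<longrightarrow> (AE t in lborel. t \<in> {0..T} \<longrightarrow>
            (\<Sum>m\<in>UNIV. qs t m \<bullet> us t m)
              = (INF \<omega>\<in>{\<omega>. \<forall>m. \<omega> m \<in> Us m}. \<Sum>m\<in>UNIV. qs t m \<bullet> \<omega> m)))"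
proof -
  obtain a b c where abc: "\<And>x. norm (DK x) \<le> a" "\<And>x. norm (Df x) \<le> b" "\<And>x. norm (Dg x) \<le> c"
    using DK_bdd Df_bdd Dg_bdd unfolding bounded_iff by blast
  \<comment> \<open>The summand 1 keeps the constant positive even when all three derivatives
    vanish.\<close>
  define L where "L = \<bar>a\<bar> + \<bar>b\<bar> + \<bar>c\<bar> + 1"
  have L: "0 < L" "\<And>x. norm (DK x) \<le> L" "\<And>x. norm (Df x) \<le> L" "\<And>x. norm (Dg x) \<le> L"
  proof -
    show "0 < L" by (simp add: L_def)
    show "norm (DK x) \<le> L" for x using abc(1)[of x] unfolding L_def by linarith
    show "norm (Df x) \<le> L" for x using abc(2)[of x] unfolding L_def by linarith
    show "norm (Dg x) \<le> L" for x using abc(3)[of x] unfolding L_def by linarith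
  qed
  obtain C where C: "compact C" "emeasure \<mu>0 (UNIV - C) = 0" using mu0_cpt by blast
  have "UNIV - C \<in> sets \<mu>0" using C(1) by (simp add: mu0_sets borel_closed compact_imp_closed sets.Diff)
  then have AEC: "AE x in \<mu>0. x \<in> C" using C(2) by (intro AE_I[of _ _ "UNIV - C"]) auto
  interpret splitting_model \<mu>0 K f g DK Df Dg C L T
    by (intro splitting_model.intro splitting_model_axioms.intro mu0_prob mu0_sets T_pos L K_odd f_odd g_odd
        K_deriv f_deriv g_deriv DK_cont Df_cont Dg_cont C(1) AEC)
  have Us: "\<And>m. compact (Us m)" "\<And>m. convex (Us m)" using U_cc by auto
  note gateaux = gateaux_derivative[OF P_pos Us(1) us_adm mu0_ac state OT adj]
  show ?thesis
  proof (intro conjI allI impI)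
    fix \<delta>u :: "real \<Rightarrow> 'M \<Rightarrow> 'a"
    assume "(\<forall>m. (\<lambda>t. \<delta>u t m) \<in> borel_measurable (restrict_space lborel {0..T})
             \<and> integrable (restrict_space lborel {0..T}) (\<lambda>t. (norm (\<delta>u t m))\<^sup>2))
        \<and> (\<exists>\<epsilon>0>0. \<forall>\<epsilon>. 0 < \<epsilon> \<and> \<epsilon> \<le> \<epsilon>0 \<longrightarrow> admissible Us T (\<lambda>t m. us t m + \<epsilon> *\<^sub>R \<delta>u t m))"
    then obtain \<epsilon>0 where "0 < \<epsilon>0" "\<And>\<epsilon>. 0 < \<epsilon> \<Longrightarrow> \<epsilon> \<le> \<epsilon>0 \<Longrightarrow> admissible Us T (\<lambda>t m. us t m + \<epsilon> *\<^sub>R \<delta>u t m)"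
      by blast
    then show "((\<lambda>\<epsilon>. (Jinf \<mu>0 K f g y0 T P z (\<lambda>t m. us t m + \<epsilon> *\<^sub>R \<delta>u t m)
                   - Jinf \<mu>0 K f g y0 T P z us
                   - \<epsilon> * (LINT t:{0..T}|lborel. (\<Sum>m\<in>UNIV. qs t m \<bullet> \<delta>u t m))) / \<epsilon>)
            \<longlongrightarrow> 0) (at_right 0)"
      by (rule gateaux)
  next
    assume "\<exists>r>0. \<forall>v. admissible Us T v \<and> L2dist T v us < r
              \<longrightarrow> Jinf \<mu>0 K f g y0 T P z us \<le> Jinf \<mu>0 K f g y0 T P z v"
    then obtain r where r: "0 < r" and min: "\<And>v. admissible Us T v \<Longrightarrow> L2dist T v us < r
              \<Longrightarrow> Jinf \<mu>0 K f g y0 T P z us \<le> Jinf \<mu>0 K f g y0 T P z v" by blast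
    have qc: "\<And>m. continuous_on {0..T} (\<lambda>t. qs t m)" using adj unfolding is_adjoint_solution_def by blast
    show "AE t in lborel. t \<in> {0..T} \<longrightarrow>
            (\<Sum>m\<in>UNIV. qs t m \<bullet> us t m)
              = (INF \<omega>\<in>{\<omega>. \<forall>m. \<omega> m \<in> Us m}. \<Sum>m\<in>UNIV. qs t m \<bullet> \<omega> m)"
    proof (rule pointwise_minimum_principle[OF Us(1) us_adm qc])
      fix v assume v: "admissible Us T v"
      let ?u = "\<lambda>\<epsilon> t m. us t m + \<epsilon> *\<^sub>R (v t m - us t m)"
      let ?Lin = "LINT t:{0..T}|lborel. (\<Sum>m\<in>UNIV. qs t m \<bullet> (v t m - us t m))"
      \<comment> \<open>Here convexity of the control sets is used: every admissible competitor
        defines an admissible direction.\<close>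
      have adm: "admissible Us T (?u \<epsilon>)" if \<epsilon>: "0 < \<epsilon>" "\<epsilon> \<le> 1" for \<epsilon> :: real
        unfolding admissible_def
      proof (intro conjI allI ballI)
        fix m
        show "(\<lambda>t. ?u \<epsilon> t m) \<in> borel_measurable (restrict_space lborel {0..T})"
          using us_adm v unfolding admissible_def
          by (intro borel_measurable_add borel_measurable_scaleR borel_measurable_diff borel_measurable_const) auto
        fix t assume "t \<in> {0..T}"
        then have "us t m \<in> Us m" "v t m \<in> Us m" using us_adm v unfolding admissible_def by blast+
        then have "(1 - \<epsilon>) *\<^sub>R us t m + \<epsilon> *\<^sub>R v t m \<in> Us m" using Us(2) \<epsilon> by (intro convexD_alt) auto
        then show "?u \<epsilon> t m \<in> Us m" by (simp add: algebra_simps)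
      qed
      note lim = gateaux[OF zero_less_one adm]
      define I where "I = (LINT t:{0..T}|lborel. (\<Sum>m\<in>UNIV. (norm (v t m - us t m))\<^sup>2))"
      \<comment> \<open>The distance to \<open>us\<close> scales linearly in \<epsilon>, so small
        steps remain in the neighbourhood where \<open>us\<close> is minimal.\<close>
      have dist: "L2dist T (?u \<epsilon>) us = \<epsilon> * sqrt I" if "0 < \<epsilon>" for \<epsilon>
      proof -
        have "(LINT t:{0..T}|lborel. (\<Sum>m\<in>UNIV. (norm (?u \<epsilon> t m - us t m))\<^sup>2)) = \<epsilon>\<^sup>2 * I"
          unfolding I_def by (simp add: power_mult_distrib flip: sum_distrib_left)
        then show ?thesis using that by (simp add: L2dist_def real_sqrt_mult)
      qed
      have "((\<lambda>\<epsilon>::real. \<epsilon> * sqrt I) \<longlongrightarrow> 0 * sqrt I) (at_right 0)" by (intro tendsto_intros)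
      then have "\<forall>\<^sub>F \<epsilon> in at_right 0. \<epsilon> * sqrt I < r" using r by (intro order_tendstoD(2)) auto
      \<comment> \<open>Minimality makes the cost difference nonnegative, so the quotients are at
        least \<open>- ?Lin\<close>; as they tend to 0, \<open>?Lin\<close> is nonnegative.\<close>
      then have "\<forall>\<^sub>F \<epsilon> in at_right 0. - ?Lin \<le> (Jinf \<mu>0 K f g y0 T P z (?u \<epsilon>) - Jinf \<mu>0 K f g y0 T P z us - \<epsilon> * ?Lin) / \<epsilon>"
        using eventually_at_right_less[of "0::real"] eventually_at_right_real[OF zero_less_one]
      proof eventually_elim
        case (elim \<epsilon>)
        then have \<epsilon>: "0 < \<epsilon>" "\<epsilon> \<le> 1" by auto
        have "Jinf \<mu>0 K f g y0 T P z us \<le> Jinf \<mu>0 K f g y0 T P z (?u \<epsilon>)"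
          by (rule min[OF adm[OF \<epsilon>]]) (use dist[OF \<epsilon>(1)] elim in simp)
        then have "(- ?Lin) * \<epsilon> \<le> Jinf \<mu>0 K f g y0 T P z (?u \<epsilon>) - Jinf \<mu>0 K f g y0 T P z us - \<epsilon> * ?Lin"
          by (simp add: mult.commute)
        then show ?case by (simp only: pos_le_divide_eq[OF \<epsilon>(1)])
      qed
      from tendsto_lowerbound[OF lim this] show "0 \<le> ?Lin" by simp
    qed
  qed
qed

end
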